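(* Let $T$ be an ergodic invertible measure-preserving transformation of an infinite standard probability space $(X,\mu)$. Then each of the two groups $$\mathrm{Aut}(T):=\{S\in \mathrm{Aut}(X,\mu)\ :\ STS^{-1}=T\},\qquad \mathrm{Aut}^{\pm}(T):=\{S\in \mathrm{Aut}(X,\mu)\ :\ STS^{-1}=T \text{ or } STS^{-1}=T^{-1}\}$$ is realizable as the automorphism group of an ergodic graphing: there are ergodic graphings $\Gamma_1,\Gamma_2$ with $\mathrm{Aut}(\Gamma_1)\cong \mathrm{Aut}(T)$ and $\mathrm{Aut}(\Gamma_2)\cong\mathrm{Aut}^{\pm}(T)$. In particular, there are ergodic graphings $\Gamma$ for which $\mathrm{Aut}(\Gamma)$ carries no Hausdorff compact topology making it a topological group; for instance, $\mathrm{Aut}(\Gamma)$ can be countably infinite.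
   Context: Standard probability space: a complete probability space isomorphic (mod null sets) to an interval with Lebesgue measure together with at most countably many point masses. It is infinite if it does not reduce, modulo null sets, to finitely many atoms. $\mathrm{Aut}(X,\mu)$ is the group of invertible measure-preserving transformations of $(X,\mu)$, identified when they agree almost everywhere (equivalently, automorphisms of the measure algebra). Graphing: a tuple $\Gamma=(V,\mathcal B,E,\mu)$ where $(V,\mathcal B,\mu)$ is a standard probability space and $E\subseteq V\times V$ is a Borel symmetric edge set making $(V,E)$ a loopless graph of bounded degree, such that for all $A,B\in\mathcal B$ $$\int_A \sharp(x\to B)\,d\mu(x)=\int_B\sharp(y\to A)\,d\mu(y),$$ where $\sharp(x\to B)$ is the number of edges from $x$ to points of $B$. The edge measure $\eta_\Gamma$ on $V\times V$ is determined by $\eta_\Gamma(A\times B)=\int_A\sharp(x\to B)\,d\mu(x)$. Automorphism of a graphing $\Gamma$: an automorphism of the measure algebra of $(\mathcal B,\mu)$ (equivalently, a $\mu$-preserving automorphism $\varphi$ of the space $V$, modulo null sets) which preserves the edge measure, i.e. $(\varphi\times\varphi)_*\eta_\Gamma=\eta_\Gamma$. These form the group $\mathrm{Aut}(\Gamma)$. A graphing is ergodic if every measurable union of connected components of $(V,E)$ has measure $0$ or $1$. The symbol $\cong$ means isomorphism of abstract groups. *)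

theory Defs
  imports "HOL-Probability.Probability" "HOL-Algebra.Group"
begin

text \<open>A measurable, measure-preserving map with a measurable, measure-preserving inverse, where
  the two maps need to be mutually inverse only off null sets.\<close>

definition iso_mod_null :: "'a measure \<Rightarrow> 'b measure \<Rightarrow> ('a \<Rightarrow> 'b) \<Rightarrow> bool" where
  "iso_mod_null M N f \<longleftrightarrow>
     f \<in> measurable M N \<and> distr M N f = N \<and>
     (\<exists>g\<in>measurable N M. distr N M g = M \<and>
        (AE x in M. g (f x) = x) \<and> (AE y in N. f (g y) = y))"

text \<open>Lebesgue measure on the set \<open>I\<close>, together with a point mass \<open>w a\<close> at each \<open>a \<in> D\<close>. The space
  is the whole real line, but everything outside \<open>I \<union> D\<close> is null.\<close>

definition lebesgue_with_atoms :: "real set \<Rightarrow> real set \<Rightarrow> (real \<Rightarrow> ennreal) \<Rightarrow> real measure" where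
  "lebesgue_with_atoms I D w =
     measure_of UNIV (sets lebesgue)
       (\<lambda>A. emeasure lebesgue (A \<inter> I) + (\<integral>\<^sup>+ a. w a * indicator A a \<partial>count_space D))"

definition standard_prob_space :: "'a measure \<Rightarrow> bool" where
  "standard_prob_space M \<longleftrightarrow>
     prob_space M \<and> complete_measure M \<and>
     (\<exists>I D w f. is_interval I \<and> countable D \<and> iso_mod_null M (lebesgue_with_atoms I D w) f)"

text \<open>In a standard probability space every atom is, modulo null sets, a single point.\<close>

definition infinite_prob_space :: "'a measure \<Rightarrow> bool" where
  "infinite_prob_space M \<longleftrightarrow> \<not> (\<exists>F. finite F \<and> (AE x in M. x \<in> F))"

definition mp_auts :: "'a measure \<Rightarrow> ('a \<Rightarrow> 'a) set" where
  "mp_auts M = {f. iso_mod_null M M f}"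

definition aut_class :: "'a measure \<Rightarrow> ('a \<Rightarrow> 'a) \<Rightarrow> ('a \<Rightarrow> 'a) set" where
  "aut_class M f = {g \<in> mp_auts M. AE x in M. f x = g x}"

definition aut_group :: "'a measure \<Rightarrow> ('a \<Rightarrow> 'a) set monoid" where
  "aut_group M =
     \<lparr>carrier = aut_class M ` mp_auts M,
      mult = (\<lambda>A B. \<Union>f\<in>A. \<Union>g\<in>B. aut_class M (f \<circ> g)),
      one = aut_class M id\<rparr>"

definition ergodic_aut :: "'a measure \<Rightarrow> ('a \<Rightarrow> 'a) \<Rightarrow> bool" where
  "ergodic_aut M T \<longleftrightarrow>
     T \<in> mp_auts M \<and>
     (\<forall>A\<in>sets M. T -` A \<inter> space M = A \<longrightarrow> measure M A = 0 \<or> measure M A = 1)"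

definition aut_T :: "'a measure \<Rightarrow> ('a \<Rightarrow> 'a) \<Rightarrow> ('a \<Rightarrow> 'a) set monoid" where
  "aut_T M T = (let G = aut_group M; t = aut_class M T in
     G\<lparr>carrier := {s \<in> carrier G. s \<otimes>\<^bsub>G\<^esub> t \<otimes>\<^bsub>G\<^esub> inv\<^bsub>G\<^esub> s = t}\<rparr>)"

definition aut_pm_T :: "'a measure \<Rightarrow> ('a \<Rightarrow> 'a) \<Rightarrow> ('a \<Rightarrow> 'a) set monoid" where
  "aut_pm_T M T = (let G = aut_group M; t = aut_class M T in
     G\<lparr>carrier := {s \<in> carrier G. s \<otimes>\<^bsub>G\<^esub> t \<otimes>\<^bsub>G\<^esub> inv\<^bsub>G\<^esub> s = t \<or>
                                  s \<otimes>\<^bsub>G\<^esub> t \<otimes>\<^bsub>G\<^esub> inv\<^bsub>G\<^esub> s = inv\<^bsub>G\<^esub> t}\<rparr>)"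

definition edges_to :: "('a \<times> 'a) set \<Rightarrow> 'a \<Rightarrow> 'a set \<Rightarrow> nat" where
  "edges_to E x B = card {y \<in> B. (x, y) \<in> E}"

text \<open>A standard probability space is complete, so ``Borel'' refers to an underlying Polish
  topology whose Borel measure has the given measure as its completion.\<close>

definition borel_edge_set :: "'a measure \<Rightarrow> ('a \<times> 'a) set \<Rightarrow> bool" where
  "borel_edge_set M E \<longleftrightarrow>
     (\<exists>X N. completely_metrizable_space X \<and> second_countable X \<and>
            space N = topspace X \<and> sets N = sigma_sets (topspace X) {U. openin X U} \<and>
            M = completion N \<and> E \<in> sets (N \<Otimes>\<^sub>M N))"

text \<open>Measurability of the counting functions is automatic for Borel edge sets of bounded degree
  (Lusin--Novikov) that satisfy the mass transport identity; it is listed so that the integrals in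
  that identity are visibly meaningful.\<close>

definition graphing :: "'a measure \<Rightarrow> ('a \<times> 'a) set \<Rightarrow> bool" where
  "graphing M E \<longleftrightarrow>
     standard_prob_space M \<and>
     borel_edge_set M E \<and>
     sym E \<and> irrefl E \<and>
     (\<exists>d. \<forall>x\<in>space M. finite (E `` {x}) \<and> card (E `` {x}) \<le> d) \<and>
     (\<forall>B\<in>sets M. (\<lambda>x. edges_to E x B) \<in> measurable M (count_space UNIV)) \<and>
     (\<forall>A\<in>sets M. \<forall>B\<in>sets M.
        (\<integral>\<^sup>+x\<in>A. of_nat (edges_to E x B) \<partial>M) = (\<integral>\<^sup>+y\<in>B. of_nat (edges_to E y A) \<partial>M))"

definition edge_measure :: "'a measure \<Rightarrow> ('a \<times> 'a) set \<Rightarrow> ('a \<times> 'a) measure" where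
  "edge_measure M E =
     measure_of (space M \<times> space M) (sets (M \<Otimes>\<^sub>M M))
       (\<lambda>W. \<integral>\<^sup>+x. of_nat (edges_to E x (Pair x -` W)) \<partial>M)"

text \<open>Preservation of the edge measure does not depend on the representative: the marginals of the
  edge measure of a graphing are absolutely continuous with respect to \<open>M\<close>.\<close>

definition graphing_aut_group :: "'a measure \<Rightarrow> ('a \<times> 'a) set \<Rightarrow> ('a \<Rightarrow> 'a) set monoid" where
  "graphing_aut_group M E = (aut_group M)
     \<lparr>carrier := {s \<in> carrier (aut_group M).
        \<forall>\<phi>\<in>s. distr (edge_measure M E) (M \<Otimes>\<^sub>M M) (map_prod \<phi> \<phi>) = edge_measure M E}\<rparr>"

definition components :: "'a measure \<Rightarrow> ('a \<times> 'a) set \<Rightarrow> 'a set set" where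
  "components M E = {E\<^sup>* `` {x} | x. x \<in> space M}"

definition ergodic_graphing :: "'a measure \<Rightarrow> ('a \<times> 'a) set \<Rightarrow> bool" where
  "ergodic_graphing M E \<longleftrightarrow>
     graphing M E \<and>
     (\<forall>C\<subseteq>components M E. \<Union>C \<in> sets M \<longrightarrow> measure M (\<Union>C) = 0 \<or> measure M (\<Union>C) = 1)"

definition group_topology :: "('a, 'b) monoid_scheme \<Rightarrow> 'a topology \<Rightarrow> bool" where
  "group_topology G X \<longleftrightarrow>
     topspace X = carrier G \<and>
     continuous_map (prod_topology X X) X (\<lambda>(a, b). a \<otimes>\<^bsub>G\<^esub> b) \<and>
     continuous_map X X (\<lambda>a. inv\<^bsub>G\<^esub> a)"

lemma emeasure_lebesgue_with_atoms:
  assumes "I \<in> sets lebesgue" "A \<in> sets lebesgue"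
  shows "emeasure (lebesgue_with_atoms I D w) A =
    emeasure lebesgue (A \<inter> I) + (\<integral>\<^sup>+ a. w a * indicator A a \<partial>count_space D)"
  unfolding lebesgue_with_atoms_def
proof (rule emeasure_measure_of_sigma)
  show "sigma_algebra UNIV (sets (lebesgue :: real measure))"
    using sets.sigma_algebra_axioms[of "lebesgue :: real measure"] by simp
  show "positive (sets lebesgue)
    (\<lambda>A. emeasure lebesgue (A \<inter> I) + (\<integral>\<^sup>+ a. w a * indicator A a \<partial>count_space D))"
    by (simp add: positive_def)
  show "countably_additive (sets lebesgue)
    (\<lambda>A. emeasure lebesgue (A \<inter> I) + (\<integral>\<^sup>+ a. w a * indicator A a \<partial>count_space D))"
  proof (rule countably_additiveI)
    fix A :: "nat \<Rightarrow> real set"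
    assume A: "range A \<subseteq> sets lebesgue" "disjoint_family A"
    have 1: "(\<Sum>i. emeasure lebesgue (A i \<inter> I)) = emeasure lebesgue ((\<Union>i. A i) \<inter> I)"
    proof -
      have "range (\<lambda>i. A i \<inter> I) \<subseteq> sets lebesgue" using A assms by auto
      moreover have "disjoint_family (\<lambda>i. A i \<inter> I)"
        using A by (auto simp: disjoint_family_on_def)
      ultimately have "(\<Sum>i. emeasure lebesgue (A i \<inter> I)) = emeasure lebesgue (\<Union>i. A i \<inter> I)"
        by (rule suminf_emeasure)
      then show ?thesis by (simp add: Int_UN_distrib2)
    qed
    have "(\<Sum>i. \<integral>\<^sup>+ a. w a * indicator (A i) a \<partial>count_space D)
        = (\<integral>\<^sup>+ a. (\<Sum>i. w a * indicator (A i) a) \<partial>count_space D)"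
      by (rule nn_integral_suminf[symmetric]) auto
    also have "\<dots> = (\<integral>\<^sup>+ a. w a * indicator (\<Union>i. A i) a \<partial>count_space D)"
      by (intro nn_integral_cong) (simp only: ennreal_suminf_cmult suminf_indicator[OF A(2)])
    finally show "(\<Sum>i. emeasure lebesgue (A i \<inter> I) +
          (\<integral>\<^sup>+ a. w a * indicator (A i) a \<partial>count_space D)) =
        emeasure lebesgue ((\<Union>i. A i) \<inter> I) +
          (\<integral>\<^sup>+ a. w a * indicator (\<Union>i. A i) a \<partial>count_space D)"
      using 1 by (simp flip: suminf_add)
  qed
qed (use assms in auto)

lemma mp_autsD:
  assumes "f \<in> mp_auts M"
  shows "f \<in> measurable M M" "distr M M f = M"
  using assms by (auto simp: mp_auts_def iso_mod_null_def)

lemma AE_mp_auts: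
  assumes "f \<in> mp_auts M" "AE x in M. P x"
  shows "AE x in M. P (f x)"
  using assms mp_autsD[OF assms(1)] by (metis AE_distrD)

lemma mp_auts_id: "id \<in> mp_auts M"
  by (auto simp: mp_auts_def iso_mod_null_def id_def intro!: bexI[of _ "\<lambda>x. x"])

lemma mp_auts_inverse:
  assumes "f \<in> mp_auts M"
  obtains g where "g \<in> mp_auts M" "AE x in M. g (f x) = x" "AE x in M. f (g x) = x"
  using assms unfolding mp_auts_def iso_mod_null_def by blast

lemma mp_auts_comp:
  assumes f: "f \<in> mp_auts M" and g: "g \<in> mp_auts M"
  shows "f \<circ> g \<in> mp_auts M"
proof -
  obtain f' where f': "f' \<in> mp_auts M" "AE x in M. f' (f x) = x" "AE x in M. f (f' x) = x"
    using mp_auts_inverse[OF f] .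
  obtain g' where g': "g' \<in> mp_auts M" "AE x in M. g' (g x) = x" "AE x in M. g (g' x) = x"
    using mp_auts_inverse[OF g] .
  have mp: "h \<circ> k \<in> measurable M M \<and> distr M M (h \<circ> k) = M"
    if "h \<in> mp_auts M" "k \<in> mp_auts M" for h k
    using mp_autsD[OF that(1)] mp_autsD[OF that(2)] distr_distr[of h M M k M]
    by (auto intro: measurable_comp)
  have 1: "AE x in M. (g' \<circ> f') ((f \<circ> g) x) = x"
    using AE_mp_auts[OF g f'(2)] g'(2) by eventually_elim simp
  have 2: "AE x in M. (f \<circ> g) ((g' \<circ> f') x) = x"
    using AE_mp_auts[OF f'(1) g'(3)] f'(3) by eventually_elim simp
  show ?thesis
    unfolding mp_auts_def iso_mod_null_def
    using mp[OF f g] mp[OF g'(1) f'(1)] 1 2 by blast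
qed

lemma aut_class_eq_iff:
  assumes "f \<in> mp_auts M" "g \<in> mp_auts M"
  shows "aut_class M f = aut_class M g \<longleftrightarrow> (AE x in M. f x = g x)"
proof
  assume "aut_class M f = aut_class M g"
  moreover have "g \<in> aut_class M g" using assms by (simp add: aut_class_def)
  ultimately show "AE x in M. f x = g x" by (auto simp: aut_class_def)
next
  assume *: "AE x in M. f x = g x"
  have "(AE x in M. f x = h x) \<longleftrightarrow> (AE x in M. g x = h x)" for h
    by (rule eventually_cong[OF *]) simp
  then show "aut_class M f = aut_class M g" by (simp add: aut_class_def)
qed

lemma aut_group_mult:
  assumes f: "f \<in> mp_auts M" and g: "g \<in> mp_auts M"
  shows "aut_class M f \<otimes>\<^bsub>aut_group M\<^esub> aut_class M g = aut_class M (f \<circ> g)"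
proof -
  have *: "aut_class M (f' \<circ> g') = aut_class M (f \<circ> g)"
    if "f' \<in> aut_class M f" "g' \<in> aut_class M g" for f' g'
  proof -
    have f': "f' \<in> mp_auts M" "AE x in M. f x = f' x" and g': "g' \<in> mp_auts M" "AE x in M. g x = g' x"
      using that by (auto simp: aut_class_def)
    have "AE x in M. (f' \<circ> g') x = (f \<circ> g) x"
      using AE_mp_auts[OF g f'(2)] g'(2) by eventually_elim simp
    then show ?thesis
      by (subst aut_class_eq_iff) (auto intro: mp_auts_comp f g f' g')
  qed
  have "f \<in> aut_class M f" "g \<in> aut_class M g" using f g by (auto simp: aut_class_def)
  then have ne: "aut_class M f \<noteq> {}" "aut_class M g \<noteq> {}" by blast+
  have "aut_class M f \<otimes>\<^bsub>aut_group M\<^esub> aut_class M g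
      = (\<Union>f'\<in>aut_class M f. \<Union>g'\<in>aut_class M g. aut_class M (f' \<circ> g'))"
    by (simp add: aut_group_def)
  also have "\<dots> = (\<Union>f'\<in>aut_class M f. \<Union>g'\<in>aut_class M g. aut_class M (f \<circ> g))"
    by (intro SUP_cong refl *)
  also have "\<dots> = aut_class M (f \<circ> g)" using ne by simp
  finally show ?thesis .
qed

lemma group_aut_group: "group (aut_group M)"
proof (rule groupI)
  show "\<one>\<^bsub>aut_group M\<^esub> \<in> carrier (aut_group M)"
    by (simp add: aut_group_def mp_auts_id)
next
  fix a b assume "a \<in> carrier (aut_group M)" "b \<in> carrier (aut_group M)"
  then obtain f g where "f \<in> mp_auts M" "g \<in> mp_auts M" "a = aut_class M f" "b = aut_class M g"
    by (auto simp: aut_group_def)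
  then show "a \<otimes>\<^bsub>aut_group M\<^esub> b \<in> carrier (aut_group M)"
    by (simp add: aut_group_mult) (simp add: aut_group_def mp_auts_comp)
next
  fix a b c assume "a \<in> carrier (aut_group M)" "b \<in> carrier (aut_group M)" "c \<in> carrier (aut_group M)"
  then obtain f g h where "f \<in> mp_auts M" "g \<in> mp_auts M" "h \<in> mp_auts M"
    "a = aut_class M f" "b = aut_class M g" "c = aut_class M h"
    by (auto simp: aut_group_def)
  then show "a \<otimes>\<^bsub>aut_group M\<^esub> b \<otimes>\<^bsub>aut_group M\<^esub> c = a \<otimes>\<^bsub>aut_group M\<^esub> (b \<otimes>\<^bsub>aut_group M\<^esub> c)"
    by (simp add: aut_group_mult mp_auts_comp comp_assoc)
next
  fix a assume "a \<in> carrier (aut_group M)"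
  then obtain f where f: "f \<in> mp_auts M" "a = aut_class M f"
    by (auto simp: aut_group_def)
  have one: "\<one>\<^bsub>aut_group M\<^esub> = aut_class M id" by (simp add: aut_group_def)
  show "\<one>\<^bsub>aut_group M\<^esub> \<otimes>\<^bsub>aut_group M\<^esub> a = a"
    using f by (simp add: one aut_group_mult mp_auts_id)
  obtain g where g: "g \<in> mp_auts M" "AE x in M. g (f x) = x"
    using mp_auts_inverse[OF f(1)] by metis
  have "aut_class M (g \<circ> f) = aut_class M id"
    using g f by (subst aut_class_eq_iff) (auto intro: mp_auts_comp mp_auts_id)
  then have "aut_class M g \<otimes>\<^bsub>aut_group M\<^esub> a = \<one>\<^bsub>aut_group M\<^esub>"
    using f g by (simp add: one aut_group_mult)
  moreover have "aut_class M g \<in> carrier (aut_group M)" using g by (simp add: aut_group_def)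
  ultimately show "\<exists>y\<in>carrier (aut_group M). y \<otimes>\<^bsub>aut_group M\<^esub> a = \<one>\<^bsub>aut_group M\<^esub>" by blast
qed

lemma edges_to_finite:
  assumes "graphing M E" "x \<in> space M"
  shows "finite {y \<in> B. (x, y) \<in> E}"
proof -
  have "finite (E `` {x})" using assms by (auto simp: graphing_def)
  then show ?thesis by (rule rev_finite_subset) auto
qed

lemma edges_to_UN:
  assumes "graphing M E" "x \<in> space M" "disjoint_family A"
  shows "(\<Sum>i::nat. of_nat (edges_to E x (A i)) :: ennreal) = of_nat (edges_to E x (\<Union>i. A i))"
proof -
  have eq: "of_nat (edges_to E x B) = emeasure (count_space (E `` {x})) (B \<inter> E `` {x})" for B
  proof -
    have "{y \<in> B. (x, y) \<in> E} = B \<inter> E `` {x}" by auto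
    then show ?thesis using edges_to_finite[OF assms(1,2), of B]
      by (simp add: edges_to_def)
  qed
  have "(\<Sum>i. emeasure (count_space (E `` {x})) (A i \<inter> E `` {x}))
      = emeasure (count_space (E `` {x})) (\<Union>i. A i \<inter> E `` {x})"
    using assms(3) by (intro suminf_emeasure) (auto simp: disjoint_family_on_def)
  then show ?thesis by (simp add: eq Int_UN_distrib2)
qed

lemma measurable_edges_to:
  assumes G: "graphing M E" and W: "W \<in> sets (M \<Otimes>\<^sub>M M)"
  shows "(\<lambda>x. of_nat (edges_to E x (Pair x -` W)) :: ennreal) \<in> borel_measurable M"
proof -
  have base: "(\<lambda>x. of_nat (edges_to E x B) :: ennreal) \<in> borel_measurable M"
    if "B \<in> sets M" for B
  proof -
    have "(\<lambda>x. edges_to E x B) \<in> measurable M (count_space UNIV)"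
      using G that by (auto simp: graphing_def)
    then show ?thesis by (rule measurable_compose) simp
  qed
  show ?thesis
    using Int_stable_pair_measure_generator pair_measure_closed W
    unfolding sets_pair_measure
  proof (induction rule: sigma_sets_induct_disjoint)
    case (basic W)
    then obtain A B where W: "W = A \<times> B" "A \<in> sets M" "B \<in> sets M" by auto
    have "(\<lambda>x. of_nat (edges_to E x (Pair x -` W)) :: ennreal) =
        (\<lambda>x. of_nat (edges_to E x B) * indicator A x)"
      by (auto simp: W edges_to_def indicator_def fun_eq_iff)
    with base[OF W(3)] W(2) show ?case by simp
  next
    case empty
    show ?case by (simp add: edges_to_def)
  next
    case (compl W)
    have eq: "of_nat (edges_to E x (Pair x -` (space M \<times> space M - W))) =
        of_nat (edges_to E x (space M)) - (of_nat (edges_to E x (Pair x -` W)) :: ennreal)"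
      if x: "x \<in> space M" for x
    proof -
      have "W \<subseteq> space M \<times> space M"
        using compl(1) sets.sets_into_space[of W "M \<Otimes>\<^sub>M M"]
        by (simp add: sets_pair_measure space_pair_measure)
      then have sub: "{y \<in> Pair x -` W. (x, y) \<in> E} \<subseteq> {y \<in> space M. (x, y) \<in> E}" by auto
      have "{y \<in> Pair x -` (space M \<times> space M - W). (x, y) \<in> E} =
          {y \<in> space M. (x, y) \<in> E} - {y \<in> Pair x -` W. (x, y) \<in> E}" using x by auto
      then have "edges_to E x (Pair x -` (space M \<times> space M - W)) =
          edges_to E x (space M) - edges_to E x (Pair x -` W)"
        using sub edges_to_finite[OF G x, of "Pair x -` W"]
        by (simp add: edges_to_def card_Diff_subset)
      then show ?thesis
        by (metis ennreal_of_nat_eq_real_of_nat ennreal_minus of_nat_0_le_iff of_nat_diff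
            card_mono[OF edges_to_finite[OF G x] sub] edges_to_def)
    qed
    have "(\<lambda>x. of_nat (edges_to E x (space M)) - (of_nat (edges_to E x (Pair x -` W)) :: ennreal))
        \<in> borel_measurable M"
      using base[OF sets.top] compl(2) by simp
    then show ?case by (simp add: eq cong: measurable_cong)
  next
    case (union W)
    have eq: "of_nat (edges_to E x (Pair x -` (\<Union>i. W i))) =
        (\<Sum>i. of_nat (edges_to E x (Pair x -` W i)) :: ennreal)" if "x \<in> space M" for x
    proof -
      have "disjoint_family (\<lambda>i. Pair x -` W i)"
        using union(1) by (auto simp: disjoint_family_on_def)
      from edges_to_UN[OF G that this] show ?thesis by (simp add: vimage_UN)
    qed
    have "(\<lambda>x. \<Sum>i. of_nat (edges_to E x (Pair x -` W i)) :: ennreal) \<in> borel_measurable M"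
      using union(3) by (rule borel_measurable_suminf_order)
    then show ?case by (simp add: eq cong: measurable_cong)
  qed
qed

lemma emeasure_edge_measure:
  assumes G: "graphing M E" and W: "W \<in> sets (M \<Otimes>\<^sub>M M)"
  shows "emeasure (edge_measure M E) W = (\<integral>\<^sup>+x. of_nat (edges_to E x (Pair x -` W)) \<partial>M)"
  unfolding edge_measure_def
proof (rule emeasure_measure_of_sigma)
  show "sigma_algebra (space M \<times> space M) (sets (M \<Otimes>\<^sub>M M))"
    using sets.sigma_algebra_axioms[of "M \<Otimes>\<^sub>M M"] by (simp add: space_pair_measure)
  show "positive (sets (M \<Otimes>\<^sub>M M)) (\<lambda>W. \<integral>\<^sup>+x. of_nat (edges_to E x (Pair x -` W)) \<partial>M)"
    by (simp add: positive_def edges_to_def)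
  show "countably_additive (sets (M \<Otimes>\<^sub>M M)) (\<lambda>W. \<integral>\<^sup>+x. of_nat (edges_to E x (Pair x -` W)) \<partial>M)"
  proof (rule countably_additiveI)
    fix A :: "nat \<Rightarrow> ('a \<times> 'a) set"
    assume A: "range A \<subseteq> sets (M \<Otimes>\<^sub>M M)" "disjoint_family A"
    have "(\<Sum>i. \<integral>\<^sup>+x. of_nat (edges_to E x (Pair x -` A i)) \<partial>M)
        = (\<integral>\<^sup>+x. (\<Sum>i. of_nat (edges_to E x (Pair x -` A i))) \<partial>M)"
      using A by (intro nn_integral_suminf[symmetric] measurable_edges_to[OF G]) auto
    also have "\<dots> = (\<integral>\<^sup>+x. of_nat (edges_to E x (Pair x -` (\<Union>i. A i))) \<partial>M)"
    proof (rule nn_integral_cong)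
      fix x assume "x \<in> space M"
      moreover have "disjoint_family (\<lambda>i. Pair x -` A i)"
        using A by (auto simp: disjoint_family_on_def)
      ultimately show "(\<Sum>i. of_nat (edges_to E x (Pair x -` A i))) =
          (of_nat (edges_to E x (Pair x -` (\<Union>i. A i))) :: ennreal)"
        using edges_to_UN[OF G] by (simp add: vimage_UN)
    qed
    finally show "(\<Sum>i. \<integral>\<^sup>+x. of_nat (edges_to E x (Pair x -` A i)) \<partial>M) =
        (\<integral>\<^sup>+x. of_nat (edges_to E x (Pair x -` (\<Union>i. A i))) \<partial>M)" .
  qed
qed (fact W)

lemma emeasure_edge_measure_Times:
  assumes G: "graphing M E" and "A \<in> sets M" "B \<in> sets M"
  shows "emeasure (edge_measure M E) (A \<times> B) = (\<integral>\<^sup>+x\<in>A. of_nat (edges_to E x B) \<partial>M)"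
  using assms
  by (subst emeasure_edge_measure)
    (auto simp: edges_to_def indicator_def intro!: nn_integral_cong)

end

theory Submission
  imports Defs
begin

text \<open>
  A graphing generated by finitely many measure-preserving bijections is preserved by \<open>\<phi>\<close> exactly if
  \<open>\<phi>\<close> maps the neighbours of almost every \<open>x\<close> onto the neighbours of \<open>\<phi> x\<close>. Hence, if \<open>S\<close> preserves
  the graph with edges \<open>{x, T x}\<close>, then \<open>S T x\<close> is \<open>T S x\<close> or \<open>T\<^sup>-\<^sup>1 S x\<close>; by aperiodicity the choice is
  \<open>T\<close>-invariant, so by ergodicity it is constant. To fix the orientation, a second copy of the space is
  added in which the copy of \<open>x\<close> is joined to \<open>x\<close>, \<open>T x\<close> and \<open>T\<^sup>3 x\<close>. The second copy can moreover carry
  the edges of an involution \<open>\<tau>\<close>, which restricts the automorphisms to those commuting with \<open>\<tau>\<close>.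

  For a countably infinite group take the Bernoulli shift \<open>T\<close> on \<open>{0,1}\<^sup>\<int>\<close> and
  \<open>\<tau> x = x'\<close> with \<open>x'\<^sub>3\<^sub>n = x\<^sub>3\<^sub>n + x\<^sub>3\<^sub>n\<^sub>+\<^sub>1\<close>. Commutators produce the maps adding to \<open>x\<^sub>0\<close> any sum of coordinates
  \<open>x\<^sub>1\<^sub>+\<^sub>3\<^sub>k\<close>, \<open>k \<ge> 0\<close>. If \<open>\<phi>\<close>, \<open>\<psi>\<close> commute with \<open>T\<close> and \<open>\<tau>\<close> and \<open>\<delta> = \<phi> - \<psi>\<close>, then all the sums
  \<open>\<delta>\<^sub>0 + \<Sum>\<^sub>k \<delta>\<^sub>1\<^sub>+\<^sub>3\<^sub>k\<close> are nonzero with the same probability \<open>p\<close>; averaging over them shows that \<open>p \<ge> 1/6\<close>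
  unless \<open>\<phi> = \<psi>\<close>. As the measure algebra is separable, the commutant is countable, and it contains the
  powers of \<open>T\<^sup>3\<close>.
\<close>

text \<open>A graphing is exact where an automorphism is vague: its edge set is Borel and symmetric
  at every point, while \<open>T\<close> is given modulo null sets. So \<open>T\<close> is carried
  to the unit interval, which works for every infinite standard space because ergodicity excludes
  atoms, and is replaced there by a Borel bijection with an exact inverse. One family of graphs on
  two copies of the interval then suffices. Its automorphisms are the maps that commute with
  \<open>\<tau>\<close> and either commute with \<open>T\<close> or, if the links allow it, invert
  \<open>T\<close>; the identity as \<open>\<tau>\<close> gives the two groups of the theorem.

  For a countable group, commuting with the Bernoulli shift is far too weak a condition, hence the
  extra involution. It is chosen so that, together with the shift, it generates maps that act
  linearly over the two-element field and collect into coordinate 0 the disagreements of two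
  commuting maps at many other coordinates. This yields a gap: distinct elements cannot be close to
  each other. Compactness fails because a countable compact Hausdorff group is finite.\<close>

lemma iso_mod_nullI:
  assumes f: "f \<in> measurable M N" "distr M N f = N" and g: "g \<in> measurable N M"
    and gf: "AE x in M. g (f x) = x" and fg: "AE y in N. f (g y) = y"
  shows "iso_mod_null M N f"
proof -
  \<comment> \<open>The inverse preserves measure automatically: pushing \<open>N\<close>, the image
    of \<open>M\<close> under \<open>f\<close>, forward by \<open>g\<close> gives the image of
    \<open>M\<close> under a map that is almost everywhere the identity.\<close>
  have "distr N M g = distr (distr M N f) M g" by (simp only: f(2))
  also have "\<dots> = distr M M (g \<circ> f)" using f g by (intro distr_distr)
  also have "\<dots> = distr M M (\<lambda>x. x)"
    by (rule distr_cong_AE[OF refl refl]) (use gf f(1) g in simp_all)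
  finally have "distr N M g = M" by (simp only: distr_id)
  then show ?thesis using assms unfolding iso_mod_null_def by blast
qed

lemma iso_mod_nullE:
  assumes "iso_mod_null M N f"
  obtains g where "f \<in> measurable M N" "distr M N f = N" "g \<in> measurable N M" "distr N M g = M"
    "AE x in M. g (f x) = x" "AE y in N. f (g y) = y"
  using assms unfolding iso_mod_null_def by blast

lemma AE_distr_eq:
  assumes "f \<in> measurable M N" "distr M N f = N" "AE x in N. P x"
  shows "AE x in M. P (f x)"
proof (rule AE_distrD[OF assms(1)])
  show "AE x in distr M N f. P x" using assms(3) by (simp only: assms(2))
qed

lemma iso_mod_null_trans:
  assumes f: "iso_mod_null M N f" and g: "iso_mod_null N L g"
  shows "iso_mod_null M L (g \<circ> f)"
proof -
  obtain f' where f': "f \<in> measurable M N" "distr M N f = N" "f' \<in> measurable N M" "distr N M f' = M"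
    "AE x in M. f' (f x) = x" "AE y in N. f (f' y) = y" using iso_mod_nullE[OF f] .
  obtain g' where g': "g \<in> measurable N L" "distr N L g = L" "g' \<in> measurable L N" "distr L N g' = N"
    "AE x in N. g' (g x) = x" "AE y in L. g (g' y) = y" using iso_mod_nullE[OF g] .
  show ?thesis
  proof (rule iso_mod_nullI[where g = "f' \<circ> g'"])
    show "g \<circ> f \<in> measurable M L" "f' \<circ> g' \<in> measurable L M"
      using measurable_comp[OF f'(1) g'(1)] measurable_comp[OF g'(3) f'(3)] by blast+
    show "distr M L (g \<circ> f) = L"
      using distr_distr[OF g'(1) f'(1)] by (simp only: f'(2) g'(2))
    show "AE x in M. (f' \<circ> g') ((g \<circ> f) x) = x"
      using AE_distr_eq[OF f'(1,2) g'(5)] f'(5) by eventually_elim simp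
    show "AE y in L. (g \<circ> f) ((f' \<circ> g') y) = y"
      using AE_distr_eq[OF g'(3,4) f'(6)] g'(6) by eventually_elim simp
  qed
qed

lemma iso_mod_null_sym:
  assumes f: "iso_mod_null M N f"
  obtains g where "iso_mod_null N M g" "AE x in M. g (f x) = x" "AE y in N. f (g y) = y"
proof -
  obtain f' where f': "f \<in> measurable M N" "distr M N f = N" "f' \<in> measurable N M" "distr N M f' = M"
    "AE x in M. f' (f x) = x" "AE y in N. f (f' y) = y" using iso_mod_nullE[OF f] .
  show thesis using iso_mod_nullI[OF f'(3,4,1,6,5)] f'(5,6) by (rule that)
qed

lemma mp_autsI:
  assumes "f \<in> measurable M M" "distr M M f = M" "g \<in> measurable M M"
    and "AE x in M. g (f x) = x" "AE y in M. f (g y) = y"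
  shows "f \<in> mp_auts M" "g \<in> mp_auts M"
proof -
  have 1: "iso_mod_null M M f" using assms by (rule iso_mod_nullI)
  obtain g' where g': "iso_mod_null M M g'" "AE y in M. f (g' y) = y"
    using iso_mod_null_sym[OF 1] by metis
  have g'm: "g' \<in> measurable M M" "distr M M g' = M" using g'(1) unfolding iso_mod_null_def by blast+
  have "AE y in M. g (f (g' y)) = g' y" using AE_distr_eq[OF g'm assms(4)] .
  then have "AE y in M. g y = g' y" using g'(2) by eventually_elim simp
  then have gM: "distr M M g = M"
    by (rule trans[OF distr_cong_AE[OF refl refl _ assms(3) g'm(1)] g'm(2)])
  show "f \<in> mp_auts M" using 1 unfolding mp_auts_def by simp
  show "g \<in> mp_auts M" using iso_mod_nullI[OF assms(3) gM assms(1,5,4)] unfolding mp_auts_def by simp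
qed

lemma mp_auts_cong_AE:
  assumes f: "f \<in> mp_auts M" and g: "g \<in> measurable M M" and eq: "AE x in M. f x = g x"
  shows "g \<in> mp_auts M"
proof -
  obtain f' where f': "f' \<in> mp_auts M" "AE x in M. f' (f x) = x" "AE x in M. f (f' x) = x"
    using mp_auts_inverse[OF f] .
  show ?thesis
  proof (rule mp_autsI)
    show "g \<in> measurable M M" "f' \<in> measurable M M" using g mp_autsD(1)[OF f'(1)] by blast+
    show "distr M M g = M" using distr_cong_AE[OF refl refl eq mp_autsD(1)[OF f] g] mp_autsD(2)[OF f] by (rule trans[OF sym])
    show "AE x in M. f' (g x) = x" using eq f'(2) by eventually_elim simp
    show "AE y in M. g (f' y) = y" using AE_mp_auts[OF f'(1) eq] f'(3) by eventually_elim simp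
  qed
qed

lemma mp_auts_funpow: "T \<in> mp_auts M \<Longrightarrow> T ^^ n \<in> mp_auts M"
  by (induction n) (auto intro: mp_auts_comp simp: mp_auts_id)

lemma mp_auts_emeasure_vimage:
  assumes "f \<in> mp_auts M" "A \<in> sets M"
  shows "emeasure M (f -` A \<inter> space M) = emeasure M A"
  using emeasure_distr[OF mp_autsD(1)[OF assms(1)] assms(2)] by (simp only: mp_autsD(2)[OF assms(1)])

lemma aut_class_self: "f \<in> mp_auts M \<Longrightarrow> f \<in> aut_class M f"
  by (simp add: aut_class_def)

text \<open>Aut(T), its \<plusminus> version and the automorphism group of a graphing all take this
  form, so that comparing them becomes a matter of maps instead of classes. A class belongs to the
  carrier as soon as one of its representatives satisfies \<open>P\<close>.\<close>

definition sub_aut :: "'a measure \<Rightarrow> (('a \<Rightarrow> 'a) \<Rightarrow> bool) \<Rightarrow> ('a \<Rightarrow> 'a) set monoid" where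
  "sub_aut M P = (aut_group M)\<lparr>carrier := aut_class M ` {S \<in> mp_auts M. P S}\<rparr>"

lemma carrier_sub_aut: "carrier (sub_aut M P) = aut_class M ` {S \<in> mp_auts M. P S}"
  by (simp add: sub_aut_def)

lemma mult_sub_aut:
  "S \<in> mp_auts M \<Longrightarrow> S' \<in> mp_auts M \<Longrightarrow>
    aut_class M S \<otimes>\<^bsub>sub_aut M P\<^esub> aut_class M S' = aut_class M (S \<circ> S')"
  using aut_group_mult[of S M S'] by (simp add: sub_aut_def)

lemma group_sub_aut:
  assumes id: "P id"
    and comp: "\<And>S R. S \<in> mp_auts M \<Longrightarrow> R \<in> mp_auts M \<Longrightarrow> P S \<Longrightarrow> P R \<Longrightarrow> P (S \<circ> R)"
    and inv: "\<And>S R. S \<in> mp_auts M \<Longrightarrow> R \<in> mp_auts M \<Longrightarrow> AE x in M. R (S x) = x \<Longrightarrow> AE x in M. S (R x) = x \<Longrightarrow>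
      P S \<Longrightarrow> P R"
  shows "group (sub_aut M P)"
proof -
  interpret G: group "aut_group M" by (rule group_aut_group)
  have one: "\<one>\<^bsub>aut_group M\<^esub> = aut_class M id" by (simp add: aut_group_def)
  have "subgroup (aut_class M ` {S \<in> mp_auts M. P S}) (aut_group M)"
  proof (rule G.subgroupI)
    show "aut_class M ` {S \<in> mp_auts M. P S} \<subseteq> carrier (aut_group M)" by (auto simp: aut_group_def)
    show "aut_class M ` {S \<in> mp_auts M. P S} \<noteq> {}" using id mp_auts_id by blast
  next
    fix s assume "s \<in> aut_class M ` {S \<in> mp_auts M. P S}"
    then obtain S where S: "S \<in> mp_auts M" "P S" "s = aut_class M S" by blast
    obtain R where R: "R \<in> mp_auts M" "AE x in M. R (S x) = x" "AE x in M. S (R x) = x"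
      using mp_auts_inverse[OF S(1)] .
    have "aut_class M (R \<circ> S) = aut_class M id"
      using R S(1) by (subst aut_class_eq_iff) (auto intro: mp_auts_comp mp_auts_id)
    then have "inv\<^bsub>aut_group M\<^esub> s = aut_class M R"
      using R S by (intro G.inv_equality) (auto simp: one aut_group_mult, auto simp: aut_group_def)
    then show "inv\<^bsub>aut_group M\<^esub> s \<in> aut_class M ` {S \<in> mp_auts M. P S}"
      using inv[OF S(1) R S(2)] R(1) by blast
  next
    fix s t assume "s \<in> aut_class M ` {S \<in> mp_auts M. P S}" "t \<in> aut_class M ` {S \<in> mp_auts M. P S}"
    then obtain S R where "S \<in> mp_auts M" "P S" "s = aut_class M S" "R \<in> mp_auts M" "P R" "t = aut_class M R"
      by blast
    then show "s \<otimes>\<^bsub>aut_group M\<^esub> t \<in> aut_class M ` {S \<in> mp_auts M. P S}"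
      using comp mp_auts_comp aut_group_mult by blast
  qed
  from G.subgroup_imp_group[OF this] show ?thesis by (simp add: sub_aut_def)
qed

text \<open>The isomorphism inverts \<open>\<Phi>\<close> on classes: a preimage is chosen, and
  \<open>eq\<close> makes its class independent of the choice. Multiplicativity is asked for almost
  everywhere, which is all that doubling and conjugation with an isomorphism modulo null sets
  provide.\<close>

lemma sub_aut_iso:
  assumes \<Phi>: "\<And>S. S \<in> mp_auts M \<Longrightarrow> \<Phi> S \<in> mp_auts M'"
    and eq: "\<And>S S'. S \<in> mp_auts M \<Longrightarrow> S' \<in> mp_auts M \<Longrightarrow>
      (AE x in M'. \<Phi> S x = \<Phi> S' x) \<longleftrightarrow> (AE x in M. S x = S' x)"
    and comp: "\<And>S S'. S \<in> mp_auts M \<Longrightarrow> S' \<in> mp_auts M \<Longrightarrow>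
      AE x in M'. \<Phi> (S \<circ> S') x = \<Phi> S (\<Phi> S' x)"
    and PQ: "\<And>S. S \<in> mp_auts M \<Longrightarrow> P S \<longleftrightarrow> Q (\<Phi> S)"
    and Q: "\<And>\<phi> \<phi>'. \<phi> \<in> mp_auts M' \<Longrightarrow> \<phi>' \<in> mp_auts M' \<Longrightarrow> AE x in M'. \<phi> x = \<phi>' x \<Longrightarrow> Q \<phi> \<Longrightarrow> Q \<phi>'"
    and surj: "\<And>\<phi>. \<phi> \<in> mp_auts M' \<Longrightarrow> Q \<phi> \<Longrightarrow> \<exists>S\<in>mp_auts M. AE x in M'. \<Phi> S x = \<phi> x"
  shows "sub_aut M' Q \<cong> sub_aut M P"
proof -
  define h where "h s = aut_class M (SOME S. S \<in> mp_auts M \<and> aut_class M' (\<Phi> S) = s)" for s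
  have h: "h (aut_class M' (\<Phi> S)) = aut_class M S" if S: "S \<in> mp_auts M" for S
  proof -
    let ?R = "SOME R. R \<in> mp_auts M \<and> aut_class M' (\<Phi> R) = aut_class M' (\<Phi> S)"
    have R: "?R \<in> mp_auts M \<and> aut_class M' (\<Phi> ?R) = aut_class M' (\<Phi> S)"
      by (rule someI[where x = S]) (use S in simp)
    then have "AE x in M'. \<Phi> ?R x = \<Phi> S x"
      using S \<Phi> aut_class_eq_iff by blast
    then have "AE x in M. ?R x = S x" using R S by (simp add: eq)
    then show ?thesis unfolding h_def using R S by (subst aut_class_eq_iff) auto
  qed
  have rep: "\<exists>S\<in>mp_auts M. P S \<and> s = aut_class M' (\<Phi> S)" if s: "s \<in> carrier (sub_aut M' Q)" for s
  proof -
    obtain \<phi> where \<phi>: "\<phi> \<in> mp_auts M'" "Q \<phi>" "s = aut_class M' \<phi>"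
      using s by (auto simp: carrier_sub_aut)
    then obtain S where S: "S \<in> mp_auts M" "AE x in M'. \<Phi> S x = \<phi> x" using surj by blast
    have S': "AE x in M'. \<phi> x = \<Phi> S x" using S(2) by eventually_elim simp
    have "P S" using PQ S Q[OF \<phi>(1) \<Phi>[OF S(1)] S' \<phi>(2)] by simp
    moreover have "s = aut_class M' (\<Phi> S)" using \<phi> S S' \<Phi> by (simp add: aut_class_eq_iff)
    ultimately show ?thesis using S by auto
  qed
  have hom: "h \<in> hom (sub_aut M' Q) (sub_aut M P)"
  proof (rule homI)
    fix s assume "s \<in> carrier (sub_aut M' Q)"
    then obtain S where "S \<in> mp_auts M" "P S" "s = aut_class M' (\<Phi> S)" using rep by blast
    then show "h s \<in> carrier (sub_aut M P)" by (auto simp: h carrier_sub_aut)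
  next
    fix s t assume "s \<in> carrier (sub_aut M' Q)" "t \<in> carrier (sub_aut M' Q)"
    then obtain S R where SR: "S \<in> mp_auts M" "s = aut_class M' (\<Phi> S)"
      "R \<in> mp_auts M" "t = aut_class M' (\<Phi> R)" using rep by meson
    have "AE x in M'. (\<Phi> S \<circ> \<Phi> R) x = \<Phi> (S \<circ> R) x"
      using comp[OF SR(1,3)] by eventually_elim simp
    then have "s \<otimes>\<^bsub>sub_aut M' Q\<^esub> t = aut_class M' (\<Phi> (S \<circ> R))"
      using SR \<Phi> by (simp add: mult_sub_aut aut_class_eq_iff mp_auts_comp)
    then show "h (s \<otimes>\<^bsub>sub_aut M' Q\<^esub> t) = h s \<otimes>\<^bsub>sub_aut M P\<^esub> h t"
      using SR by (simp add: h mult_sub_aut mp_auts_comp)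
  qed
  have "bij_betw h (carrier (sub_aut M' Q)) (carrier (sub_aut M P))"
  proof (rule bij_betwI')
    fix s t assume "s \<in> carrier (sub_aut M' Q)" "t \<in> carrier (sub_aut M' Q)"
    then obtain S R where SR: "S \<in> mp_auts M" "s = aut_class M' (\<Phi> S)"
      "R \<in> mp_auts M" "t = aut_class M' (\<Phi> R)" using rep by meson
    then show "h s = h t \<longleftrightarrow> s = t"
      using \<Phi> eq by (simp add: h aut_class_eq_iff)
  next
    fix s assume "s \<in> carrier (sub_aut M' Q)"
    then show "h s \<in> carrier (sub_aut M P)" using hom by (auto simp: hom_def)
  next
    fix t assume "t \<in> carrier (sub_aut M P)"
    then obtain S where S: "S \<in> mp_auts M" "P S" "t = aut_class M S" by (auto simp: carrier_sub_aut)
    then have "aut_class M' (\<Phi> S) \<in> carrier (sub_aut M' Q)" using \<Phi> PQ by (auto simp: carrier_sub_aut)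
    then show "\<exists>s\<in>carrier (sub_aut M' Q). t = h s" using S h by metis
  qed
  then show ?thesis using hom by (auto simp: is_iso_def iso_def)
qed

section \<open>Commutation and inversion as conditions on representatives\<close>

lemma inv_conj_iff:
  assumes "group G" "s \<in> carrier G" "t \<in> carrier G"
  shows "s \<otimes>\<^bsub>G\<^esub> t \<otimes>\<^bsub>G\<^esub> inv\<^bsub>G\<^esub> s = t \<longleftrightarrow> s \<otimes>\<^bsub>G\<^esub> t = t \<otimes>\<^bsub>G\<^esub> s"
    and "s \<otimes>\<^bsub>G\<^esub> t \<otimes>\<^bsub>G\<^esub> inv\<^bsub>G\<^esub> s = inv\<^bsub>G\<^esub> t \<longleftrightarrow> t \<otimes>\<^bsub>G\<^esub> (s \<otimes>\<^bsub>G\<^esub> t) = s"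
proof -
  interpret group G by fact
  show "s \<otimes>\<^bsub>G\<^esub> t \<otimes>\<^bsub>G\<^esub> inv\<^bsub>G\<^esub> s = t \<longleftrightarrow> s \<otimes>\<^bsub>G\<^esub> t = t \<otimes>\<^bsub>G\<^esub> s"
    using inv_solve_right[OF assms(3) m_closed[OF assms(2,3)] assms(2)] by (simp only: eq_commute[of t "s \<otimes>\<^bsub>G\<^esub> t \<otimes>\<^bsub>G\<^esub> inv\<^bsub>G\<^esub> s"])
  show "s \<otimes>\<^bsub>G\<^esub> t \<otimes>\<^bsub>G\<^esub> inv\<^bsub>G\<^esub> s = inv\<^bsub>G\<^esub> t \<longleftrightarrow> t \<otimes>\<^bsub>G\<^esub> (s \<otimes>\<^bsub>G\<^esub> t) = s"
    using inv_solve_right[OF inv_closed[OF assms(3)] m_closed[OF assms(2,3)] assms(2)]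
      inv_solve_left[OF m_closed[OF assms(2,3)] assms(3,2)] by metis
qed

definition commutes_with :: "'a measure \<Rightarrow> ('a \<Rightarrow> 'a) \<Rightarrow> ('a \<Rightarrow> 'a) \<Rightarrow> bool" where
  "commutes_with M T S \<longleftrightarrow> (AE x in M. S (T x) = T (S x))"

text \<open>The relation \<open>S T S\<^sup>-\<^sup>1 = T\<^sup>-\<^sup>1\<close> solved for
  \<open>S\<close>, so that no representative of an inverse class enters.\<close>

definition inverts :: "'a measure \<Rightarrow> ('a \<Rightarrow> 'a) \<Rightarrow> ('a \<Rightarrow> 'a) \<Rightarrow> bool" where
  "inverts M T S \<longleftrightarrow> (AE x in M. T (S (T x)) = S x)"

lemma carrier_aut_group: "carrier (aut_group M) = aut_class M ` mp_auts M"
  by (simp add: aut_group_def)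

lemma commutes_with_class_iff:
  assumes "T \<in> mp_auts M" "S \<in> mp_auts M"
  shows "aut_class M S \<otimes>\<^bsub>aut_group M\<^esub> aut_class M T \<otimes>\<^bsub>aut_group M\<^esub> inv\<^bsub>aut_group M\<^esub> aut_class M S
      = aut_class M T \<longleftrightarrow> commutes_with M T S"
    and "aut_class M S \<otimes>\<^bsub>aut_group M\<^esub> aut_class M T \<otimes>\<^bsub>aut_group M\<^esub> inv\<^bsub>aut_group M\<^esub> aut_class M S
      = inv\<^bsub>aut_group M\<^esub> aut_class M T \<longleftrightarrow> inverts M T S"
  using assms by (simp_all add: inv_conj_iff group_aut_group carrier_aut_group)
    (simp_all add: aut_group_mult mp_auts_comp aut_class_eq_iff commutes_with_def inverts_def)

lemma sub_aut_eqI: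
  assumes "\<And>S. S \<in> mp_auts M \<Longrightarrow> R (aut_class M S) \<longleftrightarrow> P S"
  shows "(aut_group M)\<lparr>carrier := {s \<in> carrier (aut_group M). R s}\<rparr> = sub_aut M P"
proof -
  have "{s \<in> carrier (aut_group M). R s} = aut_class M ` {S \<in> mp_auts M. P S}"
    using assms by (auto simp: carrier_aut_group)
  then show ?thesis by (simp only: sub_aut_def)
qed

lemma aut_T_eq:
  assumes "T \<in> mp_auts M"
  shows "aut_T M T = sub_aut M (commutes_with M T)"
    and "aut_pm_T M T = sub_aut M (\<lambda>S. commutes_with M T S \<or> inverts M T S)"
  unfolding aut_T_def aut_pm_T_def Let_def
  by (rule sub_aut_eqI, simp only: commutes_with_class_iff[OF assms])+

lemma ball_aut_class:
  assumes f: "f \<in> mp_auts M"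
    and Q: "\<And>g. g \<in> mp_auts M \<Longrightarrow> AE x in M. f x = g x \<Longrightarrow> Q f \<longleftrightarrow> Q g"
  shows "(\<forall>\<phi>\<in>aut_class M f. Q \<phi>) \<longleftrightarrow> Q f"
proof
  assume "\<forall>\<phi>\<in>aut_class M f. Q \<phi>"
  then show "Q f" using aut_class_self[OF f] by blast
next
  assume "Q f"
  then show "\<forall>\<phi>\<in>aut_class M f. Q \<phi>" using Q unfolding aut_class_def by blast
qed

text \<open>Ergodicity extends from strictly invariant sets to sets invariant modulo null sets: the set of
  points returning infinitely often to \<open>A\<close> is strictly invariant.\<close>

definition ae_ergodic :: "'a measure \<Rightarrow> ('a \<Rightarrow> 'a) \<Rightarrow> bool" where
  "ae_ergodic M T \<longleftrightarrow> (\<forall>A\<in>sets M. (AE x in M. T x \<in> A \<longleftrightarrow> x \<in> A) \<longrightarrow> measure M A = 0 \<or> measure M A = 1)"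

lemma ergodic_aut_imp_ae_ergodic:
  assumes "ergodic_aut M T"
  shows "ae_ergodic M T"
  unfolding ae_ergodic_def
proof (intro ballI impI)
  fix A assume A: "A \<in> sets M" and inv: "AE x in M. T x \<in> A \<longleftrightarrow> x \<in> A"
  have T: "T \<in> mp_auts M" using assms by (simp add: ergodic_aut_def)
  note [measurable] = mp_autsD(1)[OF T] A mp_autsD(1)[OF mp_auts_funpow[OF T]]
  define B where "B = {x \<in> space M. \<exists>\<^sub>\<infinity>n. (T ^^ n) x \<in> A}"
  have B: "B \<in> sets M" unfolding B_def INFM_nat by measurable
  have shift: "(\<exists>\<^sub>\<infinity>n. (T ^^ n) (T x) \<in> A) \<longleftrightarrow> (\<exists>\<^sub>\<infinity>n. (T ^^ n) x \<in> A)" for x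
  proof -
    have "(T ^^ n) (T x) = (T ^^ Suc n) x" for n by (simp add: funpow_swap1)
    then show ?thesis unfolding frequently_def
      using eventually_sequentially_Suc[of "\<lambda>n. (T ^^ n) x \<notin> A"] by (simp add: cofinite_eq_sequentially)
  qed
  have "T -` B \<inter> space M = B"
    using measurable_space[OF mp_autsD(1)[OF T]] by (auto simp: B_def shift)
  then have m: "measure M B = 0 \<or> measure M B = 1" using assms B by (auto simp: ergodic_aut_def)
  have "AE x in M. \<forall>n. (T ^^ n) x \<in> A \<longleftrightarrow> x \<in> A"
  proof (subst AE_all_countable, rule allI)
    fix n show "AE x in M. (T ^^ n) x \<in> A \<longleftrightarrow> x \<in> A"
    proof (induction n)
      case (Suc n)
      from Suc AE_mp_auts[OF mp_auts_funpow[OF T, of n] inv] show ?case by eventually_elim simp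
    qed simp
  qed
  then have "AE x in M. x \<in> B \<longleftrightarrow> x \<in> A"
    using AE_space
  proof eventually_elim
    case (elim x)
    then show ?case by (simp add: B_def)
  qed
  then have "measure M B = measure M A" using A B by (intro measure_eq_AE) auto
  then show "measure M A = 0 \<or> measure M A = 1" using m by simp
qed

text \<open>Measure preservation makes preimages of null sets null; this is what keeps a measurable
  map measurable when both sides are completed.\<close>

lemma measure_preserving_completion:
  assumes h: "h \<in> measurable K K'" "distr K K' h = K'"
  shows "h \<in> measurable (completion K) (completion K')"
    and "distr (completion K) (completion K') h = completion K'"
proof -
  have null: "null_sets (distr (completion K) K' h) = null_sets K'"
    by (simp only: distr_completion[OF h(1)] h(2))
  have m: "h \<in> completion K \<rightarrow>\<^sub>M K'" using h(1) by (rule measurable_completion)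
  show "h \<in> measurable (completion K) (completion K')"
    using m by (rule completion.measurable_completion2) (simp only: null)
  have "completion (distr (completion K) K' h) = distr (completion K) (completion K') h"
    using m null by (rule completion.completion_distr_eq)
  then show "distr (completion K) (completion K') h = completion K'"
    by (simp only: distr_completion[OF h(1)] h(2))
qed

lemma iso_completion:
  assumes "iso_mod_null N N' f"
  shows "iso_mod_null (completion N) (completion N') f"
proof -
  obtain g where g: "f \<in> measurable N N'" "distr N N' f = N'" "g \<in> measurable N' N" "distr N' N g = N"
    "AE x in N. g (f x) = x" "AE y in N'. f (g y) = y" using assms by (rule iso_mod_nullE)
  show ?thesis
    by (rule iso_mod_nullI[OF measure_preserving_completion[OF g(1,2)]
        measure_preserving_completion(1)[OF g(3,4)] AE_completion[OF g(5)] AE_completion[OF g(6)]])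
qed


section \<open>Graphings generated by finitely many Borel automorphisms\<close>

definition gen_edges :: "('a \<Rightarrow> 'a) list \<Rightarrow> ('a \<times> 'a) set" where
  "gen_edges gs = {(x, y). x \<noteq> y \<and> (\<exists>g\<in>set gs. y = g x)}"

text \<open>The inverses are exact, since the edge set must be Borel and symmetric at every point;
  bijections modulo null sets would not give that.\<close>

locale borel_generators =
  fixes N :: "real measure" and gs :: "(real \<Rightarrow> real) list"
  assumes prob_N: "prob_space N" and sets_N: "sets N = sets borel"
    and standard: "standard_prob_space (completion N)"
    and inverses: "\<And>g. g \<in> set gs \<Longrightarrow> \<exists>h\<in>set gs. (\<forall>x. h (g x) = x) \<and> (\<forall>x. g (h x) = x)"
    and gs_borel: "\<And>g. g \<in> set gs \<Longrightarrow> g \<in> borel_measurable borel"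
    and gs_mp: "\<And>g. g \<in> set gs \<Longrightarrow> distr N N g = N"
begin

abbreviation M where "M \<equiv> completion N"
abbreviation E where "E \<equiv> gen_edges gs"
abbreviation \<eta> where "\<eta> \<equiv> edge_measure M E"

lemma space_N: "space N = UNIV"
  using sets_eq_imp_space_eq[OF sets_N] by simp

lemma gs_N: "g \<in> set gs \<Longrightarrow> g \<in> measurable N N"
  using gs_borel measurable_cong_sets[OF sets_N sets_N] by blast

lemma gs_auts: "g \<in> set gs \<Longrightarrow> g \<in> mp_auts M"
proof -
  assume g: "g \<in> set gs"
  obtain h where h: "h \<in> set gs" "\<And>x. h (g x) = x" "\<And>x. g (h x) = x" using inverses[OF g] by blast
  show ?thesis
    by (rule mp_autsI(1)[where g = h])
      (auto intro: measure_preserving_completion gs_N gs_mp g h(1) simp only: h simp_thms intro!: AE_I2)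
qed

lemma E_Image: "E `` {x} = (\<lambda>g. g x) ` set gs - {x}"
  by (auto simp: gen_edges_def)

lemma finite_E_Image: "finite (E `` {x})"
  by (simp add: E_Image)

lemma sym_E: "(x, y) \<in> E \<longleftrightarrow> (y, x) \<in> E"
  using inverses unfolding gen_edges_def by (auto, metis+)

text \<open>A neighbour of \<open>x\<close> is \<open>g x\<close> for one of finitely many
  measure-preserving \<open>g\<close>, so almost every point has all its neighbours off a given null
  set.\<close>

lemma AE_nbr:
  assumes "AE x in M. P x"
  shows "AE x in M. \<forall>y\<in>E `` {x}. P y"
proof -
  have "AE x in M. \<forall>g\<in>set gs. P (g x)"
    by (rule AE_finite_allI) (use AE_mp_auts[OF gs_auts assms] in auto)
  then show ?thesis by eventually_elim (auto simp: E_Image)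
qed

text \<open>Several generators may produce the same edge. It is credited to the first of them, so
  that the edges split into the graphs of the generators restricted to the sets \<open>D i\<close>,
  with loops left out.\<close>

definition D :: "nat \<Rightarrow> real set" where
  "D i = {x. (gs ! i) x \<noteq> x \<and> (\<forall>j<i. (gs ! j) x \<noteq> (gs ! i) x)}"

lemma gs_nth [measurable]: "i < length gs \<Longrightarrow> gs ! i \<in> borel_measurable borel"
  using gs_borel by simp

lemma D_borel: "i < length gs \<Longrightarrow> D i \<in> sets M"
proof -
  assume i: "i < length gs"
  have [measurable]: "gs ! j \<in> borel_measurable borel" if "j < i" for j using i that by simp
  note [measurable] = gs_nth[OF i]
  have "D i \<in> sets borel" unfolding D_def by measurable
  then show ?thesis using sets_N by auto
qed

lemma edge_unique:
  assumes "(x, y) \<in> E"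
  shows "\<exists>!i. i < length gs \<and> x \<in> D i \<and> (gs ! i) x = y"
proof -
  define i where "i = (LEAST i. i < length gs \<and> (gs ! i) x = y)"
  have "\<exists>i. i < length gs \<and> (gs ! i) x = y" using assms by (auto simp: gen_edges_def in_set_conv_nth)
  then have i: "i < length gs \<and> (gs ! i) x = y" unfolding i_def by (rule LeastI_ex)
  moreover have "(gs ! j) x \<noteq> y" if "j < i" for j
    using not_less_Least[of j "\<lambda>i. i < length gs \<and> (gs ! i) x = y"] that i unfolding i_def by auto
  ultimately have 1: "i < length gs \<and> x \<in> D i \<and> (gs ! i) x = y"
    using assms by (auto simp: D_def gen_edges_def)
  show ?thesis
  proof (rule ex1I[of _ i])
    show "i < length gs \<and> x \<in> D i \<and> (gs ! i) x = y" by (rule 1)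
    fix j assume j: "j < length gs \<and> x \<in> D j \<and> (gs ! j) x = y"
    show "j = i" using j 1 by (cases i j rule: linorder_cases) (auto simp: D_def)
  qed
qed

lemma D_edge: "i < length gs \<Longrightarrow> x \<in> D i \<Longrightarrow> (x, (gs ! i) x) \<in> E"
  by (auto simp: D_def gen_edges_def)

lemma edges_to_card: "edges_to E x B = card {i. i < length gs \<and> x \<in> D i \<and> (gs ! i) x \<in> B}"
proof -
  have "bij_betw (\<lambda>i. (gs ! i) x) {i. i < length gs \<and> x \<in> D i \<and> (gs ! i) x \<in> B} {y \<in> B. (x, y) \<in> E}"
  proof (rule bij_betwI')
    fix i j assume "i \<in> {i. i < length gs \<and> x \<in> D i \<and> (gs ! i) x \<in> B}" "j \<in> {i. i < length gs \<and> x \<in> D i \<and> (gs ! i) x \<in> B}"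
    then show "(gs ! i) x = (gs ! j) x \<longleftrightarrow> i = j"
      using edge_unique[OF D_edge, of i x] by auto
  next
    fix i assume "i \<in> {i. i < length gs \<and> x \<in> D i \<and> (gs ! i) x \<in> B}"
    then show "(gs ! i) x \<in> {y \<in> B. (x, y) \<in> E}" using D_edge by auto
  next
    fix y assume "y \<in> {y \<in> B. (x, y) \<in> E}"
    then show "\<exists>i\<in>{i. i < length gs \<and> x \<in> D i \<and> (gs ! i) x \<in> B}. y = (gs ! i) x"
      using edge_unique[of x y] by auto
  qed
  from bij_betw_same_card[OF this] show ?thesis by (simp add: edges_to_def)
qed

definition inv_gs :: "nat \<Rightarrow> real \<Rightarrow> real" where
  "inv_gs i = (SOME h. h \<in> set gs \<and> (\<forall>x. h ((gs ! i) x) = x) \<and> (\<forall>x. (gs ! i) (h x) = x))"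

lemma inv_gs:
  assumes "i < length gs"
  shows "inv_gs i \<in> set gs" "inv_gs i ((gs ! i) x) = x" "(gs ! i) (inv_gs i x) = x"
proof -
  have "\<exists>h. h \<in> set gs \<and> (\<forall>x. h ((gs ! i) x) = x) \<and> (\<forall>x. (gs ! i) (h x) = x)"
    using inverses[of "gs ! i"] assms by auto
  from someI_ex[OF this] show "inv_gs i \<in> set gs" "inv_gs i ((gs ! i) x) = x" "(gs ! i) (inv_gs i x) = x"
    unfolding inv_gs_def[symmetric] by auto
qed

text \<open>The edges at \<open>y\<close> are counted from their far ends: each is credited to
  exactly one generator \<open>i\<close>, applied at the point \<open>inv_gs i y\<close>. Set
  against \<open>edges_to_card\<close>, this is the other side of the mass transport.\<close>

lemma edges_to_card_inv:
  "edges_to E y A = card {i. i < length gs \<and> inv_gs i y \<in> D i \<and> inv_gs i y \<in> A}"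
proof -
  have "bij_betw (\<lambda>i. inv_gs i y) {i. i < length gs \<and> inv_gs i y \<in> D i \<and> inv_gs i y \<in> A} {x \<in> A. (y, x) \<in> E}"
  proof (rule bij_betwI')
    fix i j assume "i \<in> {i. i < length gs \<and> inv_gs i y \<in> D i \<and> inv_gs i y \<in> A}" "j \<in> {i. i < length gs \<and> inv_gs i y \<in> D i \<and> inv_gs i y \<in> A}"
    then show "inv_gs i y = inv_gs j y \<longleftrightarrow> i = j"
      using edge_unique[OF D_edge, of i "inv_gs i y"] inv_gs(3)[of i y] inv_gs(3)[of j y] by auto
  next
    fix i assume "i \<in> {i. i < length gs \<and> inv_gs i y \<in> D i \<and> inv_gs i y \<in> A}"
    then show "inv_gs i y \<in> {x \<in> A. (y, x) \<in> E}"
      using D_edge[of i "inv_gs i y"] inv_gs(3)[of i y] sym_E by auto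
  next
    fix x assume x: "x \<in> {x \<in> A. (y, x) \<in> E}"
    then have "(x, y) \<in> E" using sym_E by auto
    then obtain i where "i < length gs" "x \<in> D i" "(gs ! i) x = y" using edge_unique[of x y] by auto
    then show "\<exists>i\<in>{i. i < length gs \<and> inv_gs i y \<in> D i \<and> inv_gs i y \<in> A}. x = inv_gs i y"
      using x inv_gs(2)[of i x] by (intro bexI[of _ i]) auto
  qed
  from bij_betw_same_card[OF this] show ?thesis by (simp add: edges_to_def)
qed

lemma nn_integral_card:
  assumes S: "\<And>i. i < length gs \<Longrightarrow> S i \<in> sets M" and A: "A \<in> sets M"
  shows "(\<integral>\<^sup>+x\<in>A. of_nat (card {i. i < length gs \<and> x \<in> S i}) \<partial>M) = (\<Sum>i<length gs. emeasure M (S i \<inter> A))"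
proof -
  have "of_nat (card {i. i < length gs \<and> x \<in> S i}) * indicator A x
      = (\<Sum>i<length gs. indicator (S i \<inter> A) x :: ennreal)" for x
  proof -
    have "(\<Sum>i<length gs. indicator (S i \<inter> A) x :: ennreal) = (\<Sum>i<length gs. if x \<in> S i \<inter> A then 1 else 0)"
      by (intro sum.cong refl) (auto simp: indicator_def)
    also have "\<dots> = of_nat (card {i \<in> {..<length gs}. x \<in> S i \<inter> A})"
      by (simp flip: sum.inter_filter)
    finally show ?thesis by (cases "x \<in> A") auto
  qed
  then have "(\<integral>\<^sup>+x\<in>A. of_nat (card {i. i < length gs \<and> x \<in> S i}) \<partial>M)
      = (\<integral>\<^sup>+x. (\<Sum>i<length gs. indicator (S i \<inter> A) x) \<partial>M)" by simp
  also have "\<dots> = (\<Sum>i<length gs. \<integral>\<^sup>+x. indicator (S i \<inter> A) x \<partial>M)"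
    using S A by (intro nn_integral_sum) auto
  also have "\<dots> = (\<Sum>i<length gs. emeasure M (S i \<inter> A))"
    using S A by (intro sum.cong refl nn_integral_indicator) auto
  finally show ?thesis .
qed

lemma gs_M: "g \<in> set gs \<Longrightarrow> B \<in> sets M \<Longrightarrow> g -` B \<in> sets M"
  using measurable_sets[OF mp_autsD(1)[OF gs_auts], of g B] space_N by simp

text \<open>The edges credited to generator \<open>i\<close> contribute to one side the measure of
  their set of starting points and to the other side that of its image under the generator. The two
  agree because the generators are measure-preserving bijections.\<close>

lemma mass_transport:
  assumes A: "A \<in> sets M" and B: "B \<in> sets M"
  shows "(\<integral>\<^sup>+x\<in>A. of_nat (edges_to E x B) \<partial>M) = (\<integral>\<^sup>+y\<in>B. of_nat (edges_to E y A) \<partial>M)"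
proof -
  have "(\<integral>\<^sup>+x\<in>A. of_nat (edges_to E x B) \<partial>M) = (\<Sum>i<length gs. emeasure M (D i \<inter> (gs ! i) -` B \<inter> A))"
    using nn_integral_card[of "\<lambda>i. D i \<inter> (gs ! i) -` B" A] A B D_borel gs_M
    by (simp add: edges_to_card)
  also have "\<dots> = (\<Sum>i<length gs. emeasure M (inv_gs i -` (D i \<inter> A) \<inter> B))"
  proof (rule sum.cong[OF refl])
    fix i assume i: "i \<in> {..<length gs}"
    have S: "D i \<inter> (gs ! i) -` B \<inter> A \<in> sets M" using i A B D_borel gs_M by auto
    have "inv_gs i -` (D i \<inter> (gs ! i) -` B \<inter> A) \<inter> space M = inv_gs i -` (D i \<inter> A) \<inter> B"
      using i inv_gs by (auto simp: space_N)
    then show "emeasure M (D i \<inter> (gs ! i) -` B \<inter> A) = emeasure M (inv_gs i -` (D i \<inter> A) \<inter> B)"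
      using mp_auts_emeasure_vimage[OF gs_auts[OF inv_gs(1)] S] i by (metis lessThan_iff)
  qed
  also have "\<dots> = (\<integral>\<^sup>+y\<in>B. of_nat (edges_to E y A) \<partial>M)"
    using nn_integral_card[of "\<lambda>i. inv_gs i -` (D i \<inter> A)" B] A B D_borel gs_M[OF inv_gs(1)]
    by (simp add: edges_to_card_inv)
  finally show ?thesis .
qed

lemma E_sets: "E \<in> sets (N \<Otimes>\<^sub>M N)"
proof -
  have [measurable]: "g \<in> borel_measurable borel" if "g \<in> set gs" for g using that by (rule gs_borel)
  have "E = {p \<in> space (borel \<Otimes>\<^sub>M borel). fst p \<noteq> snd p \<and> (\<exists>g\<in>set gs. snd p = g (fst p))}"
    by (auto simp: gen_edges_def space_pair_measure)
  also have "\<dots> \<in> sets (borel \<Otimes>\<^sub>M borel)" by measurable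
  also have "\<dots> = sets (N \<Otimes>\<^sub>M N)" by (rule sets_pair_measure_cong) (simp_all add: sets_N)
  finally show ?thesis .
qed

lemma borel_edge_set_E: "borel_edge_set M E"
  unfolding borel_edge_set_def
proof (intro exI conjI)
  show "completely_metrizable_space (euclidean :: real topology)"
    by (rule completely_metrizable_space_euclidean)
  obtain B :: "real set set" where "countable B" "topological_basis B" using ex_countable_basis by blast
  then show "second_countable (euclidean :: real topology)"
    unfolding second_countable_def topological_basis_def open_openin[symmetric]
    by (metis Union_iff Union_upper subset_iff)
  show "space N = topspace (euclidean :: real topology)" by (simp add: space_N)
  show "sets N = sigma_sets (topspace euclidean) {U. openin (euclidean :: real topology) U}"
    by (simp add: sets_N borel_def)
qed (use E_sets in auto)

lemma graphing_E: "graphing M E"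
  unfolding graphing_def
proof (intro conjI ballI)
  show "sym E" using sym_E by (auto simp: sym_def)
  show "irrefl E" by (auto simp: irrefl_def gen_edges_def)
  have "card (E `` {x}) \<le> length gs" for x
  proof -
    have "card (E `` {x}) \<le> card ((\<lambda>g. g x) ` set gs)" by (intro card_mono) (auto simp: E_Image)
    also have "\<dots> \<le> card (set gs)" by (rule card_image_le) simp
    also have "\<dots> \<le> length gs" by (rule card_length)
    finally show ?thesis .
  qed
  then show "\<exists>d. \<forall>x\<in>space M. finite (E `` {x}) \<and> card (E `` {x}) \<le> d"
    using finite_E_Image by blast
  fix B assume B: "B \<in> sets M"
  show "(\<lambda>x. edges_to E x B) \<in> measurable M (count_space UNIV)"
    unfolding edges_to_card
  proof (rule measurable_card)
    fix i
    have "{x \<in> space M. i \<in> {i. i < length gs \<and> x \<in> D i \<and> (gs ! i) x \<in> B}}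
        = (if i < length gs then D i \<inter> (gs ! i) -` B else {})" by (auto simp: space_N)
    then show "{x \<in> space M. i \<in> {i. i < length gs \<and> x \<in> D i \<and> (gs ! i) x \<in> B}} \<in> sets M"
      using D_borel gs_M B by auto
  qed
qed (use standard borel_edge_set_E mass_transport in auto)

lemma E_sets_M: "E \<in> sets (M \<Otimes>\<^sub>M M)"
proof -
  have "sets (N \<Otimes>\<^sub>M N) \<subseteq> sets (M \<Otimes>\<^sub>M M)"
    unfolding sets_pair_measure space_completion by (rule sigma_sets_mono') auto
  then show ?thesis using E_sets by blast
qed

section \<open>Preservation of the edge measure as a condition on neighbours\<close>

lemma sets_eta: "sets \<eta> = sets (M \<Otimes>\<^sub>M M)"
  unfolding edge_measure_def
  using sets.sigma_sets_eq[of "M \<Otimes>\<^sub>M M"] sets.space_closed[of "M \<Otimes>\<^sub>M M"]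
  by (subst sets_measure_of) (auto simp: space_pair_measure)

lemma space_MM: "space (M \<Otimes>\<^sub>M M) = UNIV"
  by (simp add: space_pair_measure space_N)

lemma map_prod_measurable:
  assumes "\<phi> \<in> measurable M M"
  shows "map_prod \<phi> \<phi> \<in> measurable (M \<Otimes>\<^sub>M M) (M \<Otimes>\<^sub>M M)"
  unfolding map_prod_def case_prod_beta' using assms by measurable

lemma edge_null_iff:
  assumes W: "W \<in> sets (M \<Otimes>\<^sub>M M)"
  shows "emeasure \<eta> W = 0 \<longleftrightarrow> (AE x in M. \<forall>y\<in>E `` {x}. (x, y) \<notin> W)"
proof -
  have "emeasure \<eta> W = 0 \<longleftrightarrow> (AE x in M. of_nat (edges_to E x (Pair x -` W)) = (0::ennreal))"
    unfolding emeasure_edge_measure[OF graphing_E W]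
    by (rule nn_integral_0_iff_AE[OF measurable_edges_to[OF graphing_E W]])
  also have "\<dots> \<longleftrightarrow> (AE x in M. \<forall>y\<in>E `` {x}. (x, y) \<notin> W)"
  proof -
    have "edges_to E x (Pair x -` W) = 0 \<longleftrightarrow> (\<forall>y\<in>E `` {x}. (x, y) \<notin> W)" for x
      using edges_to_finite[OF graphing_E, of x "Pair x -` W"] by (auto simp: edges_to_def space_N)
    then show ?thesis by (simp only: of_nat_eq_0_iff)
  qed
  finally show ?thesis .
qed

definition pres :: "(real \<Rightarrow> real) \<Rightarrow> bool" where
  "pres \<phi> \<longleftrightarrow> distr \<eta> (M \<Otimes>\<^sub>M M) (map_prod \<phi> \<phi>) = \<eta>"

definition nbr :: "(real \<Rightarrow> real) \<Rightarrow> bool" where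
  "nbr \<phi> \<longleftrightarrow> (AE x in M. \<phi> ` (E `` {x}) = E `` {\<phi> x})"

lemma pres_iff_emeasure:
  assumes \<phi>: "\<phi> \<in> measurable M M"
  shows "pres \<phi> \<longleftrightarrow> (\<forall>W\<in>sets (M \<Otimes>\<^sub>M M). emeasure \<eta> (map_prod \<phi> \<phi> -` W) = emeasure \<eta> W)"
proof -
  have m: "map_prod \<phi> \<phi> \<in> measurable \<eta> (M \<Otimes>\<^sub>M M)"
    using map_prod_measurable[OF \<phi>] by (simp add: measurable_cong_sets[OF sets_eta refl])
  have sp: "space \<eta> = UNIV" using sets_eq_imp_space_eq[OF sets_eta] space_MM by simp
  have e: "emeasure (distr \<eta> (M \<Otimes>\<^sub>M M) (map_prod \<phi> \<phi>)) W = emeasure \<eta> (map_prod \<phi> \<phi> -` W)"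
    if "W \<in> sets (M \<Otimes>\<^sub>M M)" for W
    using emeasure_distr[OF m that] by (simp add: sp)
  show ?thesis
  proof
    assume "pres \<phi>"
    then show "\<forall>W\<in>sets (M \<Otimes>\<^sub>M M). emeasure \<eta> (map_prod \<phi> \<phi> -` W) = emeasure \<eta> W"
      using e unfolding pres_def by metis
  next
    assume *: "\<forall>W\<in>sets (M \<Otimes>\<^sub>M M). emeasure \<eta> (map_prod \<phi> \<phi> -` W) = emeasure \<eta> W"
    show "pres \<phi>" unfolding pres_def
    proof (rule measure_eqI)
      show "sets (distr \<eta> (M \<Otimes>\<^sub>M M) (map_prod \<phi> \<phi>)) = sets \<eta>" by (simp add: sets_eta)
    qed (use e * in auto)
  qed
qed

lemma vimage_sets:
  "\<phi> \<in> measurable M M \<Longrightarrow> W \<in> sets (M \<Otimes>\<^sub>M M) \<Longrightarrow> map_prod \<phi> \<phi> -` W \<in> sets (M \<Otimes>\<^sub>M M)"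
  using measurable_sets[OF map_prod_measurable, of \<phi> W] by (simp add: space_MM)

text \<open>Almost every point lies, together with all its neighbours, in the set where
  \<open>\<phi>\<close> is the identity, so almost no edge count changes.\<close>

lemma emeasure_eta_id:
  assumes \<phi>: "\<phi> \<in> measurable M M" and id: "AE x in M. \<phi> x = x" and W: "W \<in> sets (M \<Otimes>\<^sub>M M)"
  shows "emeasure \<eta> (map_prod \<phi> \<phi> -` W) = emeasure \<eta> W"
  unfolding emeasure_edge_measure[OF graphing_E W] emeasure_edge_measure[OF graphing_E vimage_sets[OF \<phi> W]]
proof (rule nn_integral_cong_AE)
  show "AE x in M. of_nat (edges_to E x (Pair x -` map_prod \<phi> \<phi> -` W)) = (of_nat (edges_to E x (Pair x -` W)) :: ennreal)"
    using id AE_nbr[OF id]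
  proof eventually_elim
    case (elim x)
    then have "{y \<in> Pair x -` map_prod \<phi> \<phi> -` W. (x, y) \<in> E} = {y \<in> Pair x -` W. (x, y) \<in> E}" by auto
    then show ?case by (simp add: edges_to_def)
  qed
qed

text \<open>All edges lie in \<open>E\<close>, so the complement of \<open>E\<close> is null for the
  edge measure, and hence so is its preimage.\<close>

lemma pres_imp_subset:
  assumes \<phi>: "\<phi> \<in> measurable M M" and p: "pres \<phi>"
  shows "AE x in M. \<phi> ` (E `` {x}) \<subseteq> E `` {\<phi> x}"
proof -
  have E': "- E \<in> sets (M \<Otimes>\<^sub>M M)" using sets.compl_sets[OF E_sets_M] by (simp add: space_MM Compl_eq_Diff_UNIV)
  have "AE x in M. \<forall>y\<in>E `` {x}. (x, y) \<notin> - E" by simp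
  then have "emeasure \<eta> (- E) = 0" using edge_null_iff[OF E'] by simp
  then have "emeasure \<eta> (map_prod \<phi> \<phi> -` (- E)) = 0" using p \<phi> E' pres_iff_emeasure by simp
  then have "AE x in M. \<forall>y\<in>E `` {x}. (x, y) \<notin> map_prod \<phi> \<phi> -` (- E)"
    using edge_null_iff[OF vimage_sets[OF \<phi> E']] by simp
  then show ?thesis by eventually_elim auto
qed

text \<open>Applied to \<open>\<phi>\<close> and to its inverse, \<open>pres_imp_subset\<close>
  gives the two inclusions. Conversely, \<open>\<phi>\<close> is injective on the neighbours of
  almost every point, so the number of edges into \<open>W\<close> at \<open>\<phi> x\<close> equals
  the number of edges into the preimage of \<open>W\<close> at \<open>x\<close>, and
  \<open>\<phi>\<close> preserves \<open>M\<close>.\<close>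

lemma pres_iff_nbr:
  assumes \<phi>: "\<phi> \<in> mp_auts M"
  shows "pres \<phi> \<longleftrightarrow> nbr \<phi>"
proof -
  obtain \<psi> where \<psi>: "\<psi> \<in> mp_auts M" "AE x in M. \<psi> (\<phi> x) = x" "AE x in M. \<phi> (\<psi> x) = x"
    using mp_auts_inverse[OF \<phi>] .
  note m\<phi> = mp_autsD(1)[OF \<phi>] and m\<psi> = mp_autsD(1)[OF \<psi>(1)]
  show ?thesis
  proof
    assume p: "pres \<phi>"
    have "pres \<psi>"
      unfolding pres_iff_emeasure[OF m\<psi>]
    proof
      fix W assume W: "W \<in> sets (M \<Otimes>\<^sub>M M)"
      have "emeasure \<eta> (map_prod \<psi> \<psi> -` W) = emeasure \<eta> (map_prod \<phi> \<phi> -` map_prod \<psi> \<psi> -` W)"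
        using p[unfolded pres_iff_emeasure[OF m\<phi>]] vimage_sets[OF m\<psi> W] by simp
      also have "map_prod \<phi> \<phi> -` map_prod \<psi> \<psi> -` W = map_prod (\<psi> \<circ> \<phi>) (\<psi> \<circ> \<phi>) -` W"
        by (auto simp: map_prod_def)
      also have "emeasure \<eta> \<dots> = emeasure \<eta> W"
        using \<psi>(2) by (intro emeasure_eta_id measurable_comp[OF m\<phi> m\<psi>] W) simp
      finally show "emeasure \<eta> (map_prod \<psi> \<psi> -` W) = emeasure \<eta> W" .
    qed
    then have s\<psi>: "AE x in M. \<psi> ` (E `` {\<phi> x}) \<subseteq> E `` {\<psi> (\<phi> x)}"
      using AE_mp_auts[OF \<phi> pres_imp_subset[OF m\<psi>]] by simp
    show "nbr \<phi>"
      unfolding nbr_def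
      using pres_imp_subset[OF m\<phi> p] s\<psi> \<psi>(2) AE_mp_auts[OF \<phi> AE_nbr[OF \<psi>(3)]]
    proof eventually_elim
      case (elim x)
      have "E `` {\<phi> x} \<subseteq> \<phi> ` (E `` {x})"
      proof
        fix z assume z: "z \<in> E `` {\<phi> x}"
        then have "\<psi> z \<in> E `` {x}" using elim(2,3) by auto
        moreover have "\<phi> (\<psi> z) = z" using elim(4) z by blast
        ultimately show "z \<in> \<phi> ` (E `` {x})" by (metis imageI)
      qed
      then show ?case using elim(1) by blast
    qed
  next
    assume n: "nbr \<phi>"
    show "pres \<phi>"
      unfolding pres_iff_emeasure[OF m\<phi>]
    proof
      fix W assume W: "W \<in> sets (M \<Otimes>\<^sub>M M)"
      let ?F = "\<lambda>x. of_nat (edges_to E x (Pair x -` W)) :: ennreal"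
      have F: "?F \<in> borel_measurable M" by (rule measurable_edges_to[OF graphing_E W])
      have "emeasure \<eta> (map_prod \<phi> \<phi> -` W) = (\<integral>\<^sup>+x. ?F (\<phi> x) \<partial>M)"
        unfolding emeasure_edge_measure[OF graphing_E vimage_sets[OF m\<phi> W]]
      proof (rule nn_integral_cong_AE)
        show "AE x in M. of_nat (edges_to E x (Pair x -` map_prod \<phi> \<phi> -` W)) = ?F (\<phi> x)"
          using n[unfolded nbr_def] AE_nbr[OF \<psi>(2)]
        proof eventually_elim
          case (elim x)
          have "{z \<in> Pair (\<phi> x) -` W. (\<phi> x, z) \<in> E} = \<phi> ` {y \<in> Pair x -` map_prod \<phi> \<phi> -` W. (x, y) \<in> E}"
          proof -
            have "(\<phi> x, z) \<in> E \<longleftrightarrow> z \<in> \<phi> ` (E `` {x})" for z using elim(1) by auto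
            then show ?thesis by auto
          qed
          moreover have "inj_on \<phi> {y \<in> Pair x -` map_prod \<phi> \<phi> -` W. (x, y) \<in> E}"
            using elim(2) by (intro inj_on_inverseI[where g = \<psi>]) auto
          ultimately show ?case by (simp add: edges_to_def card_image)
        qed
      qed
      also have "\<dots> = (\<integral>\<^sup>+x. ?F x \<partial>distr M M \<phi>)" by (rule nn_integral_distr[symmetric]) (use m\<phi> F in simp_all)
      also have "\<dots> = emeasure \<eta> W"
        by (simp only: mp_autsD(2)[OF \<phi>] emeasure_edge_measure[OF graphing_E W])
      finally show "emeasure \<eta> (map_prod \<phi> \<phi> -` W) = emeasure \<eta> W" .
    qed
  qed
qed

lemma nbr_cong:
  assumes eq: "AE x in M. \<phi> x = \<phi>' x" and n: "nbr \<phi>"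
  shows "nbr \<phi>'"
  unfolding nbr_def using n[unfolded nbr_def] eq AE_nbr[OF eq]
proof eventually_elim
  case (elim x)
  have "\<phi>' ` (E `` {x}) = \<phi> ` (E `` {x})" using elim(3) by (intro image_cong) auto
  then show ?case using elim by simp
qed

lemma graphing_aut_group_eq: "graphing_aut_group M E = sub_aut M nbr"
  unfolding graphing_aut_group_def
proof (rule sub_aut_eqI)
  fix S assume S: "S \<in> mp_auts M"
  have "(\<forall>\<phi>\<in>aut_class M S. pres \<phi>) \<longleftrightarrow> pres S"
  proof (rule ball_aut_class[OF S])
    fix g assume g: "g \<in> mp_auts M" "AE x in M. S x = g x"
    have "AE x in M. g x = S x" using g(2) by eventually_elim simp
    then show "pres S \<longleftrightarrow> pres g" unfolding pres_iff_nbr[OF S] pres_iff_nbr[OF g(1)]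
      using nbr_cong g(2) by blast
  qed
  then show "(\<forall>\<phi>\<in>aut_class M S. distr \<eta> (M \<Otimes>\<^sub>M M) (map_prod \<phi> \<phi>) = \<eta>) \<longleftrightarrow> nbr S"
    unfolding pres_iff_nbr[OF S] by (simp only: pres_def)
qed

lemma group_graphing_aut_group: "group (graphing_aut_group M E)"
  unfolding graphing_aut_group_eq
proof (rule group_sub_aut)
  show "nbr id" by (simp add: nbr_def)
next
  fix S R assume S: "nbr S" and R: "R \<in> mp_auts M" "nbr R"
  have "AE x in M. S ` (R ` (E `` {x})) = E `` {S (R x)}"
    using AE_mp_auts[OF R(1) S[unfolded nbr_def]] R(2)[unfolded nbr_def] by eventually_elim simp
  then show "nbr (S \<circ> R)" by (simp add: nbr_def image_comp)
next
  fix S R assume R: "R \<in> mp_auts M" and RS: "AE x in M. R (S x) = x" and SR: "AE x in M. S (R x) = x"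
    and S: "nbr S"
  show "nbr R"
    unfolding nbr_def
    using AE_mp_auts[OF R S[unfolded nbr_def]] AE_mp_auts[OF R AE_nbr[OF RS]] SR
  proof eventually_elim
    case (elim x)
    have "R ` (E `` {x}) = R ` (S ` (E `` {R x}))" using elim(1,3) by simp
    also have "\<dots> = (\<lambda>y. y) ` (E `` {R x})" unfolding image_image by (rule image_cong) (use elim(2) in auto)
    finally show ?case by simp
  qed
qed

lemma components_saturated:
  assumes "C \<subseteq> components M E" "(x, y) \<in> E"
  shows "x \<in> \<Union>C \<longleftrightarrow> y \<in> \<Union>C"
proof -
  have "y \<in> \<Union>C" if "x \<in> \<Union>C" "(x, y) \<in> E" for x y
  proof -
    obtain K where K: "K \<in> C" "x \<in> K" using \<open>x \<in> \<Union>C\<close> by blast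
    then obtain z where "K = E\<^sup>* `` {z}" using assms(1) by (auto simp: components_def)
    then have "y \<in> K" using K that(2) by (auto intro: rtrancl_into_rtrancl)
    then show ?thesis using K by blast
  qed
  then show ?thesis using assms(2) sym_E by blast
qed

end


section \<open>The unit interval and its double\<close>

text \<open>Both measures live on the whole line with everything off the interval null, so that
  \<open>space\<close> is \<open>UNIV\<close> and all maps are total functions on the reals.\<close>

definition N1 :: "real measure" where "N1 = uniform_measure lborel {0..<1}"
definition N2 :: "real measure" where "N2 = uniform_measure lborel {0..<2}"

abbreviation U where "U \<equiv> completion N1"
abbreviation V where "V \<equiv> completion N2"

lemma sets_N1 [simp, measurable_cong]: "sets N1 = sets borel" by (simp add: N1_def)
lemma sets_N2 [simp, measurable_cong]: "sets N2 = sets borel" by (simp add: N2_def)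
lemma space_N1 [simp]: "space N1 = UNIV" by (simp add: N1_def)
lemma space_N2 [simp]: "space N2 = UNIV" by (simp add: N2_def)

lemma prob_N1: "prob_space N1" unfolding N1_def by (rule prob_space_uniform_measure) simp_all
lemma prob_N2: "prob_space N2" unfolding N2_def by (rule prob_space_uniform_measure) simp_all

lemma emeasure_N1: "B \<in> sets borel \<Longrightarrow> emeasure N1 B = emeasure lborel ({0..<1} \<inter> B)"
  unfolding N1_def by (subst emeasure_uniform_measure) (simp_all add: divide_ennreal_def)

lemma emeasure_N2:
  assumes B: "B \<in> sets borel"
  shows "emeasure N2 B = (emeasure N1 B + emeasure N1 ((\<lambda>x. x + 1) -` B)) / 2"
proof -
  have B1: "(\<lambda>x. x + 1) -` B \<in> sets borel"
    using measurable_sets[OF _ B, of "\<lambda>x. x + 1" borel] by simp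
  have "emeasure N2 B = emeasure lborel ({0..<2} \<inter> B) / 2"
    unfolding N2_def using B by (subst emeasure_uniform_measure) simp_all
  also have "{0..<2} \<inter> B = ({0..<1} \<inter> B) \<union> ({1..<2} \<inter> B)" by auto
  also have "emeasure lborel \<dots> = emeasure lborel ({0..<1} \<inter> B) + emeasure lborel ({1..<2} \<inter> B)"
    using B by (intro plus_emeasure[symmetric]) auto
  also have "emeasure lborel ({1..<2} \<inter> B) = emeasure (distr lborel borel ((+) 1)) ({1..<2} \<inter> B)"
    by (simp only: lborel_distr_plus)
  also have "\<dots> = emeasure lborel ({0..<1} \<inter> (\<lambda>x. x + 1) -` B)"
    using B by (subst emeasure_distr) (auto intro!: arg_cong[where f = "emeasure lborel"] simp: add.commute)
  finally show ?thesis using B B1 by (simp add: emeasure_N1)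
qed

lemma AE_U01: "AE x in U. 0 \<le> x \<and> x < 1"
proof (rule AE_completion)
  have "AE x in uniform_measure lborel {0..<1::real}. x \<in> {0..<1}"
    by (rule AE_uniform_measureI) simp_all
  then show "AE x in N1. 0 \<le> x \<and> x < 1" unfolding N1_def by simp
qed

lemma AE_auts01: "S \<in> mp_auts U \<Longrightarrow> AE x in U. 0 \<le> S x \<and> S x < 1"
  using AE_mp_auts[OF _ AE_U01] .

lemma borel_shift: "B \<in> sets borel \<Longrightarrow> (\<lambda>x::real. x + c) -` B \<in> sets borel"
  using measurable_sets[of "\<lambda>x. x + c" borel borel B] by simp

lemma null_N2_iff:
  "B \<in> sets borel \<Longrightarrow> emeasure N2 B = 0 \<longleftrightarrow> emeasure N1 B = 0 \<and> emeasure N1 ((\<lambda>x. x + 1) -` B) = 0"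
  by (simp add: emeasure_N2 divide_ennreal_def ennreal_mult_eq_top_iff)

lemma AE_completion_null:
  "(AE x in completion N. P x) \<longleftrightarrow> (\<exists>B\<in>sets N. emeasure N B = 0 \<and> {x\<in>space N. \<not> P x} \<subseteq> B)"
  by (subst AE_completion_iff, subst eventually_ae_filter) (auto simp: null_sets_def)

text \<open>Up to a factor, \<open>N2\<close> is \<open>N1\<close> plus its translate by 1.
  Statements about almost every point of the double thus split into one for each copy, which is how
  most later arguments on \<open>V\<close> begin.\<close>

lemma AE_V: "(AE x in V. P x) \<longleftrightarrow> (AE x in U. P x) \<and> (AE x in U. P (x + 1))"
proof
  assume "AE x in V. P x"
  then obtain B where B: "B \<in> sets borel" "emeasure N2 B = 0" "{x. \<not> P x} \<subseteq> B"
    unfolding AE_completion_null by auto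
  then have "{x. \<not> P (x + 1)} \<subseteq> (\<lambda>x. x + 1) -` B" by auto
  then show "(AE x in U. P x) \<and> (AE x in U. P (x + 1))"
    unfolding AE_completion_null using B borel_shift[OF B(1), of 1] null_N2_iff[OF B(1)] by auto
next
  assume "(AE x in U. P x) \<and> (AE x in U. P (x + 1))"
  then obtain B C where B: "B \<in> sets borel" "emeasure N1 B = 0" "{x. \<not> P x} \<subseteq> B"
    and C: "C \<in> sets borel" "emeasure N1 C = 0" "{x. \<not> P (x + 1)} \<subseteq> C"
    unfolding AE_completion_null by auto
  \<comment> \<open>A set that is null for \<open>N1\<close> may be arbitrary off
    \<open>{0..<1}\<close>, so each exceptional set is used only on its own half; the complement of
    both halves is null and is thrown in.\<close>
  define W where "W = ({0..<1} \<inter> B) \<union> ({1..<2} \<inter> (\<lambda>x. x + (-1)) -` C) \<union> - {0..<2}"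
  have W: "W \<in> sets borel" unfolding W_def using B C borel_shift[OF C(1), of "-1"] by auto
  have "{x. \<not> P x} \<subseteq> W"
  proof
    fix x assume "x \<in> {x. \<not> P x}"
    then have "x \<in> B" "x - 1 \<in> C" using B(3) C(3) by (auto simp: subset_eq)
    then show "x \<in> W" by (auto simp: W_def)
  qed
  moreover have "emeasure N1 W = 0"
  proof -
    have "emeasure N1 W = emeasure lborel ({0..<1} \<inter> B)"
      using W by (simp add: emeasure_N1) (rule arg_cong[where f = "emeasure lborel"], auto simp: W_def)
    then show ?thesis using B by (simp add: emeasure_N1)
  qed
  moreover have "emeasure N1 ((\<lambda>x. x + 1) -` W) = 0"
  proof -
    have "emeasure N1 ((\<lambda>x. x + 1) -` W) = emeasure lborel ({0..<1} \<inter> C)"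
      using borel_shift[OF W, of 1]
      by (simp add: emeasure_N1) (rule arg_cong[where f = "emeasure lborel"], auto simp: W_def)
    then show ?thesis using C by (simp add: emeasure_N1)
  qed
  ultimately show "AE x in V. P x"
    unfolding AE_completion_null using W null_N2_iff[OF W] by auto
qed

lemma measurable_completionI:
  assumes f: "f \<in> measurable N N'" and null: "\<And>A. A \<in> null_sets N' \<Longrightarrow> emeasure N (f -` A \<inter> space N) = 0"
  shows "f \<in> measurable (completion N) (completion N')"
proof (rule completion.measurable_completion2)
  show "f \<in> completion N \<rightarrow>\<^sub>M N'" using f by (rule measurable_completion)
  show "null_sets N' \<subseteq> null_sets (distr (completion N) N' f)"
    unfolding distr_completion[OF f] using null by (auto simp: null_sets_def emeasure_distr[OF f])
qed

lemma id_UV: "(\<lambda>x. x) \<in> measurable U V"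
  by (rule measurable_completionI) (auto simp: null_sets_def null_N2_iff)

lemma shift_UV: "(\<lambda>x. x + 1) \<in> measurable U V"
  by (rule measurable_completionI) (auto simp: null_sets_def null_N2_iff)

definition fold1 :: "real \<Rightarrow> real" where "fold1 x = (if x < 1 then x else x - 1)"

lemma fold1_VU: "fold1 \<in> measurable V U"
proof (rule measurable_completionI)
  show m: "fold1 \<in> measurable N2 N1" unfolding fold1_def by measurable
  fix A assume A: "A \<in> null_sets N1"
  then have Ab: "A \<in> sets borel" and A0: "emeasure N1 A = 0" by auto
  have fA: "fold1 -` A \<in> sets borel" using measurable_sets[OF m, of A] Ab by simp
  have "emeasure N1 (fold1 -` A) = emeasure lborel ({0..<1} \<inter> A)"
    using fA by (simp add: emeasure_N1) (rule arg_cong[where f = "emeasure lborel"], auto simp: fold1_def)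
  moreover have "emeasure N1 ((\<lambda>x. x + 1) -` fold1 -` A) = emeasure lborel ({0..<1} \<inter> A)"
    using borel_shift[OF fA, of 1]
    by (simp add: emeasure_N1) (rule arg_cong[where f = "emeasure lborel"], auto simp: fold1_def)
  ultimately have "emeasure N2 (fold1 -` A) = 0"
    using A0 Ab null_N2_iff[OF fA] by (simp add: emeasure_N1)
  then show "emeasure N2 (fold1 -` A \<inter> space N2) = 0" by simp
qed

lemma sets_V_D:
  assumes "W \<in> sets V"
  shows "W \<in> sets U" "(\<lambda>x. x + 1) -` W \<in> sets U"
  using measurable_sets[OF id_UV assms] measurable_sets[OF shift_UV assms] by simp_all

lemma emeasure_V:
  assumes W: "W \<in> sets V"
  shows "emeasure V W = (emeasure U W + emeasure U ((\<lambda>x. x + 1) -` W)) / 2"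
proof -
  obtain S where S: "S \<in> sets borel" "AE x in V. x \<in> W \<longleftrightarrow> x \<in> S"
  proof
    show "main_part N2 W \<in> sets borel" using main_part_sets[OF W] by simp
    show "AE x in V. x \<in> W \<longleftrightarrow> x \<in> main_part N2 W"
      using AE_completion[OF AE_notin_null_part[OF W]]
    proof eventually_elim
      case (elim x)
      then show ?case using main_part_null_part_Un[OF W] by blast
    qed
  qed
  have SV: "S \<in> sets V" using S by simp
  have "emeasure V W = emeasure V S"
    using S(2) W SV by (intro emeasure_eq_AE) auto
  also have "\<dots> = (emeasure U S + emeasure U ((\<lambda>x. x + 1) -` S)) / 2"
    using S(1) borel_shift[OF S(1), of 1] emeasure_N2[OF S(1)] by simp
  also have "emeasure U S = emeasure U W"
    using S(2) sets_V_D[OF W] sets_V_D[OF SV] by (intro emeasure_eq_AE) (auto simp: AE_V)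
  also have "emeasure U ((\<lambda>x. x + 1) -` S) = emeasure U ((\<lambda>x. x + 1) -` W)"
    using S(2) sets_V_D[OF W] sets_V_D[OF SV] by (intro emeasure_eq_AE) (auto simp: AE_V)
  finally show ?thesis .
qed

lemma lt1_sets [measurable]: "{x. x < (1::real)} \<in> sets V" "{x. x < (1::real)} \<in> sets U"
  by auto

section \<open>Acting on both copies at once\<close>

definition double :: "(real \<Rightarrow> real) \<Rightarrow> real \<Rightarrow> real" where
  "double S x = (if x < 1 then S x else S (x - 1) + 1)"

lemma double_eq: "double S x = (if x < 1 then S (fold1 x) else S (fold1 x) + 1)"
  by (simp add: double_def fold1_def)

lemma double_measurable:
  assumes S: "S \<in> measurable U U"
  shows "double S \<in> measurable V V"
proof -
  have a: "(\<lambda>x. S (fold1 x)) \<in> measurable V V"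
    by (rule measurable_compose[OF measurable_compose[OF fold1_VU S] id_UV])
  have b: "(\<lambda>x. S (fold1 x) + 1) \<in> measurable V V"
    by (rule measurable_compose[OF measurable_compose[OF fold1_VU S] shift_UV])
  show ?thesis unfolding double_eq[abs_def]
    by (rule measurable_If[OF a b]) (use lt1_sets in simp)
qed

lemma double_id:
  assumes S: "S \<in> mp_auts U" and eq: "AE x in U. S' (S x) = x"
  shows "AE x in V. double S' (double S x) = x"
  unfolding AE_V
proof
  show "AE x in U. double S' (double S x) = x"
    using AE_auts01[OF S] AE_U01 eq by eventually_elim (simp add: double_def)
  show "AE x in U. double S' (double S (x + 1)) = x + 1"
    using AE_auts01[OF S] AE_U01 eq by eventually_elim (simp add: double_def)
qed

lemma double_mp_auts:
  assumes S: "S \<in> mp_auts U"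
  shows "double S \<in> mp_auts V"
proof -
  obtain S' where S': "S' \<in> mp_auts U" "AE x in U. S' (S x) = x" "AE x in U. S (S' x) = x"
    using mp_auts_inverse[OF S] .
  note mS = mp_autsD(1)[OF S]
  show ?thesis
  proof (rule mp_autsI(1))
    show m: "double S \<in> measurable V V" by (rule double_measurable[OF mS])
    show "double S' \<in> measurable V V" by (rule double_measurable[OF mp_autsD(1)[OF S'(1)]])
    show "AE x in V. double S' (double S x) = x" by (rule double_id[OF S S'(2)])
    show "AE x in V. double S (double S' x) = x" by (rule double_id[OF S'(1,3)])
    show "distr V V (double S) = V"
    proof (rule measure_eqI)
      fix W assume "W \<in> sets (distr V V (double S))"
      then have W: "W \<in> sets V" by simp
      have W': "double S -` W \<in> sets V" using measurable_sets[OF m W] by simp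
      note a = sets_V_D[OF W] and b = sets_V_D[OF W']
      have "emeasure U (double S -` W) = emeasure U (S -` W \<inter> space U)"
      proof (rule emeasure_eq_AE)
        show "AE x in U. x \<in> double S -` W \<longleftrightarrow> x \<in> S -` W \<inter> space U"
          using AE_U01 by eventually_elim (simp add: double_def)
      qed (use b measurable_sets[OF mS a(1)] in auto)
      also have "\<dots> = emeasure U W" by (rule mp_auts_emeasure_vimage[OF S a(1)])
      finally have 1: "emeasure U (double S -` W) = emeasure U W" .
      have "emeasure U ((\<lambda>x. x + 1) -` double S -` W) = emeasure U (S -` ((\<lambda>x. x + 1) -` W) \<inter> space U)"
      proof (rule emeasure_eq_AE)
        show "AE x in U. x \<in> (\<lambda>x. x + 1) -` double S -` W \<longleftrightarrow> x \<in> S -` ((\<lambda>x. x + 1) -` W) \<inter> space U"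
          using AE_U01 by eventually_elim (simp add: double_def)
      qed (use b measurable_sets[OF mS a(2)] in auto)
      also have "\<dots> = emeasure U ((\<lambda>x. x + 1) -` W)" by (rule mp_auts_emeasure_vimage[OF S a(2)])
      finally have 2: "emeasure U ((\<lambda>x. x + 1) -` double S -` W) = emeasure U ((\<lambda>x. x + 1) -` W)" .
      have "emeasure (distr V V (double S)) W = emeasure V (double S -` W)"
        using emeasure_distr[OF m W] by simp
      also have "\<dots> = emeasure V W" by (simp only: emeasure_V[OF W] emeasure_V[OF W'] 1 2)
      finally show "emeasure (distr V V (double S)) W = emeasure V W" .
    qed simp
  qed
qed

lemma double_AE_eq:
  "(AE x in V. double S x = double S' x) \<longleftrightarrow> (AE x in U. S x = S' x)"
proof -
  have 1: "(AE x in U. double S x = double S' x) \<longleftrightarrow> (AE x in U. S x = S' x)"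
    by (rule eventually_cong[OF AE_U01]) (simp add: double_def)
  have 2: "(AE x in U. double S (x + 1) = double S' (x + 1)) \<longleftrightarrow> (AE x in U. S x = S' x)"
    by (rule eventually_cong[OF AE_U01]) (simp add: double_def)
  show ?thesis unfolding AE_V 1 2 by simp
qed

lemma double_comp:
  assumes S: "S \<in> mp_auts U" and S': "S' \<in> mp_auts U"
  shows "AE x in V. double (S \<circ> S') x = double S (double S' x)"
  unfolding AE_V
proof
  show "AE x in U. double (S \<circ> S') x = double S (double S' x)"
    using AE_auts01[OF S'] AE_U01 by eventually_elim (simp add: double_def)
  show "AE x in U. double (S \<circ> S') (x + 1) = double S (double S' (x + 1))"
    using AE_auts01[OF S'] AE_U01 by eventually_elim (simp add: double_def)
qed

text \<open>A test set \<open>A\<close> is lifted to a set \<open>W\<close> inside the first half.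
  Since \<open>\<phi>\<close> respects the halves, only the first summand of
  \<open>emeasure_V\<close> survives, for \<open>W\<close> and for its preimage, and the factor 1/2
  cancels.\<close>

lemma undouble_mp_auts:
  assumes \<phi>: "\<phi> \<in> mp_auts V" and sep: "AE x in V. \<phi> x < 1 \<longleftrightarrow> x < 1"
  shows "(\<lambda>x. fold1 (\<phi> x)) \<in> mp_auts U"
proof -
  obtain \<psi> where \<psi>: "\<psi> \<in> mp_auts V" "AE x in V. \<psi> (\<phi> x) = x" "AE x in V. \<phi> (\<psi> x) = x"
    using mp_auts_inverse[OF \<phi>] .
  have sep': "AE x in V. \<psi> x < 1 \<longleftrightarrow> x < 1"
    using AE_mp_auts[OF \<psi>(1) sep] \<psi>(3) by eventually_elim simp
  note sepU = conjunct1[OF sep[unfolded AE_V]] conjunct2[OF sep[unfolded AE_V]]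
    and sepU' = conjunct1[OF sep'[unfolded AE_V]]
    and inv = conjunct1[OF \<psi>(2)[unfolded AE_V]] conjunct1[OF \<psi>(3)[unfolded AE_V]]
  note m\<phi> = mp_autsD(1)[OF \<phi>] and m\<psi> = mp_autsD(1)[OF \<psi>(1)]
  let ?S = "\<lambda>x. fold1 (\<phi> x)" and ?R = "\<lambda>x. fold1 (\<psi> x)"
  have mU: "(\<lambda>x. fold1 (\<theta> x)) \<in> measurable U U" if "\<theta> \<in> measurable V V" for \<theta>
    using measurable_compose[OF measurable_compose[OF id_UV that] fold1_VU] .
  show ?thesis
  proof (rule mp_autsI(1))
    show mS: "?S \<in> measurable U U" "?R \<in> measurable U U" using mU m\<phi> m\<psi> by blast+
    show "AE x in U. fold1 (\<psi> (fold1 (\<phi> x))) = x"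
      using sepU(1) inv(1) AE_U01 by eventually_elim (simp add: fold1_def)
    show "AE x in U. fold1 (\<phi> (fold1 (\<psi> x))) = x"
      using sepU' inv(2) AE_U01 by eventually_elim (simp add: fold1_def)
    show "distr U U ?S = U"
    proof (rule measure_eqI)
      fix A assume "A \<in> sets (distr U U ?S)"
      then have A: "A \<in> sets U" by simp
      define W where "W = fold1 -` A \<inter> {x. x < 1}"
      have W: "W \<in> sets V" unfolding W_def using measurable_sets[OF fold1_VU A] lt1_sets(1) by auto
      have W': "\<phi> -` W \<in> sets V" using measurable_sets[OF m\<phi> W] by simp
      note a = sets_V_D[OF W] and b = sets_V_D[OF W']
      have 1: "emeasure U W = emeasure U A"
      proof (rule emeasure_eq_AE)
        show "AE x in U. x \<in> W \<longleftrightarrow> x \<in> A"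
          using AE_U01 by eventually_elim (simp add: W_def fold1_def)
      qed (use a A in auto)
      have 2: "emeasure U ((\<lambda>x. x + 1) -` W) = emeasure U {}"
      proof (rule emeasure_eq_AE)
        show "AE x in U. x \<in> (\<lambda>x. x + 1) -` W \<longleftrightarrow> x \<in> {}"
          using AE_U01 by eventually_elim (simp add: W_def fold1_def)
      qed (use a in auto)
      have 3: "emeasure U (\<phi> -` W) = emeasure U (?S -` A)"
      proof (rule emeasure_eq_AE)
        show "AE x in U. x \<in> \<phi> -` W \<longleftrightarrow> x \<in> ?S -` A"
          using sepU(1) AE_U01 by eventually_elim (simp add: W_def fold1_def)
      qed (use b measurable_sets[OF mS(1) A] in auto)
      have 4: "emeasure U ((\<lambda>x. x + 1) -` \<phi> -` W) = emeasure U {}"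
      proof (rule emeasure_eq_AE)
        show "AE x in U. x \<in> (\<lambda>x. x + 1) -` \<phi> -` W \<longleftrightarrow> x \<in> {}"
          using sepU(2) AE_U01 by eventually_elim (simp add: W_def fold1_def)
      qed (use b in auto)
      have "emeasure V (\<phi> -` W) = emeasure V W"
        using mp_auts_emeasure_vimage[OF \<phi> W] by simp
      then have "emeasure U (?S -` A) / 2 = emeasure U A / 2"
        unfolding emeasure_V[OF W] emeasure_V[OF W'] 1 2 3 4 by simp
      then have "2 * (emeasure U (?S -` A) / 2) = 2 * (emeasure U A / 2)" by simp
      then have "emeasure U (?S -` A) = emeasure U A"
        by (simp add: ennreal_divide_times mult.commute[of 2] ennreal_divide_self mult_divide_eq_ennreal)
      then show "emeasure (distr U U ?S) A = emeasure U A"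
        using emeasure_distr[OF mS(1) A] by simp
    qed simp
  qed
qed

text \<open>Only the total over both halves has to agree, as the links exchange the halves instead
  of preserving each.\<close>

lemma N2_preserving:
  assumes f: "f \<in> borel_measurable borel"
    and eq: "\<And>B. B \<in> sets borel \<Longrightarrow>
      emeasure N1 (f -` B) + emeasure N1 {x. f (x + 1) \<in> B} = emeasure N1 B + emeasure N1 ((\<lambda>x. x + 1) -` B)"
  shows "distr N2 N2 f = N2"
proof (rule measure_eqI)
  fix B assume "B \<in> sets (distr N2 N2 f)"
  then have B: "B \<in> sets borel" by simp
  have m: "f \<in> measurable N2 N2" using f by (simp cong: measurable_cong_sets)
  have fB: "f -` B \<in> sets borel" using measurable_sets[OF f B] by simp
  have "emeasure (distr N2 N2 f) B = emeasure N2 (f -` B)" using emeasure_distr[OF m, of B] B by simp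
  also have "\<dots> = (emeasure N1 (f -` B) + emeasure N1 {x. f (x + 1) \<in> B}) / 2"
    unfolding emeasure_N2[OF fB] by (simp add: vimage_def)
  also have "\<dots> = emeasure N2 B" unfolding emeasure_N2[OF B] eq[OF B] ..
  finally show "emeasure (distr N2 N2 f) B = emeasure N2 B" .
qed simp

lemma N1_preserving_vimage:
  assumes f: "f \<in> borel_measurable borel" "distr N1 N1 f = N1" and B: "B \<in> sets borel"
  shows "emeasure N1 (f -` B) = emeasure N1 B"
proof -
  have "f \<in> measurable N1 N1" using f by (simp cong: measurable_cong_sets)
  from emeasure_distr[OF this, of B] B show ?thesis by (simp add: f(2))
qed

section \<open>The double is a standard probability space\<close>

lemma lborel_shift:
  assumes B: "B \<in> sets borel"
  shows "emeasure lborel ((\<lambda>x::real. x + c) -` B) = emeasure lborel B"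
proof -
  have "emeasure lborel B = emeasure (distr lborel borel ((+) c)) B" by (simp only: lborel_distr_plus)
  also have "\<dots> = emeasure lborel ((\<lambda>x. x + c) -` B)"
    using B by (subst emeasure_distr) (auto intro!: arg_cong[where f = "emeasure lborel"] simp: add.commute)
  finally show ?thesis by simp
qed

lemma lebesgue_shift: "(\<lambda>x::real. x + c) \<in> measurable lebesgue lebesgue"
  by (rule measurable_completionI) (auto simp: null_sets_def lborel_shift)

text \<open>Off \<open>{0..<1}\<close> a set measurable for \<open>U\<close> may be arbitrary; on
  the interval the null sets of \<open>N1\<close> and of Lebesgue measure agree.\<close>

lemma U_lebesgue:
  assumes B: "B \<in> sets U"
  shows "{0..<1} \<inter> B \<in> sets lebesgue"
proof -
  obtain S N' where S: "B = S \<union> N'" "S \<in> sets borel" and N': "\<exists>N''\<in>null_sets N1. N' \<subseteq> N''"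
    using B by (rule sets_completionE) (use that in auto)
  then obtain N'' where n: "N'' \<in> null_sets N1" "N' \<subseteq> N''" by blast
  have N'': "N'' \<in> sets borel" "emeasure N1 N'' = 0" "N' \<subseteq> N''"
    using null_setsD2[OF n(1)] null_setsD1[OF n(1)] n(2) by simp_all
  then have "{0..<1} \<inter> N'' \<in> null_sets lborel" by (auto simp: null_sets_def emeasure_N1)
  then have "{0..<1} \<inter> N' \<in> null_sets lebesgue"
    using null_sets_completion_subset[OF _ null_sets_completionI] N''(3) by (metis Int_mono subset_refl)
  then have "{0..<1} \<inter> S \<union> {0..<1} \<inter> N' \<in> sets lebesgue" using S by auto
  then show ?thesis by (simp add: S Int_Un_distrib)
qed

text \<open>\<open>K\<close> is left abstract because it has two uses: with \<open>a = 0\<close> it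
  shows that \<open>V\<close> is standard, and with an arbitrary \<open>a\<close> it recognises a
  given atomless standard space.\<close>

lemma iso_U_lebesgue:
  assumes K: "sets K = sets lebesgue"
    and eK: "\<And>A. A \<in> sets lebesgue \<Longrightarrow> emeasure K A = emeasure lebesgue (A \<inter> {a..<a+1})"
  shows "iso_mod_null U K (\<lambda>x. x + a)"
proof (rule iso_mod_nullI)
  have spK: "space K = UNIV" using sets_eq_imp_space_eq[OF K] by simp
  have m: "(\<lambda>x. x + a) \<in> measurable U lebesgue"
  proof (rule measurable_completionI)
    fix A :: "real set" assume "A \<in> null_sets lborel"
    then have A: "A \<in> sets borel" "emeasure lborel A = 0" by auto
    have "emeasure N1 ((\<lambda>x. x + a) -` A) \<le> emeasure lborel ((\<lambda>x. x + a) -` A)"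
      using borel_shift[OF A(1), of a] by (simp add: emeasure_N1) (rule emeasure_mono, auto)
    then show "emeasure N1 ((\<lambda>x. x + a) -` A \<inter> space N1) = 0" by (simp add: lborel_shift A)
  qed simp
  then show mK: "(\<lambda>x. x + a) \<in> measurable U K" using measurable_cong_sets[OF refl K] by blast
  show "distr U K (\<lambda>x. x + a) = K"
  proof (rule measure_eqI)
    fix A assume "A \<in> sets (distr U K (\<lambda>x. x + a))"
    then have A: "A \<in> sets lebesgue" using K by simp
    define S where "S = main_part lborel A"
    have S: "S \<in> sets borel" using main_part_sets[OF A] by (simp add: S_def)
    have ae: "AE x in lebesgue. x \<in> A \<longleftrightarrow> x \<in> S"
      using AE_completion[OF AE_notin_null_part[OF A]]
    proof eventually_elim
      case (elim x)
      then show ?case using main_part_null_part_Un[OF A] by (auto simp: S_def)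
    qed
    have aeU: "AE x in U. x + a \<in> A \<longleftrightarrow> x + a \<in> S"
    proof -
      obtain B where B: "B \<in> sets borel" "emeasure lborel B = 0" "{x. (x \<in> A) \<noteq> (x \<in> S)} \<subseteq> B"
        using ae unfolding AE_completion_null by auto
      have "emeasure N1 ((\<lambda>x. x + a) -` B) \<le> emeasure lborel ((\<lambda>x. x + a) -` B)"
        using borel_shift[OF B(1), of a] by (simp add: emeasure_N1) (rule emeasure_mono, auto)
      then show ?thesis unfolding AE_completion_null using B borel_shift[OF B(1), of a]
        by (intro bexI[of _ "(\<lambda>x. x + a) -` B"]) (auto simp: lborel_shift)
    qed
    have "emeasure (distr U K (\<lambda>x. x + a)) A = emeasure U ((\<lambda>x. x + a) -` A)"
      using A K by (subst emeasure_distr[OF mK]) auto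
    also have "\<dots> = emeasure U ((\<lambda>x. x + a) -` S)"
      using aeU measurable_sets[OF m, of A] measurable_sets[OF m, of S] A S by (intro emeasure_eq_AE) auto
    also have "\<dots> = emeasure lborel ({0..<1} \<inter> (\<lambda>x. x + a) -` S)"
      using borel_shift[OF S, of a] by (simp add: emeasure_N1)
    also have "\<dots> = emeasure lborel ((\<lambda>x. x + a) -` (S \<inter> {a..<a+1}))"
      by (rule arg_cong[where f = "emeasure lborel"]) auto
    also have "\<dots> = emeasure lebesgue (S \<inter> {a..<a+1})" using S lborel_shift[of "S \<inter> {a..<a+1}" a] by simp
    also have "\<dots> = emeasure lebesgue (A \<inter> {a..<a+1})"
      using ae A S by (intro emeasure_eq_AE) auto
    finally show "emeasure (distr U K (\<lambda>x. x + a)) A = emeasure K A" by (simp add: eK[OF A])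
  qed simp
  \<comment> \<open>The value 0 off the interval is a dummy on a null set; it is the reason why the
    complement of the interval appears in preimages of sets containing 0.\<close>
  show "(\<lambda>y. if a \<le> y \<and> y < a + 1 then y - a else 0) \<in> measurable K U"
  proof (rule measurableI)
    fix B assume B: "B \<in> sets U"
    have "(\<lambda>y. if a \<le> y \<and> y < a + 1 then y - a else 0) -` B \<inter> space K
        = (\<lambda>y. y + (- a)) -` ({0..<1} \<inter> B) \<union> (if 0 \<in> B then - {a..<a+1} else {})"
      by (auto simp: spK split: if_splits)
    then show "(\<lambda>y. if a \<le> y \<and> y < a + 1 then y - a else 0) -` B \<inter> space K \<in> sets K"
      using measurable_sets[OF lebesgue_shift U_lebesgue[OF B], of "- a"] K by auto
  qed simp
  show "AE x in U. (if a \<le> x + a \<and> x + a < a + 1 then x + a - a else 0) = x"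
    using AE_U01 by eventually_elim simp
  have "AE y in K. a \<le> y \<and> y < a + 1"
  proof (rule AE_I)
    show "{y \<in> space K. \<not> (a \<le> y \<and> y < a + 1)} \<subseteq> - {a..<a+1}" by auto
    have "- {a..<a+1} \<in> sets lebesgue" by auto
    then show "- {a..<a+1} \<in> sets K" "emeasure K (- {a..<a+1}) = 0" using eK[of "- {a..<a+1}"] K by auto
  qed
  then show "AE y in K. (if a \<le> y \<and> y < a + 1 then y - a else 0) + a = y"
    by eventually_elim simp
qed

lemma iso_N2_N1: "iso_mod_null N2 N1 (\<lambda>x. x / 2)"
proof (rule iso_mod_nullI)
  show "distr N2 N1 (\<lambda>x. x / 2) = N1"
  proof (rule measure_eqI)
    fix B assume "B \<in> sets (distr N2 N1 (\<lambda>x. x / 2))"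
    then have B: "B \<in> sets borel" by simp
    have hB: "(\<lambda>x. x / 2) -` B \<in> sets borel" using measurable_sets[of "\<lambda>x. x / 2" borel borel B] B by simp
    have "emeasure lborel ({0..<1} \<inter> B) = emeasure (distr lborel borel ((*) (1/2))) ({0..<1} \<inter> B) / 2"
      using B by (subst lborel_distr_mult) (auto simp: emeasure_density_const ennreal_mult_divide_eq mult.commute[of 2])
    also have "emeasure (distr lborel borel ((*) (1/2))) ({0..<1} \<inter> B)
        = emeasure lborel ({0..<2} \<inter> (\<lambda>x. x / 2) -` B)"
      using B by (subst emeasure_distr) (auto intro!: arg_cong[where f = "emeasure lborel"])
    finally have 1: "emeasure N1 B = emeasure lborel ({0..<2} \<inter> (\<lambda>x. x / 2) -` B) / 2"
      using B by (simp add: emeasure_N1)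
    have "emeasure (distr N2 N1 (\<lambda>x. x / 2)) B = emeasure N2 ((\<lambda>x. x / 2) -` B)"
      using B by (subst emeasure_distr) auto
    also have "\<dots> = emeasure lborel ({0..<2} \<inter> (\<lambda>x. x / 2) -` B) / 2"
      unfolding N2_def using hB by (subst emeasure_uniform_measure) simp_all
    finally show "emeasure (distr N2 N1 (\<lambda>x. x / 2)) B = emeasure N1 B" using 1 by simp
  qed simp
  show "(\<lambda>x. x / 2) \<in> measurable N2 N1" "(\<lambda>x. x * 2) \<in> measurable N1 N2" by simp_all
qed simp_all

lemma sets_lebesgue_with_atoms: "sets (lebesgue_with_atoms I D w) = sets lebesgue"
  unfolding lebesgue_with_atoms_def using sets.sigma_sets_eq[of "lebesgue :: real measure"]
  by (subst sets_measure_of) auto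

lemma standard_V: "standard_prob_space V"
  unfolding standard_prob_space_def
proof (intro conjI exI)
  show "prob_space V" using prob_space.prob_space_completion[OF prob_N2] .
  show "complete_measure V" by (rule completion.complete_measure_axioms)
  show "is_interval {0..<1::real}" by simp
  show "countable ({} :: real set)" by simp
  let ?K = "lebesgue_with_atoms {0..<1} {} (\<lambda>_. 0)"
  have "iso_mod_null U ?K (\<lambda>x. x + 0)"
    by (rule iso_U_lebesgue[OF sets_lebesgue_with_atoms]) (simp add: emeasure_lebesgue_with_atoms nn_integral_count_space_indicator)
  then show "iso_mod_null V ?K ((\<lambda>x. x + 0) \<circ> (\<lambda>x. x / 2))"
    using iso_completion[OF iso_N2_N1] by (rule_tac iso_mod_null_trans)
qed


section \<open>Borel automorphisms of the unit interval\<close>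

text \<open>Being the identity off \<open>{0..<1}\<close>, such a map acts on the double without
  disturbing the second half, and its translate by 1 leaves the first half alone.\<close>

definition unit_aut :: "(real \<Rightarrow> real) \<Rightarrow> (real \<Rightarrow> real) \<Rightarrow> bool" where
  "unit_aut T T' \<longleftrightarrow> T \<in> borel_measurable borel \<and> T' \<in> borel_measurable borel \<and>
     (\<forall>x. T' (T x) = x) \<and> (\<forall>x. T (T' x) = x) \<and> distr N1 N1 T = N1 \<and>
     (\<forall>x. x \<notin> {0..<1} \<longrightarrow> T x = x)"

lemma unit_autD:
  assumes "unit_aut T T'"
  shows "T \<in> borel_measurable borel" "T' \<in> borel_measurable borel" "T' (T x) = x" "T (T' x) = x"
    "distr N1 N1 T = N1" "x \<notin> {0..<1} \<Longrightarrow> T x = x" "T \<in> measurable N1 N1" "T' \<in> measurable N1 N1"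
  using assms unfolding unit_aut_def by (blast, blast, blast, blast, blast, blast, simp_all cong: measurable_cong_sets)

lemma unit_aut_sym:
  assumes T: "unit_aut T T'"
  shows "unit_aut T' T"
proof -
  note D = unit_autD[OF T]
  have "distr N1 N1 T' = distr (distr N1 N1 T) N1 T'" by (simp only: D(5))
  also have "\<dots> = distr N1 N1 (T' \<circ> T)" by (rule distr_distr[OF D(8,7)])
  also have "T' \<circ> T = (\<lambda>x. x)" using D(3) by auto
  finally have "distr N1 N1 T' = N1" by (simp only: distr_id)
  moreover have "T' x = x" if "x \<notin> {0..<1}" for x using D(3)[of x] D(6)[OF that] by simp
  ultimately show ?thesis using D(1-4) unfolding unit_aut_def by blast
qed

lemma unit_aut_mem:
  assumes T: "unit_aut T T'"
  shows "0 \<le> T x \<and> T x < 1 \<longleftrightarrow> 0 \<le> x \<and> x < 1"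
  using unit_autD(6)[OF T, of x] unit_autD(6)[OF unit_aut_sym[OF T], of "T x"] unit_autD(3)[OF T, of x]
  by (cases "x \<in> {0..<1}"; cases "T x \<in> {0..<1}") auto

lemma unit_aut_mp:
  assumes T: "unit_aut T T'"
  shows "T \<in> mp_auts U"
proof (rule mp_autsI(1))
  note D = unit_autD[OF T] and D' = unit_autD[OF unit_aut_sym[OF T]]
  show "T \<in> measurable U U" "distr U U T = U" using measure_preserving_completion[OF D(7,5)] by blast+
  show "T' \<in> measurable U U" using measure_preserving_completion(1)[OF D'(7,5)] .
  show "AE x in U. T' (T x) = x" "AE x in U. T (T' x) = x" using D(3,4) by simp_all
qed

lemma unit_aut_id: "unit_aut (\<lambda>x. x) (\<lambda>x. x)"
  unfolding unit_aut_def by (simp add: distr_id)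

lemma unit_aut_funpow:
  assumes T: "unit_aut T T'"
  shows "unit_aut (T ^^ n) (T' ^^ n)"
proof (induction n)
  case 0
  then show ?case using unit_aut_id by (simp add: id_def)
next
  case (Suc n)
  note D = unit_autD[OF T] and I = unit_autD[OF Suc]
  have "distr N1 N1 (T \<circ> T ^^ n) = distr (distr N1 N1 (T ^^ n)) N1 T"
    by (rule distr_distr[OF D(7) I(7), symmetric])
  also have "\<dots> = N1" by (simp only: I(5) D(5))
  finally have 1: "distr N1 N1 (T ^^ Suc n) = N1" by simp
  have 2: "(T ^^ Suc n) \<in> borel_measurable borel" "(T' ^^ Suc n) \<in> borel_measurable borel"
    using measurable_comp[OF I(1) D(1)] measurable_comp[OF I(2) D(2)] by simp_all
  have 3: "(T' ^^ Suc n) ((T ^^ Suc n) x) = x" "(T ^^ Suc n) ((T' ^^ Suc n) x) = x" for x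
  proof -
    have r: "T' ^^ Suc n = T' ^^ n \<circ> T'" "T ^^ Suc n = T ^^ n \<circ> T" by (rule funpow_Suc_right)+
    have l: "T' ^^ Suc n = T' \<circ> T' ^^ n" "T ^^ Suc n = T \<circ> T ^^ n" by simp_all
    show "(T' ^^ Suc n) ((T ^^ Suc n) x) = x" unfolding r(1) l(2) by (simp only: comp_apply D(3) I(3))
    show "(T ^^ Suc n) ((T' ^^ Suc n) x) = x" unfolding r(2) l(1) by (simp only: comp_apply D(4) I(4))
  qed
  have 4: "(T ^^ Suc n) x = x" if "x \<notin> {0..<1}" for x using D(6)[OF that] I(6)[OF that] by simp
  show ?case using 1 2 3 4 unfolding unit_aut_def by blast
qed

lemma aperiodic_inj:
  assumes T: "unit_aut T T'" and ap: "\<forall>n>0. (T ^^ n) x \<noteq> x"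
  shows "(T ^^ a) x = (T ^^ b) x \<longleftrightarrow> a = b" and "(T' ^^ a) x = (T' ^^ b) x \<longleftrightarrow> a = b"
proof -
  have 1: "(T ^^ a) x \<noteq> (T ^^ b) x" if "a < b" for a b
  proof
    assume "(T ^^ a) x = (T ^^ b) x"
    also have "(T ^^ b) x = (T ^^ a) ((T ^^ (b - a)) x)"
      using funpow_add[of a "b - a" T] that by simp
    finally have "(T ^^ (b - a)) x = x"
      using unit_autD(3)[OF unit_aut_funpow[OF T, of a]] by metis
    then show False using ap that by simp
  qed
  have 2: "(T' ^^ a) x \<noteq> (T' ^^ b) x" if "a < b" for a b
  proof
    assume eq: "(T' ^^ a) x = (T' ^^ b) x"
    have "(T' ^^ b) x = (T' ^^ (b - a)) ((T' ^^ a) x)"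
      using funpow_add[of "b - a" a T'] that by simp
    then have "(T ^^ (b - a)) ((T' ^^ b) x) = (T' ^^ a) x"
      using unit_autD(4)[OF unit_aut_funpow[OF T, of "b - a"]] by simp
    then have "(T ^^ (b - a)) ((T' ^^ a) x) = (T' ^^ a) x" using eq by simp
    then have "(T ^^ a) ((T ^^ (b - a)) ((T' ^^ a) x)) = (T ^^ a) ((T' ^^ a) x)" by simp
    then have "(T ^^ (b - a)) ((T ^^ a) ((T' ^^ a) x)) = (T ^^ a) ((T' ^^ a) x)"
      using funpow_add[of a "b - a" T] funpow_add[of "b - a" a T] that by (metis add.commute comp_apply)
    then have "(T ^^ (b - a)) x = x" using unit_autD(4)[OF unit_aut_funpow[OF T, of a]] by simp
    then show False using ap that by simp
  qed
  show "(T ^^ a) x = (T ^^ b) x \<longleftrightarrow> a = b" using 1[of a b] 1[of b a] by (cases a b rule: linorder_cases) auto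
  show "(T' ^^ a) x = (T' ^^ b) x \<longleftrightarrow> a = b" using 2[of a b] 2[of b a] by (cases a b rule: linorder_cases) auto
qed

lemma measure_zero_one_AE:
  assumes "prob_space M" "A \<in> sets M" "measure M A = 0 \<or> measure M A = 1"
  shows "(AE x in M. x \<notin> A) \<or> (AE x in M. x \<in> A)"
proof -
  interpret prob_space M by fact
  show ?thesis using assms AE_iff_measurable[of A M "\<lambda>x. x \<notin> A"] prob_eq_1[of A]
    by (auto simp: emeasure_eq_measure dest: sets.sets_into_space)
qed

lemma prob_U: "prob_space U" using prob_space.prob_space_completion[OF prob_N1] .

text \<open>If \<open>T ^^ n\<close> were the identity, the union of \<open>n\<close> translates of a small interval would be
  invariant.\<close>

lemma ergodic_aperiodic:
  assumes T: "unit_aut T T'" and erg: "ae_ergodic U T"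
  shows "AE x in U. \<forall>n>0. (T ^^ n) x \<noteq> x"
proof -
  interpret prob_space U by (rule prob_U)
  have [measurable]: "T ^^ i \<in> borel_measurable borel" for i using unit_autD(1)[OF unit_aut_funpow[OF T]] .
  have "AE x in U. (T ^^ n) x \<noteq> x" if n: "n > 0" for n
  proof -
    define P where "P = {x. (T ^^ n) x = x}"
    have "P \<in> sets borel" unfolding P_def by measurable
    then have P: "P \<in> sets U" by simp
    have "T x \<in> P \<longleftrightarrow> x \<in> P" for x
      using unit_autD(3)[OF T] by (simp add: P_def funpow_swap1[symmetric]) metis
    then have "measure U P = 0 \<or> measure U P = 1" using erg P by (auto simp: ae_ergodic_def)
    then consider "AE x in U. x \<notin> P" | "AE x in U. x \<in> P"
      using measure_zero_one_AE[OF prob_U P] by blast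
    then show ?thesis
    proof cases
      case 1
      then show ?thesis by (simp add: P_def)
    next
      case 2
      \<comment> \<open>With length \<open>1 / (2 * n)\<close> the \<open>n\<close> preimages have
        total measure 1/2, so their union is neither null nor full.\<close>
      define J where "J = {0..<1 / (2 * real n)}"
      define W where "W = (\<Union>i<n. (T ^^ i) -` J)"
      have TJ: "(T ^^ i) -` J \<in> sets borel" for i
        using measurable_sets[of "T ^^ i" borel borel J] by (simp add: J_def)
      then have Wb: "W \<in> sets borel" by (auto simp: W_def)
      then have W: "W \<in> sets U" by simp
      have "AE x in U. T x \<in> W \<longleftrightarrow> x \<in> W"
        using 2
      proof eventually_elim
        case (elim x)
        then have per: "(T ^^ n) x = x" by (simp add: P_def)
        show ?case
        proof
          assume "T x \<in> W"
          then obtain i where i: "i < n" "(T ^^ Suc i) x \<in> J" by (auto simp: W_def funpow_swap1)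
          show "x \<in> W"
          proof (cases "Suc i = n")
            case True
            then have "(T ^^ 0) x \<in> J" using i per by simp
            then show ?thesis using n unfolding W_def by blast
          next
            case False
            then have "Suc i < n" using i by simp
            then show ?thesis using i(2) unfolding W_def by blast
          qed
        next
          assume "x \<in> W"
          then obtain i where i: "i < n" "(T ^^ i) x \<in> J" by (auto simp: W_def)
          obtain j where j: "j < n" "(T ^^ Suc j) x = (T ^^ i) x"
          proof (cases i)
            case 0
            then show ?thesis using that[of "n - 1"] n per by simp
          next
            case (Suc j)
            then show ?thesis using that[of j] i by simp
          qed
          then have "(T ^^ j) (T x) \<in> J" using i by (simp add: funpow_swap1)
          then show "T x \<in> W" using j unfolding W_def by blast
        qed
      qed
      then have 01: "measure U W = 0 \<or> measure U W = 1" using erg W by (auto simp: ae_ergodic_def)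
      have "{0..<1} \<inter> J = J" using n by (auto simp: J_def field_simps)
      then have eJ: "emeasure U J = ennreal (1 / (2 * real n))"
        using emeasure_N1[of J] n by (simp add: J_def)
      have eTJ: "emeasure U ((T ^^ i) -` J) = ennreal (1 / (2 * real n))" for i
        using mp_auts_emeasure_vimage[OF unit_aut_mp[OF unit_aut_funpow[OF T, of i]], of J] eJ
        by (simp add: J_def)
      have "measure U ((T ^^ 0) -` J) \<le> measure U W"
        using TJ Wb n by (intro finite_measure_mono) (auto simp: W_def)
      then have "1 / (2 * real n) \<le> measure U W" using eTJ[of 0] by (simp add: measure_def)
      then have 1: "measure U W \<noteq> 0" using n by auto
      have "measure U W \<le> (\<Sum>i<n. measure U ((T ^^ i) -` J))"
        unfolding W_def using TJ by (intro finite_measure_subadditive_finite) auto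
      also have "\<dots> = (\<Sum>i<n. 1 / (2 * real n))"
        using eTJ by (intro sum.cong refl) (simp only: measure_def, simp)
      also have "\<dots> = 1 / 2" using n by simp
      finally show ?thesis using 01 1 by linarith
    qed
  qed
  then have "AE x in U. \<forall>n. n > 0 \<longrightarrow> (T ^^ n) x \<noteq> x"
    by (subst AE_all_countable) auto
  then show ?thesis by simp
qed

lemma commutes_with_funpow:
  assumes T: "T \<in> mp_auts M" and S: "commutes_with M T S"
  shows "commutes_with M (T ^^ n) S"
proof (induction n)
  case 0
  then show ?case by (simp add: commutes_with_def)
next
  case (Suc n)
  show ?case
    using AE_mp_auts[OF mp_auts_funpow[OF T, of n] S[unfolded commutes_with_def]] Suc[unfolded commutes_with_def]
    unfolding commutes_with_def by eventually_elim simp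
qed

lemma commutes_with_inverse:
  assumes T: "unit_aut T T'" and S: "commutes_with U T S"
  shows "commutes_with U T' S"
  using AE_mp_auts[OF unit_aut_mp[OF unit_aut_sym[OF T]] S[unfolded commutes_with_def]]
  unfolding commutes_with_def
  by eventually_elim (metis unit_autD(3)[OF T] unit_autD(4)[OF T])

lemma inverts_swap:
  assumes T: "unit_aut T T'" and S: "inverts U T S"
  shows "AE x in U. S (T x) = T' (S x)" "AE x in U. S (T' x) = T (S x)"
proof -
  show "AE x in U. S (T x) = T' (S x)"
    using S[unfolded inverts_def] by eventually_elim (metis unit_autD(3)[OF T])
  show "AE x in U. S (T' x) = T (S x)"
    using AE_mp_auts[OF unit_aut_mp[OF unit_aut_sym[OF T]] S[unfolded inverts_def]]
    by eventually_elim (simp add: unit_autD(4)[OF T])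
qed

section \<open>The graphing of an ergodic automorphism\<close>

text \<open>The first copy \<open>{0..<1}\<close> of the interval carries the lines \<open>x, T x, T\<^sup>2 x, \<dots>\<close>, the second copy
  \<open>{1..<2}\<close> carries the edges of the involution \<open>\<tau>\<close>, and \<open>1 + x\<close> is linked to \<open>T ^^ k x\<close> for \<open>k \<in> F\<close>.
  The two copies are told apart by their degrees.\<close>

locale line_graph =
  fixes T T' \<tau> \<tau>' :: "real \<Rightarrow> real" and F :: "nat list"
  assumes T: "unit_aut T T'" and \<tau>: "unit_aut \<tau> \<tau>'"
    and erg: "ae_ergodic U T" and \<tau>\<tau>: "AE x in U. \<tau> (\<tau> x) = x"
    and F: "0 \<in> set F" "distinct F"
begin

text \<open>The two branches are inverse to each other, so a link is an involution exchanging the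
  halves, and a single generator yields a symmetric set of edges.\<close>

definition link :: "nat \<Rightarrow> real \<Rightarrow> real" where
  "link k x = (if 0 \<le> x \<and> x < 1 then (T' ^^ k) x + 1 else if 1 \<le> x \<and> x < 2 then (T ^^ k) (x - 1) else x)"

definition gens :: "(real \<Rightarrow> real) list" where
  "gens = [T, T', \<lambda>x. \<tau> (x - 1) + 1, \<lambda>x. \<tau>' (x - 1) + 1] @ map link F"

lemma T_pow: "unit_aut (T ^^ k) (T' ^^ k)" "unit_aut (T' ^^ k) (T ^^ k)"
  using unit_aut_funpow[OF T] unit_aut_sym by blast+

lemma T': "unit_aut T' T" and \<tau>': "unit_aut \<tau>' \<tau>"
  using T \<tau> unit_aut_sym by blast+

lemma link_link: "link k (link k x) = x"
proof -
  consider "0 \<le> x \<and> x < 1" | "0 \<le> x - 1 \<and> x - 1 < 1" | "\<not> (0 \<le> x \<and> x < 2)" by linarith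
  then show ?thesis
  proof cases
    case 1
    then show ?thesis using unit_aut_mem[OF T_pow(2), of k x] unit_autD(3)[OF T_pow(2)]
      by (auto simp: link_def)
  next
    case 2
    then show ?thesis using unit_aut_mem[OF T_pow(1), of k "x - 1"] unit_autD(3)[OF T_pow(1)]
      by (auto simp: link_def)
  qed (auto simp: link_def)
qed

lemma link_borel: "link k \<in> borel_measurable borel"
proof -
  have [measurable]: "T ^^ k \<in> borel_measurable borel" "T' ^^ k \<in> borel_measurable borel"
    using unit_autD(1)[OF T_pow(1)] unit_autD(1)[OF T_pow(2)] .
  show ?thesis unfolding link_def by measurable
qed

lemma N1_cong:
  assumes "\<And>x. 0 \<le> x \<Longrightarrow> x < 1 \<Longrightarrow> x \<in> A \<longleftrightarrow> x \<in> B" "A \<in> sets borel" "B \<in> sets borel"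
  shows "emeasure N1 A = emeasure N1 B"
proof -
  have "{0..<1} \<inter> A = {0..<1} \<inter> B" using assms(1) by auto
  then show ?thesis using assms by (simp add: emeasure_N1)
qed

lemma vimage_borel: "f \<in> borel_measurable borel \<Longrightarrow> B \<in> sets borel \<Longrightarrow> f -` B \<in> sets borel"
  using measurable_sets[of f borel borel B] by simp

lemma unit_aut_N2:
  assumes S: "unit_aut S S'"
  shows "distr N2 N2 S = N2" and "distr N2 N2 (\<lambda>x. S (x - 1) + 1) = N2"
proof -
  have Sb [measurable]: "S \<in> borel_measurable borel" by (rule unit_autD(1)[OF S])
  show "distr N2 N2 S = N2"
  proof (rule N2_preserving)
    fix B :: "real set" assume B: "B \<in> sets borel"
    have "emeasure N1 {x. S (x + 1) \<in> B} = emeasure N1 ((\<lambda>x. x + 1) -` B)"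
      by (rule N1_cong) (use unit_autD(6)[OF S] B vimage_borel[OF Sb B] borel_shift[of _ 1] in \<open>auto simp: vimage_def\<close>)
    then show "emeasure N1 (S -` B) + emeasure N1 {x. S (x + 1) \<in> B} = emeasure N1 B + emeasure N1 ((\<lambda>x. x + 1) -` B)"
      using N1_preserving_vimage[OF Sb unit_autD(5)[OF S] B] by simp
  qed (rule Sb)
  show "distr N2 N2 (\<lambda>x. S (x - 1) + 1) = N2"
  proof (rule N2_preserving)
    show m: "(\<lambda>x. S (x - 1) + 1) \<in> borel_measurable borel" by measurable
    fix B :: "real set" assume B: "B \<in> sets borel"
    have "emeasure N1 ((\<lambda>x. S (x - 1) + 1) -` B) = emeasure N1 B"
      by (rule N1_cong) (use unit_autD(6)[OF S] B vimage_borel[OF m B] in auto)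
    moreover have "emeasure N1 {x. S (x + 1 - 1) + 1 \<in> B} = emeasure N1 ((\<lambda>x. x + 1) -` B)"
      using N1_preserving_vimage[OF Sb unit_autD(5)[OF S] borel_shift[OF B, of 1]] by (simp add: vimage_def)
    ultimately show "emeasure N1 ((\<lambda>x. S (x - 1) + 1) -` B) + emeasure N1 {x. S (x + 1 - 1) + 1 \<in> B}
        = emeasure N1 B + emeasure N1 ((\<lambda>x. x + 1) -` B)" by simp
  qed
qed

lemma link_N2: "distr N2 N2 (link k) = N2"
proof (rule N2_preserving[OF link_borel])
  fix B :: "real set" assume B: "B \<in> sets borel"
  note Tk = unit_autD[OF T_pow(1), of k] and T'k = unit_autD[OF T_pow(2), of k]
  have "emeasure N1 (link k -` B) = emeasure N1 ((T' ^^ k) -` ((\<lambda>x. x + 1) -` B))"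
    by (rule N1_cong) (use vimage_borel[OF link_borel B] vimage_borel[OF T'k(1) borel_shift[OF B, of 1]]
        in \<open>auto simp: link_def\<close>)
  also have "\<dots> = emeasure N1 ((\<lambda>x. x + 1) -` B)"
    by (rule N1_preserving_vimage[OF T'k(1,5) borel_shift[OF B]])
  finally have 1: "emeasure N1 (link k -` B) = emeasure N1 ((\<lambda>x. x + 1) -` B)" .
  have "emeasure N1 {x. link k (x + 1) \<in> B} = emeasure N1 ((T ^^ k) -` B)"
    by (rule N1_cong) (use borel_shift[OF vimage_borel[OF link_borel[of k] B], of 1] vimage_borel[OF Tk(1) B]
        in \<open>auto simp: link_def vimage_def\<close>)
  also have "\<dots> = emeasure N1 B" by (rule N1_preserving_vimage[OF Tk(1,5) B])
  finally show "emeasure N1 (link k -` B) + emeasure N1 {x. link k (x + 1) \<in> B}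
      = emeasure N1 B + emeasure N1 ((\<lambda>x. x + 1) -` B)" using 1 by (simp add: add.commute)
qed

sublocale borel_generators N2 gens
proof (rule borel_generators.intro)
  show "prob_space N2" "sets N2 = sets borel" "standard_prob_space V"
    using prob_N2 standard_V by simp_all
  fix g assume g: "g \<in> set gens"
  note TD = unit_autD[OF T] and \<tau>D = unit_autD[OF \<tau>]
  have [measurable]: "\<tau> \<in> borel_measurable borel" "\<tau>' \<in> borel_measurable borel" using \<tau>D(1,2) .
  show "g \<in> borel_measurable borel" using g TD(1,2) link_borel by (auto simp: gens_def)
  show "distr N2 N2 g = N2"
    using g unit_aut_N2[OF T] unit_aut_N2[OF T'] unit_aut_N2[OF \<tau>] unit_aut_N2[OF \<tau>'] link_N2
    unfolding gens_def set_append list.set set_map by blast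
  consider "g = T" | "g = T'" | "g = (\<lambda>x. \<tau> (x - 1) + 1)" | "g = (\<lambda>x. \<tau>' (x - 1) + 1)" | k where "k \<in> set F" "g = link k"
    using g by (auto simp: gens_def)
  then show "\<exists>h\<in>set gens. (\<forall>x. h (g x) = x) \<and> (\<forall>x. g (h x) = x)"
  proof cases
    case 1
    then show ?thesis using TD(3,4) by (intro bexI[of _ T']) (auto simp: gens_def)
  next
    case 2
    then show ?thesis using TD(3,4) by (intro bexI[of _ T]) (auto simp: gens_def)
  next
    case 3
    then show ?thesis using \<tau>D(3,4) by (intro bexI[of _ "\<lambda>x. \<tau>' (x - 1) + 1"]) (auto simp: gens_def)
  next
    case 4
    then show ?thesis using \<tau>D(3,4) by (intro bexI[of _ "\<lambda>x. \<tau> (x - 1) + 1"]) (auto simp: gens_def)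
  next
    case 5
    then show ?thesis using link_link by (intro bexI[of _ "link k"]) (auto simp: gens_def)
  qed
qed

lemma E_first:
  assumes "0 \<le> x" "x < 1"
  shows "E `` {x} \<inter> {y. y < 1} = {T x, T' x} - {x}"
    and "E `` {x} \<inter> {y. \<not> y < 1} = (\<lambda>k. (T' ^^ k) x + 1) ` set F"
proof -
  have b: "0 \<le> T x \<and> T x < 1" "0 \<le> T' x \<and> T' x < 1" "0 \<le> (T' ^^ k) x \<and> (T' ^^ k) x < 1" for k
    using assms unit_aut_mem[OF T] unit_aut_mem[OF T'] unit_aut_mem[OF T_pow(2)] by blast+
  have t: "\<tau> (x - 1) = x - 1" "\<tau>' (x - 1) = x - 1"
    using assms unit_autD(6)[OF \<tau>, of "x - 1"] unit_autD(6)[OF \<tau>', of "x - 1"] by auto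
  have l: "link k x = (T' ^^ k) x + 1" for k using assms by (simp add: link_def)
  have ne: "(T' ^^ k) x + 1 \<noteq> x" for k using b(3)[of k] assms by linarith
  have E: "E `` {x} = ({T x, T' x} - {x}) \<union> (\<lambda>k. (T' ^^ k) x + 1) ` set F"
    unfolding E_Image unfolding gens_def using t ne ne[symmetric] by (auto simp: l image_image)
  have b1: "\<not> (T' ^^ k) x + 1 < 1" for k using b(3)[of k] by linarith
  show "E `` {x} \<inter> {y. y < 1} = {T x, T' x} - {x}" unfolding E using b(1,2) b1 ne ne[symmetric] by auto
  show "E `` {x} \<inter> {y. \<not> y < 1} = (\<lambda>k. (T' ^^ k) x + 1) ` set F" unfolding E using b(1,2) b1 by auto
qed

lemma E_second:
  assumes "0 \<le> x" "x < 1"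
  shows "E `` {x + 1} \<inter> {y. y < 1} = (\<lambda>k. (T ^^ k) x) ` set F"
    and "E `` {x + 1} \<inter> {y. \<not> y < 1} = (\<lambda>y. y + 1) ` ({\<tau> x, \<tau>' x} - {x})"
proof -
  have b: "0 \<le> \<tau> x \<and> \<tau> x < 1" "0 \<le> \<tau>' x \<and> \<tau>' x < 1" "0 \<le> (T ^^ k) x \<and> (T ^^ k) x < 1" for k
    using assms unit_aut_mem[OF \<tau>] unit_aut_mem[OF \<tau>'] unit_aut_mem[OF T_pow(1)] by blast+
  have t: "T (x + 1) = x + 1" "T' (x + 1) = x + 1"
    using assms unit_autD(6)[OF T, of "x + 1"] unit_autD(6)[OF T', of "x + 1"] by auto
  have l: "link k (x + 1) = (T ^^ k) x" for k using assms by (simp add: link_def)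
  have ne: "(T ^^ k) x \<noteq> x + 1" for k using b(3)[of k] assms by linarith
  have E: "E `` {x + 1} = (\<lambda>y. y + 1) ` ({\<tau> x, \<tau>' x} - {x}) \<union> (\<lambda>k. (T ^^ k) x) ` set F"
    unfolding E_Image unfolding gens_def using t ne ne[symmetric] by (auto simp: l image_image)
  show "E `` {x + 1} \<inter> {y. y < 1} = (\<lambda>k. (T ^^ k) x) ` set F" unfolding E using b by auto
  show "E `` {x + 1} \<inter> {y. \<not> y < 1} = (\<lambda>y. y + 1) ` ({\<tau> x, \<tau>' x} - {x})" unfolding E using b by auto
qed

lemma aperiodic: "AE x in U. \<forall>n>0. (T ^^ n) x \<noteq> x"
  by (rule ergodic_aperiodic[OF T erg])

text \<open>On the first half a union of components is invariant under \<open>T\<close>. The link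
  with exponent 0 joins \<open>x\<close> to \<open>x + 1\<close>, so on the second half the union is
  a translate of the same set up to null sets, and its measure in \<open>V\<close> equals that in
  \<open>U\<close>.\<close>

lemma ergodic_graphing_E: "ergodic_graphing V E"
  unfolding ergodic_graphing_def
proof (intro conjI allI impI)
  show "graphing V E" by (rule graphing_E)
  fix C assume C: "C \<subseteq> components V E" and W: "\<Union>C \<in> sets V"
  note sat = components_saturated[OF C]
  note WU = sets_V_D[OF W]
  have "AE x in U. T x \<in> \<Union>C \<longleftrightarrow> x \<in> \<Union>C"
  proof (rule AE_I2)
    fix x
    have "(x, T x) \<in> E \<or> T x = x" by (auto simp: gen_edges_def gens_def)
    then show "T x \<in> \<Union>C \<longleftrightarrow> x \<in> \<Union>C" using sat[of x "T x"] by auto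
  qed
  then have 01: "measure U (\<Union>C) = 0 \<or> measure U (\<Union>C) = 1" using erg WU unfolding ae_ergodic_def by blast
  have "AE x in U. x \<in> (\<lambda>x. x + 1) -` \<Union>C \<longleftrightarrow> x \<in> \<Union>C"
    using AE_U01
  proof eventually_elim
    case (elim x)
    have "(T' ^^ 0) x + 1 \<in> E `` {x} \<inter> {y. \<not> y < 1}"
      unfolding E_first(2)[OF conjunct1[OF elim] conjunct2[OF elim]] using F by blast
    then have "(x, x + 1) \<in> E" by simp
    then show ?case using sat[of x "x + 1"] by blast
  qed
  then have "emeasure U ((\<lambda>x. x + 1) -` \<Union>C) = emeasure U (\<Union>C)"
    using WU by (intro emeasure_eq_AE) auto
  then have "emeasure V (\<Union>C) = (emeasure U (\<Union>C) + emeasure U (\<Union>C)) / 2"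
    using emeasure_V[OF W] by simp
  also have "\<dots> = emeasure U (\<Union>C)"
    by (simp add: mult_2_right[symmetric] mult_divide_eq_ennreal)
  finally show "measure V (\<Union>C) = 0 \<or> measure V (\<Union>C) = 1" using 01 by (simp add: measure_def)
qed

end


section \<open>Reading the automorphisms off the graph\<close>

context line_graph
begin

lemma tau_inverse: "AE x in U. \<tau>' x = \<tau> x"
  using \<tau>\<tau> by eventually_elim (metis unit_autD(3)[OF \<tau>])

lemma E_split: "E `` {x} = (E `` {x} \<inter> {y. y < 1}) \<union> (E `` {x} \<inter> {y. \<not> y < 1})"
  by blast

lemma card_E_split:
  "card (E `` {x}) = card (E `` {x} \<inter> {y. y < 1}) + card (E `` {x} \<inter> {y. \<not> y < 1})"
proof -
  have "finite (E `` {x} \<inter> {y. y < 1})" "finite (E `` {x} \<inter> {y. \<not> y < 1})"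
    using finite_E_Image by blast+
  then show ?thesis by (subst E_split, subst card_Un_disjoint) auto
qed

lemma degree_first:
  assumes x: "0 \<le> x" "x < 1" and ap: "\<forall>n>0. (T ^^ n) x \<noteq> x"
  shows "card (E `` {x}) = 2 + length F" and "{T x, T' x} - {x} = {T x, T' x}"
proof -
  note inj = aperiodic_inj[OF T ap]
  have "T x \<noteq> x" using ap[rule_format, of 1] by simp
  moreover have "T' x \<noteq> x" using inj(2)[of 1 0] by simp
  moreover have "T x \<noteq> T' x"
    using ap[rule_format, of 2] unit_autD(4)[OF T, of x] by (auto simp: numeral_2_eq_2)
  ultimately have 1: "{T x, T' x} - {x} = {T x, T' x}" "card {T x, T' x} = 2" by auto
  have "inj_on (\<lambda>k. (T' ^^ k) x + 1) (set F)" using inj(2) by (auto simp: inj_on_def)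
  then have "card ((\<lambda>k. (T' ^^ k) x + 1) ` set F) = length F"
    using F(2) by (simp add: card_image distinct_card)
  then show "card (E `` {x}) = 2 + length F" using 1 by (simp add: card_E_split E_first[OF x])
  show "{T x, T' x} - {x} = {T x, T' x}" by (rule 1)
qed

lemma degree_second:
  assumes x: "0 \<le> x" "x < 1" and "\<tau>' x = \<tau> x"
  shows "card (E `` {x + 1}) \<le> 1 + length F"
proof -
  have "card ((\<lambda>y. y + 1) ` ({\<tau> x, \<tau>' x} - {x})) \<le> card ({\<tau> x})"
    using assms(3) by (intro order_trans[OF card_image_le] card_mono) auto
  moreover have "card ((\<lambda>k. (T ^^ k) x) ` set F) \<le> length F"
    by (rule order_trans[OF card_image_le card_length]) simp
  ultimately show ?thesis by (simp add: card_E_split E_second[OF x])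
qed

text \<open>A point of the first half has two neighbours on its line, distinct by aperiodicity, and
  one link for each element of \<open>F\<close>. A point of the second half has its links and at
  most one further neighbour, because \<open>\<tau>\<close> and \<open>\<tau>'\<close> agree almost
  everywhere.\<close>

lemma degree_AE: "AE x in V. card (E `` {x}) = 2 + length F \<longleftrightarrow> x < 1"
  unfolding AE_V
proof
  show "AE x in U. card (E `` {x}) = 2 + length F \<longleftrightarrow> x < 1"
    using AE_U01 aperiodic by eventually_elim (simp add: degree_first(1))
  show "AE x in U. card (E `` {x + 1}) = 2 + length F \<longleftrightarrow> x + 1 < 1"
    using AE_U01 tau_inverse by eventually_elim (use degree_second in fastforce)
qed

text \<open>The almost everywhere inverse makes \<open>\<phi>\<close> injective on the neighbours of
  almost every point, so degrees are preserved.\<close>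

lemma nbr_separates:
  assumes \<phi>: "\<phi> \<in> mp_auts V" and n: "nbr \<phi>"
  shows "AE x in V. \<phi> x < 1 \<longleftrightarrow> x < 1"
proof -
  obtain \<psi> where \<psi>: "\<psi> \<in> mp_auts V" "AE x in V. \<psi> (\<phi> x) = x" using mp_auts_inverse[OF \<phi>] by metis
  show ?thesis
    using n[unfolded nbr_def] AE_nbr[OF \<psi>(2)] degree_AE AE_mp_auts[OF \<phi> degree_AE]
  proof eventually_elim
    case (elim x)
    have "inj_on \<phi> (E `` {x})" using elim(2) by (intro inj_on_inverseI[where g = \<psi>]) blast
    then have "card (E `` {\<phi> x}) = card (E `` {x})" using elim(1) card_image by metis
    then show ?case using elim by simp
  qed
qed

lemma nbr_parts:
  assumes "\<phi> ` (E `` {x}) = E `` {\<phi> x}" "\<forall>y\<in>E `` {x}. \<phi> y < 1 \<longleftrightarrow> y < 1"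
  shows "\<phi> ` (E `` {x} \<inter> {y. y < 1}) = E `` {\<phi> x} \<inter> {y. y < 1}"
    and "\<phi> ` (E `` {x} \<inter> {y. \<not> y < 1}) = E `` {\<phi> x} \<inter> {y. \<not> y < 1}"
  unfolding assms(1)[symmetric] using assms(2) by blast+

text \<open>The choice propagates along the line. The neighbours of \<open>v = S (T x)\<close> are
  \<open>u = S x\<close> and \<open>w = S (T (T x))\<close>, so \<open>w\<close> is the successor of
  \<open>v\<close> exactly if \<open>u\<close> is its predecessor; aperiodicity keeps predecessor
  and successor apart.\<close>

lemma dichotomy:
  assumes S: "S \<in> mp_auts U" and eq: "AE x in U. {S (T x), S (T' x)} = {T (S x), T' (S x)}"
  shows "commutes_with U T S \<or> inverts U T S"
proof -
  note mT = unit_aut_mp[OF T]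
  define Z where "Z = {x. S (T x) = T (S x)}"
  have Z: "Z \<in> sets U"
  proof -
    have "(\<lambda>x. x) \<in> borel_measurable U" by (rule measurable_completion) simp
    then have b: "f \<in> borel_measurable U" if "f \<in> measurable U U" for f :: "real \<Rightarrow> real"
      using measurable_compose[OF that] by blast
    have [measurable]: "(\<lambda>x. S (T x)) \<in> borel_measurable U" "(\<lambda>x. T (S x)) \<in> borel_measurable U"
      using b measurable_compose[OF mp_autsD(1)[OF mT] mp_autsD(1)[OF S]]
        measurable_compose[OF mp_autsD(1)[OF S] mp_autsD(1)[OF mT]] by blast+
    have "{x \<in> space U. S (T x) = T (S x)} \<in> sets U" by measurable
    then show ?thesis by (simp add: Z_def)
  qed
  have step: "AE x in U. (x \<in> Z \<or> S (T x) = T' (S x)) \<and> (T x \<in> Z \<longleftrightarrow> x \<in> Z)"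
    using eq AE_mp_auts[OF mT eq] AE_mp_auts[OF S aperiodic]
  proof eventually_elim
    case (elim x)
    define u v w where uvw: "u = S x" "v = S (T x)" "w = S (T (T x))"
    have TT: "T' (T y) = y" "T (T' y) = y" for y using unit_autD(3,4)[OF T] .
    have 1: "v = T u \<or> v = T' u" using elim(1) by (auto simp: uvw doubleton_eq_iff)
    have 2: "{w, u} = {T v, T' v}" using elim(2) by (simp add: uvw TT)
    have 3: "T (T u) \<noteq> u" using elim(3)[rule_format, of 2] by (simp add: uvw numeral_2_eq_2)
    have Zx: "x \<in> Z \<longleftrightarrow> v = T u" and ZTx: "T x \<in> Z \<longleftrightarrow> w = T v" by (simp_all add: Z_def uvw)
    from 1 show ?case
    proof
      assume v: "v = T u"
      then have "w = T v" using 2 3 by (auto simp: doubleton_eq_iff TT)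
      then show ?thesis using v Zx ZTx by simp
    next
      assume v: "v = T' u"
      have nZ: "v \<noteq> T u"
      proof
        assume "v = T u"
        then have "T (T u) = T (T' u)" using v by simp
        then show False using 3 by (simp add: TT)
      qed
      have "w \<noteq> T v"
      proof
        assume "w = T v"
        then have "T' v = u" using 2 v by (auto simp: doubleton_eq_iff TT)
        then have "T u = v" by (auto simp: TT)
        then show False using nZ by simp
      qed
      then show ?thesis using v nZ Zx ZTx uvw by simp
    qed
  qed
  have "AE x in U. T x \<in> Z \<longleftrightarrow> x \<in> Z" using step by eventually_elim simp
  then have "measure U Z = 0 \<or> measure U Z = 1" using erg Z by (simp add: ae_ergodic_def)
  then consider "AE x in U. x \<in> Z" | "AE x in U. x \<notin> Z" using measure_zero_one_AE[OF prob_U Z] by blast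
  then show ?thesis
  proof cases
    case 1
    then show ?thesis by (simp add: Z_def commutes_with_def)
  next
    case 2
    have "AE x in U. T (S (T x)) = S x"
      using step 2 by eventually_elim (auto simp: unit_autD(4)[OF T])
    then show ?thesis by (simp add: inverts_def)
  qed
qed

text \<open>On the two halves \<open>\<phi>\<close> acts by maps \<open>S\<close> and
  \<open>R\<close> that are a priori unrelated. The links tie them together only through sets of
  points; that \<open>R\<close> agrees with \<open>S\<close> depends on \<open>F\<close> and is
  settled later.\<close>

lemma nbr_analysis:
  assumes \<phi>: "\<phi> \<in> mp_auts V" and n: "nbr \<phi>"
  obtains S R where "S \<in> mp_auts U" "AE x in U. \<phi> x = S x" "AE x in U. \<phi> (x + 1) = R x + 1"
    "AE x in U. {S (T x), S (T' x)} = {T (S x), T' (S x)}"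
    "AE x in U. (\<lambda>k. S ((T ^^ k) x)) ` set F = (\<lambda>k. (T ^^ k) (R x)) ` set F"
    "AE x in U. R (\<tau> x) = \<tau> (R x)"
proof -
  define S where "S x = fold1 (\<phi> x)" for x
  define R where "R x = \<phi> (x + 1) - 1" for x
  note sep = nbr_separates[OF \<phi> n]
  note sep1 = conjunct1[OF sep[unfolded AE_V]] and sep2 = conjunct2[OF sep[unfolded AE_V]]
  have S: "S \<in> mp_auts U" unfolding S_def by (rule undouble_mp_auts[OF \<phi> sep])
  have \<phi>S: "AE x in U. \<phi> x = S x"
    using sep1 AE_U01 by eventually_elim (simp add: S_def fold1_def)
  have \<phi>S01: "AE x in U. 0 \<le> \<phi> x \<and> \<phi> x < 1"
    using \<phi>S AE_auts01[OF S] by eventually_elim simp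
  have "AE x in V. 0 \<le> x \<and> x < 2"
    unfolding AE_V using AE_U01 by (auto elim: eventually_mono)
  from AE_mp_auts[OF \<phi> this] have "AE x in U. 0 \<le> \<phi> (x + 1) \<and> \<phi> (x + 1) < 2"
    unfolding AE_V by simp
  then have R01: "AE x in U. 0 \<le> R x \<and> R x < 1"
    using sep2 AE_U01 by eventually_elim (simp add: R_def)
  note n' = n[unfolded nbr_def AE_V] and s' = AE_nbr[OF sep, unfolded AE_V]
  have ap\<phi>: "AE x in U. \<forall>n>0. (T ^^ n) (\<phi> x) \<noteq> \<phi> x"
    using AE_mp_auts[OF S aperiodic] \<phi>S by eventually_elim simp
  have 1: "AE x in U. {\<phi> (T x), \<phi> (T' x)} = {T (\<phi> x), T' (\<phi> x)}"
    using conjunct1[OF n'] conjunct1[OF s'] AE_U01 \<phi>S01 aperiodic ap\<phi>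
  proof eventually_elim
    case (elim x)
    have x: "0 \<le> x" "x < 1" and px: "0 \<le> \<phi> x" "\<phi> x < 1" using elim by simp_all
    from nbr_parts(1)[OF elim(1,2)] show ?case
      unfolding E_first(1)[OF x] E_first(1)[OF px] degree_first(2)[OF x elim(5)] degree_first(2)[OF px elim(6)]
      by simp
  qed
  have A: "AE x in U. {S (T x), S (T' x)} = {T (S x), T' (S x)}"
    using 1 \<phi>S AE_mp_auts[OF unit_aut_mp[OF T] \<phi>S] AE_mp_auts[OF unit_aut_mp[OF T'] \<phi>S]
    by eventually_elim simp
  have "AE x in U. \<forall>k\<in>set F. \<phi> ((T ^^ k) x) = S ((T ^^ k) x)"
    by (rule AE_finite_allI) (use AE_mp_auts[OF unit_aut_mp[OF T_pow(1)] \<phi>S] in auto)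
  then have B: "AE x in U. (\<lambda>k. S ((T ^^ k) x)) ` set F = (\<lambda>k. (T ^^ k) (R x)) ` set F"
    using conjunct2[OF n'] conjunct2[OF s'] AE_U01 R01
  proof eventually_elim
    case (elim x)
    have x: "0 \<le> x" "x < 1" and Rx: "0 \<le> R x" "R x < 1" using elim by simp_all
    have R: "\<phi> (x + 1) = R x + 1" by (simp add: R_def)
    have "(\<lambda>k. S ((T ^^ k) x)) ` set F = \<phi> ` ((\<lambda>k. (T ^^ k) x) ` set F)"
      unfolding image_image by (rule image_cong) (use elim(1) in auto)
    also have "\<dots> = (\<lambda>k. (T ^^ k) (R x)) ` set F"
      using nbr_parts(1)[OF elim(2,3)] unfolding R E_second(1)[OF x] E_second(1)[OF Rx] .
    finally show ?case .
  qed
  have "AE x in U. \<tau>' (R x) = \<tau> (R x)"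
  proof -
    \<comment> \<open>Nothing is known yet about \<open>R\<close> and null sets of \<open>U\<close>,
      so the set where \<open>\<tau>'\<close> and \<open>\<tau>\<close> differ is pulled back along
      \<open>\<phi>\<close> on \<open>V\<close>.\<close>
    have "AE x in V. \<not> x < 1 \<longrightarrow> \<tau>' (x - 1) = \<tau> (x - 1)"
      unfolding AE_V using AE_U01 tau_inverse by (auto elim: eventually_mono eventually_elim2)
    from AE_mp_auts[OF \<phi> this] have "AE x in U. \<not> \<phi> (x + 1) < 1 \<longrightarrow> \<tau>' (R x) = \<tau> (R x)"
      unfolding AE_V R_def by simp
    then show ?thesis using sep2 AE_U01 by eventually_elim simp
  qed
  then have C: "AE x in U. R (\<tau> x) = \<tau> (R x)"
    using conjunct2[OF n'] conjunct2[OF s'] AE_U01 R01 tau_inverse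
  proof eventually_elim
    case (elim x)
    have x: "0 \<le> x" "x < 1" and Rx: "0 \<le> R x" "R x < 1" using elim by simp_all
    have R: "\<phi> (x + 1) = R x + 1" by (simp add: R_def)
    have "(\<lambda>y. R y + 1) ` ({\<tau> x} - {x}) = \<phi> ` ((\<lambda>y. y + 1) ` ({\<tau> x, \<tau>' x} - {x}))"
      unfolding image_image elim(6) R_def by simp
    also have "\<dots> = (\<lambda>y. y + 1) ` ({\<tau> (R x), \<tau>' (R x)} - {R x})"
      using nbr_parts(2)[OF elim(2,3)] unfolding R E_second(2)[OF x] E_second(2)[OF Rx] .
    finally have "(\<lambda>y. R y + 1) ` ({\<tau> x} - {x}) = (\<lambda>y. y + 1) ` ({\<tau> (R x)} - {R x})"
      by (simp add: elim(1))
    \<comment> \<open>Loops are not edges, so a fixed point of \<open>\<tau>\<close> shows up as an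
      empty set; the equation then makes both \<open>x\<close> and \<open>R x\<close> fixed, or
      neither.\<close>
    then show ?case by (cases "\<tau> x = x"; cases "\<tau> (R x) = R x") auto
  qed
  show thesis
    by (rule that[OF S \<phi>S _ A B C]) (simp add: R_def)
qed

text \<open>An inverting \<open>S\<close> swaps the two neighbours on a line and so keeps the lines.
  Links with exponent 0 join \<open>x\<close> to \<open>x + 1\<close> and ignore the direction, so
  they survive an inversion as well.\<close>

lemma double_nbr:
  assumes S: "S \<in> mp_auts U" and ST: "commutes_with U T S \<or> inverts U T S \<and> F = [0]"
    and S\<tau>: "commutes_with U \<tau> S"
  shows "nbr (double S)"
proof -
  have ab: "AE x in U. {S (T x), S (T' x)} = {T (S x), T' (S x)}"
    using ST
  proof
    assume c: "commutes_with U T S"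
    show ?thesis using c[unfolded commutes_with_def] commutes_with_inverse[OF T c, unfolded commutes_with_def]
      by eventually_elim simp
  next
    assume "inverts U T S \<and> F = [0]"
    then have c: "inverts U T S" by simp
    show ?thesis using inverts_swap[OF T c] by eventually_elim auto
  qed
  have F1: "AE x in U. \<forall>k\<in>set F. S ((T ^^ k) x) = (T ^^ k) (S x) \<and> S ((T' ^^ k) x) = (T' ^^ k) (S x)"
    using ST
  proof
    assume c: "commutes_with U T S"
    show ?thesis
    proof (rule AE_finite_allI)
      fix k
      show "AE x in U. S ((T ^^ k) x) = (T ^^ k) (S x) \<and> S ((T' ^^ k) x) = (T' ^^ k) (S x)"
        using commutes_with_funpow[OF unit_aut_mp[OF T] c, of k]
          commutes_with_funpow[OF unit_aut_mp[OF T'] commutes_with_inverse[OF T c], of k]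
        unfolding commutes_with_def by eventually_elim simp
    qed simp
  next
    assume "inverts U T S \<and> F = [0]"
    then show ?thesis by simp
  qed
  obtain S' where S': "AE x in U. S' (S x) = x" using mp_auts_inverse[OF S] by metis
  note apS = AE_mp_auts[OF S aperiodic] and tS = AE_mp_auts[OF S tau_inverse]
  note S01 = AE_auts01[OF S]
  show ?thesis unfolding nbr_def AE_V
  proof
    show "AE x in U. double S ` (E `` {x}) = E `` {double S x}"
      using ab F1 AE_U01 S01 aperiodic apS
    proof eventually_elim
      case (elim x)
      have x: "0 \<le> x" "x < 1" and Sx: "0 \<le> S x" "S x < 1" using elim by simp_all
      have dx: "double S x = S x" using x by (simp add: double_def)
      have Tx: "T x < 1" "T' x < 1" "\<And>k. 0 \<le> (T' ^^ k) x"
        using x unit_aut_mem[OF T, of x] unit_aut_mem[OF T', of x] unit_aut_mem[OF T_pow(2), of _ x] by blast+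
      have "double S ` {T x, T' x} = {T (S x), T' (S x)}"
        using Tx elim(1) by (simp add: double_def)
      moreover have "double S ` (\<lambda>k. (T' ^^ k) x + 1) ` set F = (\<lambda>k. (T' ^^ k) (S x) + 1) ` set F"
        unfolding image_image using Tx(3) elim(2) by (intro image_cong) (auto simp: double_def not_less[symmetric])
      moreover have "E `` {x} = {T x, T' x} \<union> (\<lambda>k. (T' ^^ k) x + 1) ` set F"
        by (subst E_split) (simp only: E_first[OF x] degree_first(2)[OF x elim(5)])
      moreover have "E `` {S x} = {T (S x), T' (S x)} \<union> (\<lambda>k. (T' ^^ k) (S x) + 1) ` set F"
        by (subst E_split) (simp only: E_first[OF Sx] degree_first(2)[OF Sx elim(6)])
      ultimately show ?case by (simp only: dx image_Un)
    qed
    show "AE x in U. double S ` (E `` {x + 1}) = E `` {double S (x + 1)}"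
      using F1 S\<tau>[unfolded commutes_with_def] AE_U01 S01 tau_inverse tS S' AE_mp_auts[OF unit_aut_mp[OF \<tau>] S']
    proof eventually_elim
      case (elim x)
      have x: "0 \<le> x" "x < 1" and Sx: "0 \<le> S x" "S x < 1" using elim by simp_all
      have dx: "double S (x + 1) = S x + 1" using x by (simp add: double_def)
      have b: "\<And>k. (T ^^ k) x < 1" "0 \<le> \<tau> x"
        using x unit_aut_mem[OF \<tau>, of x] unit_aut_mem[OF T_pow(1), of _ x] by blast+
      have "\<tau> x = x \<longleftrightarrow> \<tau> (S x) = S x" using elim(2,7,8) by metis
      then have "double S ` (\<lambda>y. y + 1) ` ({\<tau> x} - {x}) = (\<lambda>y. y + 1) ` ({\<tau> (S x)} - {S x})"
        using b elim(2) by (cases "\<tau> x = x") (simp_all add: double_def not_less[symmetric])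
      moreover have "double S ` (\<lambda>k. (T ^^ k) x) ` set F = (\<lambda>k. (T ^^ k) (S x)) ` set F"
        unfolding image_image using b(1) elim(1) by (intro image_cong) (auto simp: double_def)
      moreover have "E `` {x + 1} = (\<lambda>k. (T ^^ k) x) ` set F \<union> (\<lambda>y. y + 1) ` ({\<tau> x} - {x})"
        by (subst E_split) (simp only: E_second[OF x] elim(5) insert_absorb2)
      moreover have "E `` {S x + 1} = (\<lambda>k. (T ^^ k) (S x)) ` set F \<union> (\<lambda>y. y + 1) ` ({\<tau> (S x)} - {S x})"
        by (subst E_split) (simp only: E_second[OF Sx] elim(6) insert_absorb2)
      ultimately show ?case by (simp only: dx image_Un)
    qed
  qed
qed

text \<open>Hypothesis \<open>R\<close> isolates the combinatorics of \<open>F\<close>: the links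
  must make both halves move alike and, unless \<open>F = [0]\<close>, exclude inversions that do
  not also commute with \<open>T\<close>.\<close>

lemma graphing_aut_group_iso:
  assumes P: "\<And>S. P S \<longleftrightarrow> (commutes_with U T S \<or> inverts U T S \<and> F = [0]) \<and> commutes_with U \<tau> S"
    and R: "\<And>S R. S \<in> mp_auts U \<Longrightarrow> commutes_with U T S \<or> inverts U T S \<Longrightarrow>
      AE x in U. (\<lambda>k. S ((T ^^ k) x)) ` set F = (\<lambda>k. (T ^^ k) (R x)) ` set F \<Longrightarrow>
      (AE x in U. R x = S x) \<and> (inverts U T S \<longrightarrow> commutes_with U T S \<or> F = [0])"
  shows "graphing_aut_group V E \<cong> sub_aut U P"
  unfolding graphing_aut_group_eq
proof (rule sub_aut_iso[where \<Phi> = double])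
  have ana: "\<exists>S\<in>mp_auts U. P S \<and> (AE x in V. double S x = \<phi> x)" if \<phi>: "\<phi> \<in> mp_auts V" "nbr \<phi>" for \<phi>
  proof -
    obtain S R' where S: "S \<in> mp_auts U" "AE x in U. \<phi> x = S x" "AE x in U. \<phi> (x + 1) = R' x + 1"
      "AE x in U. {S (T x), S (T' x)} = {T (S x), T' (S x)}"
      "AE x in U. (\<lambda>k. S ((T ^^ k) x)) ` set F = (\<lambda>k. (T ^^ k) (R' x)) ` set F"
      "AE x in U. R' (\<tau> x) = \<tau> (R' x)" by (rule nbr_analysis[OF \<phi>])
    note d = dichotomy[OF S(1,4)]
    have eq: "AE x in U. R' x = S x" and d': "inverts U T S \<longrightarrow> commutes_with U T S \<or> F = [0]"
      using R[OF S(1) d S(5)] by simp_all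
    have "commutes_with U \<tau> S"
      using S(6) eq AE_mp_auts[OF unit_aut_mp[OF \<tau>] eq] unfolding commutes_with_def by eventually_elim simp
    then have "P S" using d d' P by blast
    moreover have "AE x in V. double S x = \<phi> x"
      unfolding AE_V
    proof
      show "AE x in U. double S x = \<phi> x" using AE_U01 S(2) by eventually_elim (simp add: double_def)
      show "AE x in U. double S (x + 1) = \<phi> (x + 1)"
        using AE_U01 S(3) eq by eventually_elim (simp add: double_def)
    qed
    ultimately show ?thesis using S(1) by blast
  qed
  show "\<exists>S\<in>mp_auts U. AE x in V. double S x = \<phi> x" if "\<phi> \<in> mp_auts V" "nbr \<phi>" for \<phi>
    using ana[OF that] by blast
  show "P S \<longleftrightarrow> nbr (double S)" if S: "S \<in> mp_auts U" for S
  proof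
    assume "P S"
    then show "nbr (double S)" using double_nbr[OF S] P by blast
  next
    assume "nbr (double S)"
    then obtain S' where S': "S' \<in> mp_auts U" "P S'" "AE x in V. double S' x = double S x"
      using ana[OF double_mp_auts[OF S]] by blast
    then have eq: "AE x in U. S' x = S x" by (simp add: double_AE_eq)
    have c: "commutes_with U h S" if "commutes_with U h S'" "h \<in> mp_auts U" for h
      using that(1) eq AE_mp_auts[OF that(2) eq] unfolding commutes_with_def by eventually_elim simp
    have "inverts U T S" if "inverts U T S'"
      using that eq AE_mp_auts[OF unit_aut_mp[OF T] eq] unfolding inverts_def by eventually_elim simp
    then show "P S" using S'(2) c unit_aut_mp[OF T] unit_aut_mp[OF \<tau>] unfolding P by blast
  qed
qed (use double_mp_auts double_AE_eq double_comp nbr_cong in blast)+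

end


section \<open>Transfer to the unit interval\<close>

lemma borel_measurable_U:
  fixes f :: "real \<Rightarrow> real"
  assumes "f \<in> measurable U U"
  shows "f \<in> borel_measurable U"
proof -
  have "(\<lambda>x. x) \<in> borel_measurable U" by (rule measurable_completion) simp
  then show ?thesis using measurable_compose[OF assms] by blast
qed

lemma borel_measurable_N1: "f \<in> borel_measurable borel \<longleftrightarrow> f \<in> borel_measurable N1"
  by (simp cong: measurable_cong_sets)

lemma borel_mp_auts:
  assumes h: "h \<in> mp_auts U"
  obtains g where "g \<in> borel_measurable borel" "AE x in U. g x = h x" "g \<in> mp_auts U"
proof -
  obtain g where g: "g \<in> borel_measurable N1" "AE x in N1. h x = g x"
    using completion_ex_borel_measurable_real[OF borel_measurable_U[OF mp_autsD(1)[OF h]]] by blast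
  have gb: "g \<in> borel_measurable borel" using g(1) borel_measurable_N1 by blast
  have ae: "AE x in U. h x = g x" using g(2) by (rule AE_completion)
  have "g \<in> measurable U U"
  proof (rule measurable_completionI)
    show "g \<in> measurable N1 N1" using gb by (simp cong: measurable_cong_sets)
    fix A assume A: "A \<in> null_sets N1"
    then have A': "A \<in> sets borel" "emeasure N1 A = 0" using null_setsD2[OF A] null_setsD1[OF A] by simp_all
    have gA: "g -` A \<in> sets borel" using measurable_sets[OF gb A'(1)] by simp
    have "emeasure U (g -` A) = emeasure U (h -` A \<inter> space U)"
      using ae gA measurable_sets[OF mp_autsD(1)[OF h], of A] A'(1) by (intro emeasure_eq_AE) auto
    also have "\<dots> = emeasure U A" using A' by (intro mp_auts_emeasure_vimage[OF h]) simp
    finally show "emeasure N1 (g -` A \<inter> space N1) = 0" using gA A' by simp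
  qed
  then have "g \<in> mp_auts U" using mp_auts_cong_AE[OF h _ ae] by blast
  moreover have "AE x in U. g x = h x" using ae by eventually_elim simp
  ultimately show thesis using that gb by blast
qed

text \<open>Borel versions \<open>g\<close> and \<open>k\<close> of \<open>h\<close> and its inverse
  cancel only on a conull set \<open>B0\<close>. The points whose forward orbits under
  \<open>g\<close> and under \<open>k\<close> stay in \<open>B0\<close> form a conull set that both
  maps carry into itself, so \<open>g\<close> restricts to a bijection of it, which is completed by
  the identity.\<close>

lemma unit_aut_version:
  assumes h: "h \<in> mp_auts U"
  obtains T T' where "unit_aut T T'" "AE x in U. T x = h x"
proof -
  obtain h' where h': "h' \<in> mp_auts U" "AE x in U. h' (h x) = x" "AE x in U. h (h' x) = x"
    using mp_auts_inverse[OF h] .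
  obtain g where g: "g \<in> borel_measurable borel" "AE x in U. g x = h x" "g \<in> mp_auts U"
    using borel_mp_auts[OF h] .
  obtain k where k: "k \<in> borel_measurable borel" "AE x in U. k x = h' x" "k \<in> mp_auts U"
    using borel_mp_auts[OF h'(1)] .
  note [measurable] = g(1) k(1)
  have gn [measurable]: "(g ^^ n) \<in> borel_measurable borel" "(k ^^ n) \<in> borel_measurable borel" for n
    by (induction n) auto
  define B0 where "B0 = {x. 0 \<le> x \<and> x < 1 \<and> k (g x) = x \<and> g (k x) = x}"
  have B0 [measurable]: "B0 \<in> sets borel" unfolding B0_def by measurable
  have "AE x in U. x \<in> B0"
    using AE_U01 AE_mp_auts[OF h k(2)] AE_mp_auts[OF h'(1) g(2)] g(2) k(2) h'(2,3)
    by eventually_elim (simp add: B0_def)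
  note ae0 = this
  define B where "B = {x. \<forall>n. (g ^^ n) x \<in> B0 \<and> (k ^^ n) x \<in> B0}"
  have B [measurable]: "B \<in> sets borel" unfolding B_def by measurable
  have aeB: "AE x in U. x \<in> B"
  proof -
    have "AE x in U. \<forall>n. (g ^^ n) x \<in> B0 \<and> (k ^^ n) x \<in> B0"
    proof (subst AE_all_countable, rule allI)
      fix n
      show "AE x in U. (g ^^ n) x \<in> B0 \<and> (k ^^ n) x \<in> B0"
        using AE_mp_auts[OF mp_auts_funpow[OF g(3)] ae0] AE_mp_auts[OF mp_auts_funpow[OF k(3)] ae0]
        by eventually_elim simp
    qed
    then show ?thesis by (simp add: B_def)
  qed
  have BB: "x \<in> B0" if "x \<in> B" for x
  proof -
    have "(g ^^ 0) x \<in> B0" using that unfolding B_def by blast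
    then show ?thesis by simp
  qed
  have inv: "k (g x) = x" "g (k x) = x" if "x \<in> B" for x using BB[OF that] by (simp_all add: B0_def)
  have gB: "g x \<in> B" if x: "x \<in> B" for x
  proof -
    have "(g ^^ n) (g x) \<in> B0 \<and> (k ^^ n) (g x) \<in> B0" for n
    proof
      have "(g ^^ Suc n) x \<in> B0" using x unfolding B_def by blast
      then show "(g ^^ n) (g x) \<in> B0" by (simp add: funpow_swap1)
      show "(k ^^ n) (g x) \<in> B0"
      proof (cases n)
        case 0
        have "(g ^^ Suc 0) x \<in> B0" using x unfolding B_def by blast
        then show ?thesis using 0 by simp
      next
        case (Suc m)
        have "(k ^^ Suc m) (g x) = (k ^^ m) x" using inv(1)[OF x] by (simp add: funpow_swap1)
        then show ?thesis using x Suc unfolding B_def by simp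
      qed
    qed
    then show ?thesis by (simp add: B_def)
  qed
  have kB: "k x \<in> B" if x: "x \<in> B" for x
  proof -
    have "(g ^^ n) (k x) \<in> B0 \<and> (k ^^ n) (k x) \<in> B0" for n
    proof
      have "(k ^^ Suc n) x \<in> B0" using x unfolding B_def by blast
      then show "(k ^^ n) (k x) \<in> B0" by (simp add: funpow_swap1)
      show "(g ^^ n) (k x) \<in> B0"
      proof (cases n)
        case 0
        have "(k ^^ Suc 0) x \<in> B0" using x unfolding B_def by blast
        then show ?thesis using 0 by simp
      next
        case (Suc m)
        have "(g ^^ Suc m) (k x) = (g ^^ m) x" using inv(2)[OF x] by (simp add: funpow_swap1)
        then show ?thesis using x Suc unfolding B_def by simp
      qed
    qed
    then show ?thesis by (simp add: B_def)
  qed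
  define T where "T x = (if x \<in> B then g x else x)" for x
  define T' where "T' x = (if x \<in> B then k x else x)" for x
  have Tb: "T \<in> borel_measurable borel" "T' \<in> borel_measurable borel"
    unfolding T_def T'_def by measurable
  have Tg: "AE x in U. T x = h x" using aeB g(2) by eventually_elim (simp add: T_def)
  have "distr N1 N1 T = N1"
  proof (rule measure_eqI)
    fix A assume "A \<in> sets (distr N1 N1 T)"
    then have A: "A \<in> sets borel" by simp
    have TA: "T -` A \<in> sets borel" using measurable_sets[OF Tb(1) A] by simp
    have TN: "T \<in> measurable N1 N1" using Tb by (simp cong: measurable_cong_sets)
    have "emeasure (distr N1 N1 T) A = emeasure U (T -` A)"
      using emeasure_distr[OF TN, of A] A TA by simp
    also have "\<dots> = emeasure U (h -` A \<inter> space U)"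
      using Tg TA measurable_sets[OF mp_autsD(1)[OF h], of A] A by (intro emeasure_eq_AE) auto
    also have "\<dots> = emeasure U A" using A by (intro mp_auts_emeasure_vimage[OF h]) simp
    finally show "emeasure (distr N1 N1 T) A = emeasure N1 A" using A by simp
  qed simp
  moreover have "T' (T x) = x" "T (T' x) = x" for x
    using gB kB inv by (simp_all add: T_def T'_def)
  moreover have "T x = x" if "x \<notin> {0..<1}" for x
    using BB[of x] that by (auto simp: T_def B0_def)
  ultimately have "unit_aut T T'" unfolding unit_aut_def using Tb by blast
  then show thesis using that Tg by blast
qed

lemma ae_ergodic_transfer:
  assumes f: "iso_mod_null M N f" "g \<in> measurable N M" "AE x in M. g (f x) = x"
    and T: "T \<in> mp_auts M" and erg: "ae_ergodic M T" and T1: "AE y in N. T1 y = f (T (g y))"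
  shows "ae_ergodic N T1"
  unfolding ae_ergodic_def
proof (intro ballI impI)
  fix A assume A: "A \<in> sets N" and inv: "AE x in N. T1 x \<in> A \<longleftrightarrow> x \<in> A"
  have fm: "f \<in> measurable M N" and fd: "distr M N f = N" using f(1) unfolding iso_mod_null_def by blast+
  let ?B = "f -` A \<inter> space M"
  have B: "?B \<in> sets M" using measurable_sets[OF fm A] .
  have "AE x in M. T x \<in> ?B \<longleftrightarrow> x \<in> ?B"
    using AE_distr_eq[OF fm fd inv] AE_distr_eq[OF fm fd T1] f(3) AE_space
  proof eventually_elim
    case (elim x)
    then show ?case using measurable_space[OF mp_autsD(1)[OF T]] by simp
  qed
  then have "measure M ?B = 0 \<or> measure M ?B = 1" using erg B unfolding ae_ergodic_def by blast
  moreover have "measure M ?B = measure N A"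
    using measure_distr[OF fm A] by (simp only: fd)
  ultimately show "measure N A = 0 \<or> measure N A = 1" by simp
qed

section \<open>Centralisers under isomorphism of the underlying space\<close>

lemma commutes_with_cong:
  assumes S: "S \<in> mp_auts M" and eq: "AE x in M. T x = T1 x"
  shows "commutes_with M T S \<longleftrightarrow> commutes_with M T1 S" and "T \<in> mp_auts M \<Longrightarrow> inverts M T S \<longleftrightarrow> inverts M T1 S"
proof -
  have e: "AE x in M. T x = T1 x \<and> T (S x) = T1 (S x)"
    using eq AE_mp_auts[OF S eq] by eventually_elim simp
  show "commutes_with M T S \<longleftrightarrow> commutes_with M T1 S"
    unfolding commutes_with_def by (rule eventually_cong[OF e]) auto
  assume T: "T \<in> mp_auts M"
  have e: "AE x in M. T x = T1 x \<and> T (S (T x)) = T1 (S (T x))"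
    using eq AE_mp_auts[OF T AE_mp_auts[OF S eq]] by eventually_elim simp
  show "inverts M T S \<longleftrightarrow> inverts M T1 S"
    unfolding inverts_def by (rule eventually_cong[OF e]) auto
qed

lemma commutes_with_cong':
  assumes T: "T \<in> mp_auts M" and eq: "AE x in M. S x = S1 x"
  shows "commutes_with M T S \<longleftrightarrow> commutes_with M T S1" and "inverts M T S \<longleftrightarrow> inverts M T S1"
proof -
  have e: "AE x in M. S x = S1 x \<and> S (T x) = S1 (T x)"
    using eq AE_mp_auts[OF T eq] by eventually_elim simp
  show "commutes_with M T S \<longleftrightarrow> commutes_with M T S1"
    unfolding commutes_with_def by (rule eventually_cong[OF e]) auto
  show "inverts M T S \<longleftrightarrow> inverts M T S1"
    unfolding inverts_def by (rule eventually_cong[OF e]) auto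
qed

text \<open>The flag \<open>pm\<close> admits inversions. With the identity as \<open>\<tau>\<close>
  these are the conditions for Aut(T) and its \<plusminus> version; with the Bernoulli shift and
  \<open>tau\<close> the result is the countable example.\<close>

definition cent :: "'a measure \<Rightarrow> bool \<Rightarrow> ('a \<Rightarrow> 'a) \<Rightarrow> ('a \<Rightarrow> 'a) \<Rightarrow> ('a \<Rightarrow> 'a) \<Rightarrow> bool" where
  "cent M pm T \<tau> S \<longleftrightarrow> (commutes_with M T S \<or> pm \<and> inverts M T S) \<and> commutes_with M \<tau> S"

text \<open>Conjugation by \<open>f\<close> does it. \<open>T1\<close> and \<open>\<tau>1\<close>
  agree with the conjugates only almost everywhere, because they will be exact Borel
  versions.\<close>

lemma cent_transfer:
  assumes f: "iso_mod_null M N f"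
    and g: "iso_mod_null N M g" "AE x in M. g (f x) = x" "AE y in N. f (g y) = y"
    and T: "T \<in> mp_auts M" and \<tau>: "\<tau> \<in> mp_auts M"
    and T1: "T1 \<in> mp_auts N" "AE y in N. T1 y = f (T (g y))"
    and \<tau>1: "\<tau>1 \<in> mp_auts N" "AE y in N. \<tau>1 y = f (\<tau> (g y))"
  shows "sub_aut N (cent N pm T1 \<tau>1) \<cong> sub_aut M (cent M pm T \<tau>)"
proof -
  have fm: "f \<in> measurable M N" and fd: "distr M N f = N" using f unfolding iso_mod_null_def by blast+
  have gm: "g \<in> measurable N M" and gd: "distr N M g = M" using g(1) unfolding iso_mod_null_def by blast+
  define \<Phi> where "\<Phi> S = (\<lambda>y. f (S (g y)))" for S
  have \<Phi>: "\<Phi> S \<in> mp_auts N" if "S \<in> mp_auts M" for S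
    using iso_mod_null_trans[OF g(1) iso_mod_null_trans[OF _ f, of M S]] that
    by (simp add: mp_auts_def \<Phi>_def comp_def)
  have eq: "(AE y in N. \<Phi> S y = \<Phi> S' y) \<longleftrightarrow> (AE x in M. S x = S' x)"
    if S: "S \<in> mp_auts M" "S' \<in> mp_auts M" for S S'
  proof
    assume "AE y in N. \<Phi> S y = \<Phi> S' y"
    from AE_distr_eq[OF fm fd this] show "AE x in M. S x = S' x"
      using g(2) AE_mp_auts[OF S(1) g(2)] AE_mp_auts[OF S(2) g(2)]
      unfolding \<Phi>_def by eventually_elim metis
  next
    assume "AE x in M. S x = S' x"
    from AE_distr_eq[OF gm gd this] show "AE y in N. \<Phi> S y = \<Phi> S' y"
      unfolding \<Phi>_def by eventually_elim simp
  qed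
  have comp: "AE y in N. \<Phi> (S \<circ> S') y = \<Phi> S (\<Phi> S' y)" if S: "S \<in> mp_auts M" "S' \<in> mp_auts M" for S S'
    using AE_distr_eq[OF gm gd AE_mp_auts[OF S(2) g(2)]] unfolding \<Phi>_def by eventually_elim simp
  have comm: "commutes_with N (\<Phi> R) (\<Phi> S) \<longleftrightarrow> commutes_with M R S" and
    inv: "inverts N (\<Phi> R) (\<Phi> S) \<longleftrightarrow> inverts M R S" if R: "R \<in> mp_auts M" and S: "S \<in> mp_auts M" for R S
  proof -
    have "AE y in N. \<Phi> (S \<circ> R) y = \<Phi> S (\<Phi> R y) \<and> \<Phi> (R \<circ> S) y = \<Phi> R (\<Phi> S y)"
      using comp[OF S R] comp[OF R S] by eventually_elim simp
    then have "(AE y in N. \<Phi> (S \<circ> R) y = \<Phi> (R \<circ> S) y) \<longleftrightarrow> (AE y in N. \<Phi> S (\<Phi> R y) = \<Phi> R (\<Phi> S y))"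
      by (rule eventually_cong) simp
    then show "commutes_with N (\<Phi> R) (\<Phi> S) \<longleftrightarrow> commutes_with M R S"
      using eq[OF mp_auts_comp[OF S R] mp_auts_comp[OF R S]] by (simp add: commutes_with_def)
    have "AE y in N. \<Phi> (R \<circ> (S \<circ> R)) y = \<Phi> R (\<Phi> S (\<Phi> R y))"
      using comp[OF R mp_auts_comp[OF S R]] comp[OF S R] by eventually_elim simp
    then have "(AE y in N. \<Phi> (R \<circ> (S \<circ> R)) y = \<Phi> S y) \<longleftrightarrow> (AE y in N. \<Phi> R (\<Phi> S (\<Phi> R y)) = \<Phi> S y)"
      by (rule eventually_cong) simp
    then show "inverts N (\<Phi> R) (\<Phi> S) \<longleftrightarrow> inverts M R S"
      using eq[OF mp_auts_comp[OF R mp_auts_comp[OF S R]] S] by (simp add: inverts_def)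
  qed
  show ?thesis
  proof (rule sub_aut_iso[where \<Phi> = \<Phi>])
    have c: "cent N pm T1 \<tau>1 \<phi> \<longleftrightarrow> cent N pm (\<Phi> T) (\<Phi> \<tau>) \<phi>" if "\<phi> \<in> mp_auts N" for \<phi>
      unfolding cent_def using commutes_with_cong[OF that, of T1 "\<Phi> T"] commutes_with_cong[OF that, of \<tau>1 "\<Phi> \<tau>"]
        T1 \<tau>1 by (simp add: \<Phi>_def)
    show "cent M pm T \<tau> S \<longleftrightarrow> cent N pm T1 \<tau>1 (\<Phi> S)" if S: "S \<in> mp_auts M" for S
      unfolding c[OF \<Phi>[OF S]] unfolding cent_def by (simp only: comm[OF T S] inv[OF T S] comm[OF \<tau> S])
    show "cent N pm T1 \<tau>1 \<phi>'" if "\<phi> \<in> mp_auts N" "\<phi>' \<in> mp_auts N" "AE x in N. \<phi> x = \<phi>' x" "cent N pm T1 \<tau>1 \<phi>" for \<phi> \<phi>'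
      using that(4) commutes_with_cong'[OF T1(1) that(3)] commutes_with_cong'[OF \<tau>1(1) that(3)]
      unfolding cent_def by simp
    show "\<exists>S\<in>mp_auts M. AE y in N. \<Phi> S y = \<phi> y" if \<phi>: "\<phi> \<in> mp_auts N" for \<phi>
    proof (rule bexI[of _ "\<lambda>x. g (\<phi> (f x))"])
      show "(\<lambda>x. g (\<phi> (f x))) \<in> mp_auts M"
        using iso_mod_null_trans[OF f iso_mod_null_trans[OF _ g(1), of N \<phi>]] \<phi> by (simp add: mp_auts_def comp_def)
      show "AE y in N. \<Phi> (\<lambda>x. g (\<phi> (f x))) y = \<phi> y"
        using g(3) AE_mp_auts[OF \<phi> g(3)] unfolding \<Phi>_def by eventually_elim simp
    qed
  qed (use \<Phi> eq comp in blast)+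
qed

text \<open>The translate must contain 0, which among natural numbers forces \<open>a = 0\<close>.
  The set \<open>{0, 2, 3}\<close> is \<open>{0, 1, 3}\<close> reflected by k -> 3 - k.\<close>

lemma triple_eqs:
  fixes a :: nat
  shows "{a, a + 1, a + 3} = {0, 1, 3} \<Longrightarrow> a = 0" and "{a, a + 1, a + 3} \<noteq> {0, 2, 3}"
proof -
  have "a = 0" if "{a, a + 1, a + 3} = {0, b, 3}" for b
  proof -
    have "0 \<in> {a, a + 1, a + 3}" using that by simp
    then show ?thesis by simp
  qed
  note z = this
  show "{a, a + 1, a + 3} = {0, 1, 3} \<Longrightarrow> a = 0" by (rule z)
  show "{a, a + 1, a + 3} \<noteq> {0, 2, 3}"
  proof
    assume h: "{a, a + 1, a + 3} = {0, 2, 3}"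
    then have "{0, 1, 3} = {0, 2, 3 :: nat}" using z[OF h] by simp
    moreover have "1 \<in> {0, 1, 3 :: nat}" by simp
    ultimately have "1 \<in> {0, 2, 3 :: nat}" by simp
    then show False by simp
  qed
qed

text \<open>Along a free orbit, equality of point sets is equality of sets of exponents. The
  exponent 0 puts \<open>y\<close> itself on the forward orbit of \<open>x\<close>, so the
  translation is by a natural number.\<close>

lemma translate_triple:
  assumes inj: "inj (\<lambda>n. (T ^^ n) x)"
    and eq: "(\<lambda>k. (T ^^ k) x) ` J = (\<lambda>k. (T ^^ k) y) ` {0, 1, 3}" and "finite J"
  obtains a where "y = (T ^^ a) x" "{a, a + 1, a + 3} = J"
proof -
  have "(T ^^ 0) y \<in> (\<lambda>k. (T ^^ k) y) ` {0, 1, 3}" by blast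
  then obtain a where a: "y = (T ^^ a) x" using eq by auto
  have "(\<lambda>k. (T ^^ k) y) ` {0, 1, 3} = (\<lambda>k. (T ^^ k) x) ` {a, a + 1, a + 3}"
    unfolding a by (simp add: numeral_3_eq_3)
  then have "{a, a + 1, a + 3} = J" using eq inj by (metis inj_image_eq_iff)
  then show thesis using that a by blast
qed

context line_graph
begin

lemma aut_group_pm:
  assumes F0: "F = [0]"
  shows "graphing_aut_group V E \<cong> sub_aut U (cent U True T \<tau>)"
  by (rule graphing_aut_group_iso) (simp_all add: cent_def F0, auto elim: eventually_mono)

text \<open>The set \<open>{0, 1, 3}\<close> is not a translate of its mirror image, so the links determine the
  direction of the lines.\<close>

lemma aut_group_plus:
  assumes F0: "F = [0, 1, 3]"
  shows "graphing_aut_group V E \<cong> sub_aut U (cent U False T \<tau>)"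
proof (rule graphing_aut_group_iso)
  show "cent U False T \<tau> S \<longleftrightarrow> (commutes_with U T S \<or> inverts U T S \<and> F = [0]) \<and> commutes_with U \<tau> S" for S
    by (simp add: cent_def F0)
  fix S R assume S: "S \<in> mp_auts U" and ST: "commutes_with U T S \<or> inverts U T S"
    and SR: "AE x in U. (\<lambda>k. S ((T ^^ k) x)) ` set F = (\<lambda>k. (T ^^ k) (R x)) ` set F"
  note mT = unit_aut_mp[OF T] and apS = AE_mp_auts[OF S aperiodic]
  from ST show "(AE x in U. R x = S x) \<and> (inverts U T S \<longrightarrow> commutes_with U T S \<or> F = [0])"
  proof
    assume c: "commutes_with U T S"
    have "AE x in U. \<forall>k. S ((T ^^ k) x) = (T ^^ k) (S x)"
      using commutes_with_funpow[OF mT c] unfolding commutes_with_def by (subst AE_all_countable) blast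
    then have "AE x in U. R x = S x"
      using SR apS
    proof eventually_elim
      case (elim x)
      have "inj (\<lambda>n. (T ^^ n) (S x))" using aperiodic_inj(1)[OF T elim(3)] by (auto simp: inj_def)
      moreover have "(\<lambda>k. (T ^^ k) (S x)) ` {0, 1, 3} = (\<lambda>k. (T ^^ k) (R x)) ` {0, 1, 3}"
        using elim(2) by (simp only: elim(1) F0 list.set)
      ultimately obtain a where "R x = (T ^^ a) (S x)" "{a, a + 1, a + 3} = {0, 1, 3}"
        by (rule translate_triple) simp
      then show ?case using triple_eqs(1)[of a] by simp
    qed
    then show ?thesis using c by simp
  next
    assume i: "inverts U T S"
    note sw = inverts_swap(1)[OF T i]
    have "AE x in U. False"
      using SR apS sw AE_mp_auts[OF mT sw] AE_mp_auts[OF mp_auts_funpow[OF mT, of 2] sw]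
    proof eventually_elim
      case (elim x)
      \<comment> \<open>An inverting \<open>S\<close> sends \<open>(T ^^ k) x\<close> to the point
        \<open>k\<close> steps before \<open>S x\<close>. Counted from \<open>w\<close>, three steps
        before \<open>S x\<close>, the exponents 0, 1, 3 become 3, 2, 0.\<close>
      define w where "w = T' (T' (T' (S x)))"
      have TT: "T (T' y) = y" for y using unit_autD(4)[OF T] .
      have w: "S x = (T ^^ 3) w" "S (T x) = (T ^^ 2) w" "S ((T ^^ 3) x) = (T ^^ 0) w"
        using elim(3-5) by (simp_all add: w_def TT numeral_3_eq_3 numeral_2_eq_2)
      have "inj (\<lambda>n. (T ^^ n) w)"
      proof (rule injI)
        fix a b assume "(T ^^ a) w = (T ^^ b) w"
        then have "(T ^^ 3) ((T ^^ a) w) = (T ^^ 3) ((T ^^ b) w)" by simp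
        then have "(T ^^ a) (S x) = (T ^^ b) (S x)"
          unfolding w(1) using funpow_add[of a 3 T] funpow_add[of b 3 T] funpow_add[of 3 a T] funpow_add[of 3 b T]
          by (metis add.commute comp_apply)
        then show "a = b" using aperiodic_inj(1)[OF T elim(2)] by simp
      qed
      moreover have "(\<lambda>k. (T ^^ k) w) ` {0, 2, 3} = (\<lambda>k. (T ^^ k) (R x)) ` {0, 1, 3}"
      proof -
        have "(\<lambda>k. S ((T ^^ k) x)) ` {0, 1, 3} = {(T ^^ 3) w, (T ^^ 2) w, (T ^^ 0) w}"
          unfolding w(1)[symmetric] w(2)[symmetric] w(3)[symmetric] by simp
        then show ?thesis using elim(1) unfolding F0 by auto
      qed
      ultimately obtain a where "R x = (T ^^ a) w" "{a, a + 1, a + 3} = {0, 2, 3}"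
        by (rule translate_triple) simp
      then show False using triple_eqs(2)[of a] by simp
    qed
    \<comment> \<open>A contradiction at almost every point makes every property hold almost
      everywhere, commutation included.\<close>
    then have "\<And>P. AE x in U. P x" by (auto elim: eventually_mono)
    then show ?thesis unfolding commutes_with_def by blast
  qed
qed

end

text \<open>The exponents \<open>[0]\<close> leave the lines unoriented, \<open>[0, 1, 3]\<close>
  orient them. That the automorphisms form a group is recorded for the topological argument at the
  end.\<close>

theorem graphing_of_cent:
  assumes f: "iso_mod_null M U f" and T: "T \<in> mp_auts M" "ae_ergodic M T"
    and \<tau>: "\<tau> \<in> mp_auts M" "AE x in M. \<tau> (\<tau> x) = x"
  shows "\<exists>E. ergodic_graphing V E \<and> group (graphing_aut_group V E) \<and>
    graphing_aut_group V E \<cong> sub_aut M (cent M pm T \<tau>)"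
proof -
  obtain g where g: "iso_mod_null U M g" "AE x in M. g (f x) = x" "AE y in U. f (g y) = y"
    using iso_mod_null_sym[OF f] by metis
  have fm: "f \<in> measurable M U" and fd: "distr M U f = U" using f unfolding iso_mod_null_def by blast+
  have gm: "g \<in> measurable U M" and gd: "distr U M g = M" using g(1) unfolding iso_mod_null_def by blast+
  have \<Phi>: "(\<lambda>y. f (S (g y))) \<in> mp_auts U" if "S \<in> mp_auts M" for S
    using iso_mod_null_trans[OF g(1) iso_mod_null_trans[OF _ f, of M S]] that
    by (simp add: mp_auts_def comp_def)
  obtain T1 T1' where T1: "unit_aut T1 T1'" "AE y in U. T1 y = f (T (g y))"
    using unit_aut_version[OF \<Phi>[OF T(1)]] .
  obtain \<tau>1 \<tau>1' where \<tau>1: "unit_aut \<tau>1 \<tau>1'" "AE y in U. \<tau>1 y = f (\<tau> (g y))"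
    using unit_aut_version[OF \<Phi>[OF \<tau>(1)]] .
  have erg: "ae_ergodic U T1" by (rule ae_ergodic_transfer[OF f gm g(2) T T1(2)])
  have \<tau>\<tau>: "AE y in U. \<tau>1 (\<tau>1 y) = y"
    using \<tau>1(2) AE_mp_auts[OF unit_aut_mp[OF \<tau>1(1)] \<tau>1(2)] AE_distr_eq[OF gm gd AE_mp_auts[OF \<tau>(1) g(2)]]
      AE_distr_eq[OF gm gd \<tau>(2)] g(3)
    by eventually_elim simp
  have tr: "sub_aut U (cent U pm T1 \<tau>1) \<cong> sub_aut M (cent M pm T \<tau>)"
    by (rule cent_transfer[OF f g T(1) \<tau>(1) unit_aut_mp[OF T1(1)] T1(2) unit_aut_mp[OF \<tau>1(1)] \<tau>1(2)])
  show ?thesis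
  proof (cases pm)
    case True
    interpret line_graph T1 T1' \<tau>1 \<tau>1' "[0]"
      by (rule line_graph.intro) (use T1 \<tau>1 erg \<tau>\<tau> in simp_all)
    have "graphing_aut_group V E \<cong> sub_aut M (cent M pm T \<tau>)"
      using iso_trans[OF aut_group_pm[OF refl]] tr True by auto
    then show ?thesis using ergodic_graphing_E group_graphing_aut_group by blast
  next
    case False
    interpret line_graph T1 T1' \<tau>1 \<tau>1' "[0, 1, 3]"
      by (rule line_graph.intro) (use T1 \<tau>1 erg \<tau>\<tau> in simp_all)
    have "graphing_aut_group V E \<cong> sub_aut M (cent M pm T \<tau>)"
      using iso_trans[OF aut_group_plus[OF refl]] tr False by auto
    then show ?thesis using ergodic_graphing_E group_graphing_aut_group by blast
  qed
qed

text \<open>The orbit of an atom consists of atoms of at least the same mass, so it is finite and, by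
  ergodicity, of full measure.\<close>

lemma ergodic_no_atoms:
  fixes K :: "'b measure"
  assumes "prob_space K" and single: "\<And>x. x \<in> space K \<Longrightarrow> {x} \<in> sets K"
    and T: "T \<in> mp_auts K" and erg: "ae_ergodic K T" and inf: "infinite_prob_space K"
    and a: "a \<in> space K"
  shows "measure K {a} = 0"
proof (rule ccontr)
  interpret prob_space K by fact
  assume "measure K {a} \<noteq> 0"
  then have pos: "measure K {a} > 0" by (simp add: zero_less_measure_iff)
  note mT = mp_autsD(1)[OF T]
  define x where "x n = (T ^^ n) a" for n
  have xs: "x n \<in> space K" for n
    using measurable_space[OF mp_autsD(1)[OF mp_auts_funpow[OF T]] a] by (simp add: x_def)
  have mono: "measure K {y} \<le> measure K {T y}" if y: "y \<in> space K" for y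
  proof -
    have "T y \<in> space K" using measurable_space[OF mT y] .
    then have "{T y} \<in> sets K" by (rule single)
    then have "emeasure K (T -` {T y} \<inter> space K) = emeasure K {T y}" "T -` {T y} \<inter> space K \<in> sets K"
      using mp_auts_emeasure_vimage[OF T] measurable_sets[OF mT] by blast+
    then show ?thesis
      using finite_measure_mono[of "{y}" "T -` {T y} \<inter> space K"] y by (simp add: measure_def)
  qed
  have big: "measure K {a} \<le> measure K {x n}" for n
  proof (induction n)
    case (Suc n)
    then show ?case using mono[OF xs[of n]] by (simp add: x_def)
  qed (simp add: x_def)
  have fin: "finite (range x)"
  proof (rule ccontr)
    assume "infinite (range x)"
    moreover obtain n where n: "real n * measure K {a} > 1" using reals_Archimedean3[OF pos] by blast
    ultimately obtain A where A: "A \<subseteq> range x" "finite A" "card A = n" using infinite_arbitrarily_large by metis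
    have "real n * measure K {a} = (\<Sum>y\<in>A. measure K {a})" using A by simp
    also have "\<dots> \<le> (\<Sum>y\<in>A. measure K {y})" using A big by (intro sum_mono) blast
    also have "\<dots> = measure K A"
    proof (rule finite_measure_eq_sum_singleton[symmetric])
      fix y assume "y \<in> A"
      then show "{y} \<in> sets K" using A xs single by blast
    qed (rule A)
    also have "\<dots> \<le> 1" by simp
    finally show False using n by simp
  qed
  let ?O = "range x"
  have O: "?O \<in> sets K"
  proof -
    have "(\<Union>y\<in>?O. {y}) \<in> sets K" using fin xs single by (intro sets.finite_UN) auto
    then show ?thesis by simp
  qed
  have TO: "T -` ?O \<inter> space K \<in> sets K" using measurable_sets[OF mT O] .
  have sub: "?O \<subseteq> T -` ?O \<inter> space K"
  proof
    fix y assume "y \<in> ?O"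
    then obtain n where n: "y = x n" by blast
    then have "T y = x (Suc n)" by (simp add: x_def)
    then show "y \<in> T -` ?O \<inter> space K" using xs n by blast
  qed
  \<comment> \<open>The orbit is only known to be closed under \<open>T\<close>, hence contained in
    its preimage; since both have the same measure, they differ by a null set.\<close>
  have "measure K (T -` ?O \<inter> space K) = measure K ?O"
    using mp_auts_emeasure_vimage[OF T O] by (simp add: measure_def)
  then have "measure K ((T -` ?O \<inter> space K) - ?O) = 0"
    using finite_measure_Diff[OF TO O sub] by simp
  then have "(T -` ?O \<inter> space K) - ?O \<in> null_sets K"
    using TO O by (simp add: null_sets_def emeasure_eq_measure)
  from AE_not_in[OF this] have "AE y in K. T y \<in> ?O \<longleftrightarrow> y \<in> ?O"
    using AE_space
  proof eventually_elim
    case (elim y)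
    then show ?case using sub by blast
  qed
  then have "measure K ?O = 0 \<or> measure K ?O = 1" using erg O unfolding ae_ergodic_def by blast
  moreover have "measure K ?O \<ge> measure K {x 0}" using O by (intro finite_measure_mono) auto
  ultimately have "measure K ?O = 1" using pos by (auto simp: x_def)
  then have "AE y in K. y \<in> ?O" using prob_eq_1[OF O] by simp
  then show False using inf fin unfolding infinite_prob_space_def by blast
qed

section \<open>Identifying the space with the unit interval\<close>

lemma unit_length_interval:
  assumes I: "is_interval I" and leb: "emeasure lebesgue I = 1"
  obtains a :: real where "\<And>x. x \<noteq> a \<Longrightarrow> x \<noteq> a + 1 \<Longrightarrow> x \<in> I \<longleftrightarrow> a \<le> x \<and> x < a + 1"
proof -
  have "\<exists>a. \<forall>x. x \<noteq> a \<longrightarrow> x \<noteq> a + 1 \<longrightarrow> (x \<in> I \<longleftrightarrow> a \<le> x \<and> x < a + 1)"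
  proof -
    have inf: "I \<noteq> {}" "I \<noteq> UNIV" "I \<noteq> {..<b}" "I \<noteq> {..b}" "I \<noteq> {b<..}" "I \<noteq> {b..}" for b
    proof -
      have n: "measure lebesgue I = 1" "I \<in> lmeasurable"
        using leb real_interval_borel_measurable[OF I] by (auto simp: measure_def fmeasurable_def)
      have le: "B \<le> 1" if "{c..c+B} \<subseteq> I" "B > 0" for c B
        using measure_mono_fmeasurable[OF that(1) _ n(2)] n(1) that(2) by simp
      show "I \<noteq> {}" using leb by auto
      show "I \<noteq> UNIV" using le[of 0 2] by auto
      show "I \<noteq> {..<b}" using le[of "b - 3" 2] by (auto simp: subset_iff)
      show "I \<noteq> {..b}" using le[of "b - 3" 2] by (auto simp: subset_iff)
      show "I \<noteq> {b<..}" using le[of "b + 1" 2] by (auto simp: subset_iff)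
      show "I \<noteq> {b..}" using le[of "b + 1" 2] by (auto simp: subset_iff)
    qed
    obtain a b where ab: "I = {a<..<b} \<or> I = {a<..b} \<or> I = {a..<b} \<or> I = {a..b}"
      using is_real_interval[OF I] inf by metis
    have "a \<le> b" using ab inf(1) by (auto simp: not_less)
    then have "emeasure lebesgue I = ennreal (b - a)"
      using ab by (auto simp: emeasure_lborel_Ioo emeasure_lborel_Icc)
    then have "b = a + 1" using leb \<open>a \<le> b\<close> by (simp add: ennreal_eq_1)
    then show ?thesis using ab by (intro exI[of _ a]) auto
  qed
  then show thesis using that by blast
qed

text \<open>Ergodicity kills the point masses, so all mass is Lebesgue measure on \<open>I\<close>,
  and total mass 1 makes \<open>I\<close> a unit interval up to endpoints.\<close>

lemma standard_ergodic_iso: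
  assumes st: "standard_prob_space M" and inf: "infinite_prob_space M" and erg: "ergodic_aut M T"
  shows "\<exists>f. iso_mod_null M U f"
proof -
  obtain I D w f where I: "is_interval I" and D: "countable D" and f: "iso_mod_null M (lebesgue_with_atoms I D w) f"
    using st unfolding standard_prob_space_def by blast
  define L where "L = lebesgue_with_atoms I D w"
  have f: "iso_mod_null M L f" using f by (simp add: L_def)
  obtain g where g: "iso_mod_null L M g" "AE x in M. g (f x) = x" "AE y in L. f (g y) = y"
    using iso_mod_null_sym[OF f] by metis
  have fm: "f \<in> measurable M L" and fd: "distr M L f = L" using f unfolding iso_mod_null_def by blast+
  have gm: "g \<in> measurable L M" using g(1) unfolding iso_mod_null_def by blast+
  have Ib: "I \<in> sets borel" by (rule real_interval_borel_measurable[OF I])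
  have sL: "sets L = sets lebesgue" unfolding L_def by (rule sets_lebesgue_with_atoms)
  have spL: "space L = UNIV" using sets_eq_imp_space_eq[OF sL] by simp
  have eL: "emeasure L A = emeasure lebesgue (A \<inter> I) + (\<integral>\<^sup>+ a. w a * indicator A a \<partial>count_space D)"
    if "A \<in> sets lebesgue" for A
    unfolding L_def using Ib that by (intro emeasure_lebesgue_with_atoms) auto
  have "prob_space M" using st by (simp add: standard_prob_space_def)
  then have pL: "prob_space L" using prob_space.prob_space_distr[OF _ fm] by (simp only: fd)
  have T: "T \<in> mp_auts M" using erg by (simp add: ergodic_aut_def)
  have T1: "(\<lambda>y. f (T (g y))) \<in> mp_auts L"
    using iso_mod_null_trans[OF g(1) iso_mod_null_trans[OF _ f, of M T]] T by (simp add: mp_auts_def comp_def)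
  have ergL: "ae_ergodic L (\<lambda>y. f (T (g y)))"
    by (rule ae_ergodic_transfer[OF f gm g(2) T ergodic_aut_imp_ae_ergodic[OF erg]]) simp
  have infL: "infinite_prob_space L"
    unfolding infinite_prob_space_def
  proof
    assume "\<exists>F. finite F \<and> (AE x in L. x \<in> F)"
    then obtain F where F: "finite F" "AE x in L. x \<in> F" by blast
    have "AE x in M. x \<in> g ` F"
      using AE_distr_eq[OF fm fd F(2)] g(2) by eventually_elim (metis imageI)
    then show False using inf F(1) unfolding infinite_prob_space_def by blast
  qed
  have "measure L {a} = 0" for a
    using ergodic_no_atoms[OF pL _ T1 ergL infL, of a] by (simp add: sL spL)
  then have "emeasure L {a} = 0" for a
    using finite_measure.emeasure_eq_measure[OF prob_space.finite_measure[OF pL]] by simp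
  then have w0: "w a = 0" if "a \<in> D" for a
    using eL[of "{a}"] that by (simp add: nn_integral_indicator_singleton)
  have eL': "emeasure L A = emeasure lebesgue (A \<inter> I)" if "A \<in> sets lebesgue" for A
  proof -
    have "(\<integral>\<^sup>+ a. w a * indicator A a \<partial>count_space D) = (\<integral>\<^sup>+ a. 0 \<partial>count_space D)"
      by (rule nn_integral_cong) (simp add: w0)
    then show ?thesis using eL[OF that] by simp
  qed
  have "emeasure lebesgue I = 1"
    using eL'[of UNIV] prob_space.emeasure_space_1[OF pL] by (simp add: spL)
  then obtain a where a: "\<And>x. x \<noteq> a \<Longrightarrow> x \<noteq> a + 1 \<Longrightarrow> x \<in> I \<longleftrightarrow> a \<le> x \<and> x < a + 1"
    using unit_length_interval[OF I] by blast
  have "iso_mod_null U L (\<lambda>x. x + a)"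
  proof (rule iso_U_lebesgue[OF sL])
    fix A :: "real set" assume A: "A \<in> sets lebesgue"
    have "AE x in lebesgue. x \<in> A \<inter> I \<longleftrightarrow> x \<in> A \<inter> {a..<a+1}"
      using AE_completion[OF AE_lborel_singleton[of a]] AE_completion[OF AE_lborel_singleton[of "a + 1"]]
      by eventually_elim (use a in auto)
    then show "emeasure L A = emeasure lebesgue (A \<inter> {a..<a+1})"
      unfolding eL'[OF A] using A Ib by (intro emeasure_eq_AE) auto
  qed
  then obtain h where "iso_mod_null L U h" using iso_mod_null_sym by metis
  then show ?thesis using iso_mod_null_trans[OF f] by blast
qed

text \<open>With the identity as involution the second copy has no edges of its own, and commuting
  with the involution is no condition.\<close>

theorem ergodic_automorphism_graphings:
  assumes st: "standard_prob_space M" "infinite_prob_space M" and erg: "ergodic_aut M T"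
  shows "\<exists>E. ergodic_graphing V E \<and> graphing_aut_group V E \<cong> aut_T M T"
    and "\<exists>E. ergodic_graphing V E \<and> graphing_aut_group V E \<cong> aut_pm_T M T"
proof -
  have T: "T \<in> mp_auts M" using erg by (simp add: ergodic_aut_def)
  obtain f where f: "iso_mod_null M U f" using standard_ergodic_iso[OF assms] by blast
  have id: "commutes_with M id S" for S by (simp add: commutes_with_def)
  have 1: "aut_T M T = sub_aut M (cent M False T id)" "aut_pm_T M T = sub_aut M (cent M True T id)"
    unfolding aut_T_eq[OF T] cent_def by (simp_all add: id)
  show "\<exists>E. ergodic_graphing V E \<and> graphing_aut_group V E \<cong> aut_T M T"
    "\<exists>E. ergodic_graphing V E \<and> graphing_aut_group V E \<cong> aut_pm_T M T"
    unfolding 1 using graphing_of_cent[OF f T ergodic_aut_imp_ae_ergodic[OF erg] mp_auts_id] by force+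
qed


section \<open>The Bernoulli shift\<close>

definition Om :: "(int \<Rightarrow> bool) measure" where
  "Om = PiM UNIV (\<lambda>_. measure_pmf (bernoulli_pmf (1/2)))"

lemma space_Om [simp]: "space Om = UNIV"
  by (simp add: Om_def space_PiM PiE_UNIV_domain)

interpretation coin: product_prob_space "\<lambda>_::int. measure_pmf (bernoulli_pmf (1/2))" UNIV
  by standard

interpretation Om: prob_space Om
  unfolding Om_def by (rule coin.P.prob_space_axioms)

lemma coord_measurable [measurable]: "(\<lambda>x. x i) \<in> measurable Om (count_space UNIV)"
proof -
  have "(\<lambda>x. x i) \<in> measurable Om (measure_pmf (bernoulli_pmf (1/2)))"
    unfolding Om_def by (rule measurable_component_singleton) simp
  then show ?thesis by (simp cong: measurable_cong_sets)
qed

lemma measurable_into_Om: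
  assumes "\<And>i. (\<lambda>x. f x i) \<in> measurable M (count_space UNIV)"
  shows "f \<in> measurable M Om"
  unfolding Om_def
  by (rule measurable_PiM_single') (use assms in \<open>simp_all add: PiE_UNIV_domain cong: measurable_cong_sets\<close>)

definition cyl :: "int set \<Rightarrow> (int \<Rightarrow> bool) \<Rightarrow> (int \<Rightarrow> bool) set" where
  "cyl J b = {x. \<forall>i\<in>J. x i = b i}"

lemma cyl_sets: "finite J \<Longrightarrow> cyl J b \<in> sets Om"
proof -
  assume [measurable]: "finite J"
  have "{x \<in> space Om. \<forall>i\<in>J. x i = b i} \<in> sets Om" by measurable
  then show ?thesis by (simp add: cyl_def)
qed

lemma emeasure_cyl:
  assumes "finite J"
  shows "emeasure Om (cyl J b) = ennreal ((1/2) ^ card J)"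
proof -
  have "emeasure Om (cyl J b) = emeasure (PiM UNIV (\<lambda>_. measure_pmf (bernoulli_pmf (1/2))))
      {x \<in> space (PiM UNIV (\<lambda>_::int. measure_pmf (bernoulli_pmf (1/2)))). \<forall>i\<in>J. x i \<in> {b i}}"
    unfolding Om_def cyl_def by (simp add: space_PiM PiE_UNIV_domain)
  also have "\<dots> = (\<Prod>i\<in>J. emeasure (measure_pmf (bernoulli_pmf (1/2))) {b i})"
    using assms by (intro coin.emeasure_PiM_Collect) auto
  also have "\<dots> = (\<Prod>i\<in>J. ennreal (1/2))"
  proof (rule prod.cong[OF refl])
    fix i show "emeasure (measure_pmf (bernoulli_pmf (1/2))) {b i} = ennreal (1/2)"
      by (cases "b i") (simp_all add: emeasure_pmf_single)
  qed
  also have "\<dots> = ennreal ((1/2) ^ card J)" by (subst prod_constant, rule ennreal_power) simp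
  finally show ?thesis .
qed

lemma measure_cyl: "finite J \<Longrightarrow> measure Om (cyl J b) = (1/2) ^ card J"
proof -
  assume J: "finite J"
  have "ennreal (measure Om (cyl J b)) = ennreal ((1/2) ^ card J)"
    using emeasure_cyl[OF J] by (simp add: Om.emeasure_eq_measure)
  then show ?thesis by simp
qed

definition dep :: "int set \<Rightarrow> (int \<Rightarrow> bool) set \<Rightarrow> bool" where
  "dep J S \<longleftrightarrow> (\<forall>x y. (\<forall>i\<in>J. x i = y i) \<longrightarrow> x \<in> S \<longrightarrow> y \<in> S)"

text \<open>Extensional functions pick out one representative for each cylinder over
  \<open>J\<close>, so that for finite \<open>J\<close> these are finitely many pairwise disjoint
  cylinders.\<close>

definition patterns :: "int set \<Rightarrow> (int \<Rightarrow> bool) set \<Rightarrow> (int \<Rightarrow> bool) set" where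
  "patterns J S = {b \<in> J \<rightarrow>\<^sub>E UNIV. b \<in> S}"

lemma finite_patterns: "finite J \<Longrightarrow> finite (patterns J S)"
  unfolding patterns_def by (rule finite_subset[of _ "J \<rightarrow>\<^sub>E UNIV"]) (auto intro: finite_PiE)

lemma dep_UN: "dep J S \<Longrightarrow> S = (\<Union>b\<in>patterns J S. cyl J b)"
proof (intro equalityI subsetI)
  fix x assume S: "dep J S" and x: "x \<in> S"
  have "restrict x J \<in> S" using S[unfolded dep_def, rule_format, OF _ x, of "restrict x J"] by simp
  then have "restrict x J \<in> patterns J S" by (simp add: patterns_def)
  moreover have "x \<in> cyl J (restrict x J)" by (simp add: cyl_def)
  ultimately show "x \<in> (\<Union>b\<in>patterns J S. cyl J b)" by blast
next
  fix x assume S: "dep J S" and "x \<in> (\<Union>b\<in>patterns J S. cyl J b)"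
  then obtain b where "b \<in> S" "\<forall>i\<in>J. b i = x i" by (auto simp: patterns_def cyl_def)
  then show "x \<in> S" using S unfolding dep_def by blast
qed

lemma patterns_disjoint: "disjoint_family_on (\<lambda>b. cyl J b \<inter> W) (patterns J S)"
  unfolding disjoint_family_on_def
proof (intro ballI impI)
  fix b c assume bc: "b \<in> patterns J S" "c \<in> patterns J S" "b \<noteq> c"
  then have p: "b \<in> J \<rightarrow>\<^sub>E UNIV" "c \<in> J \<rightarrow>\<^sub>E UNIV" by (simp_all add: patterns_def)
  obtain i where "i \<in> J" "b i \<noteq> c i" using PiE_ext[OF p] bc(3) by blast
  then show "cyl J b \<inter> W \<inter> (cyl J c \<inter> W) = {}" by (auto simp: cyl_def)
qed

lemma dep_sets: "finite J \<Longrightarrow> dep J S \<Longrightarrow> S \<in> sets Om"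
  using dep_UN[of J S] finite_patterns[of J S] cyl_sets by (metis sets.finite_UN)

lemma emeasure_dep:
  assumes J: "finite J" and S: "dep J S" and Q: "sets Q = sets Om" and W: "W \<in> sets Om"
  shows "emeasure Q (S \<inter> W) = (\<Sum>b\<in>patterns J S. emeasure Q (cyl J b \<inter> W))"
proof -
  have "S \<inter> W = (\<Union>b\<in>patterns J S. cyl J b \<inter> W)" using dep_UN[OF S] by blast
  moreover have "(\<Sum>b\<in>patterns J S. emeasure Q (cyl J b \<inter> W)) = emeasure Q (\<Union>b\<in>patterns J S. cyl J b \<inter> W)"
    using patterns_disjoint finite_patterns[OF J] cyl_sets[OF J] W Q by (intro sum_emeasure) auto
  ultimately show ?thesis by simp
qed

text \<open>The exhausting sequence of coordinate sets is left open so that it can be fitted to the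
  map at hand: symmetric windows for the shift, blocks of three for \<open>tau\<close>, the
  enumeration of the integers for binary digits.\<close>

lemma Om_eqI:
  fixes J :: "nat \<Rightarrow> int set"
  assumes Q: "sets Q = sets Om" and J: "incseq J" "\<And>n. finite (J n)" "(\<Union>n. J n) = UNIV"
    and eq: "\<And>n b. emeasure Q (cyl (J n) b) = ennreal ((1/2) ^ card (J n))"
  shows "Q = Om"
proof -
  let ?M = "\<lambda>_::int. measure_pmf (bernoulli_pmf (1/2))"
  have "Om = Q"
  proof (rule measure_eqI_PiM_infinite[where M = ?M and I = UNIV])
    show "sets Om = sets (PiM UNIV ?M)" "sets Q = sets (PiM UNIV ?M)" using Q by (simp_all add: Om_def)
    show "finite_measure Om" by (rule Om.finite_measure_axioms)
    fix A :: "int \<Rightarrow> bool set" and K :: "int set"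
    assume K: "finite K"
    obtain n where n: "K \<subseteq> J n"
    proof -
      have "\<exists>n. K \<subseteq> J n" using K
      proof (induction K rule: finite_induct)
        case (insert i K)
        then obtain n where n: "K \<subseteq> J n" by blast
        obtain m where m: "i \<in> J m" using J(3) by blast
        have "insert i K \<subseteq> J (max n m)"
          using n m monoD[OF J(1), of n "max n m"] monoD[OF J(1), of m "max n m"] by auto
        then show ?case by blast
      qed simp
      then show thesis using that by blast
    qed
    let ?S = "prod_emb UNIV ?M K (Pi\<^sub>E K A)"
    have S: "?S = {x. \<forall>i\<in>K. x i \<in> A i}" by (auto simp: prod_emb_def PiE_UNIV_domain restrict_def PiE_iff)
    have d: "dep (J n) ?S"
      unfolding S dep_def
    proof (intro allI impI CollectI ballI)
      fix x y i assume xy: "\<forall>i\<in>J n. x i = y i" and x: "x \<in> {x. \<forall>i\<in>K. x i \<in> A i}" and i: "i \<in> K"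
      have "x i = y i" using xy i n by blast
      moreover have "x i \<in> A i" using x i by blast
      ultimately show "y i \<in> A i" by simp
    qed
    have "emeasure Om (?S \<inter> UNIV) = emeasure Q (?S \<inter> UNIV)"
      unfolding emeasure_dep[OF J(2) d refl sets.top[of Om, simplified]] emeasure_dep[OF J(2) d Q sets.top[of Om, simplified]]
      using eq emeasure_cyl[OF J(2)] by simp
    then show "emeasure Om ?S = emeasure Q ?S" by simp
  qed
  then show ?thesis by simp
qed

section \<open>The shift and the involution\<close>

definition shift :: "int \<Rightarrow> (int \<Rightarrow> bool) \<Rightarrow> int \<Rightarrow> bool" where
  "shift m x = (\<lambda>i. x (i + m))"

lemma shift_measurable: "shift m \<in> measurable Om Om"
  unfolding shift_def by (rule measurable_into_Om) measurable

lemma shift_shift: "shift m (shift n x) = shift (m + n) x" "shift 0 x = x"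
  by (simp_all add: shift_def add.assoc)

lemma distr_shift: "distr Om Om (shift m) = Om"
proof (rule Om_eqI[where J = "\<lambda>n. {- int n..int n}"])
  show "incseq (\<lambda>n. {- int n..int n})" by (auto simp: incseq_def)
  show "(\<Union>n. {- int n..int n}) = UNIV"
  proof (intro equalityI subsetI UNIV_I)
    fix x :: int
    have "x \<in> {- int (nat \<bar>x\<bar>)..int (nat \<bar>x\<bar>)}" by auto
    then show "x \<in> (\<Union>n. {- int n..int n})" by blast
  qed
  fix n :: nat and b
  have "shift m x \<in> cyl {- int n..int n} b \<longleftrightarrow> x \<in> cyl {- int n + m..int n + m} (shift (- m) b)" for x
  proof
    assume h: "shift m x \<in> cyl {- int n..int n} b"
    have "x i = shift (- m) b i" if "i \<in> {- int n + m..int n + m}" for i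
    proof -
      have "i - m \<in> {- int n..int n}" using that by simp
      then have "shift m x (i - m) = b (i - m)" using h unfolding cyl_def by blast
      then show ?thesis by (simp add: shift_def)
    qed
    then show "x \<in> cyl {- int n + m..int n + m} (shift (- m) b)" unfolding cyl_def by blast
  next
    assume h: "x \<in> cyl {- int n + m..int n + m} (shift (- m) b)"
    have "shift m x i = b i" if "i \<in> {- int n..int n}" for i
    proof -
      have "i + m \<in> {- int n + m..int n + m}" using that by simp
      then have "x (i + m) = shift (- m) b (i + m)" using h unfolding cyl_def by blast
      then show ?thesis by (simp add: shift_def)
    qed
    then show "shift m x \<in> cyl {- int n..int n} b" unfolding cyl_def by blast
  qed
  then have "shift m -` cyl {- int n..int n} b = cyl {- int n + m..int n + m} (shift (- m) b)" by blast
  then show "emeasure (distr Om Om (shift m)) (cyl {- int n..int n} b) = ennreal ((1/2) ^ card {- int n..int n})"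
    using emeasure_distr[OF shift_measurable[of m] cyl_sets[of "{- int n..int n}" b]]
      emeasure_cyl[of "{- int n + m..int n + m}" "shift (- m) b"] by simp
qed simp_all

text \<open>The added coordinate \<open>x (i + 1)\<close> has index 1 modulo 3 and is itself left
  alone, which makes \<open>tau\<close> an involution. It commutes with the shifts by multiples of
  3, and these will make the commutant infinite.\<close>

definition tau :: "(int \<Rightarrow> bool) \<Rightarrow> int \<Rightarrow> bool" where
  "tau x = (\<lambda>i. if i mod 3 = 0 then x i \<noteq> x (i + 1) else x i)"

lemma tau_measurable: "tau \<in> measurable Om Om"
  unfolding tau_def by (rule measurable_into_Om) measurable

lemma tau_tau: "tau (tau x) = x"
proof
  fix i :: int
  have "(i + 1) mod 3 \<noteq> 0" if "i mod 3 = 0" using that by presburger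
  then show "tau (tau x) i = x i" by (auto simp: tau_def)
qed

lemma distr_tau: "distr Om Om tau = Om"
\<comment> \<open>A half-open window between multiples of 3 contains \<open>i + 1\<close> along with
  each \<open>i\<close> divisible by 3, so the preimage under \<open>tau\<close> of a cylinder over
  it is again such a cylinder.\<close>
proof (rule Om_eqI[where J = "\<lambda>n. {- 3 * int n..<3 * int n}"])
  show "incseq (\<lambda>n. {- 3 * int n..<3 * int n})" by (auto simp: incseq_def)
  show "(\<Union>n. {- 3 * int n..<3 * int n}) = UNIV"
  proof (intro equalityI subsetI UNIV_I)
    fix x :: int
    have "x \<in> {- 3 * int (nat \<bar>x\<bar> + 1)..<3 * int (nat \<bar>x\<bar> + 1)}" by auto
    then show "x \<in> (\<Union>n. {- 3 * int n..<3 * int n})" by blast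
  qed
  fix n :: nat and b
  let ?J = "{- 3 * int n..<3 * int n}"
  have closed: "i + 1 \<in> ?J" if "i \<in> ?J" "i mod 3 = 0" for i using that by (simp, presburger)
  have tt: "x \<in> cyl ?J (tau b)" if "tau x \<in> cyl ?J b" for x b
  proof -
    have "x i = tau b i" if i: "i \<in> ?J" for i
    proof -
      have "tau x i = b i" "i mod 3 = 0 \<Longrightarrow> tau x (i + 1) = b (i + 1)"
        using \<open>tau x \<in> cyl ?J b\<close> i closed by (auto simp: cyl_def)
      then have "tau (tau x) i = tau b i" by (simp add: tau_def[of "tau x"] tau_def[of b])
      then show ?thesis by (simp add: tau_tau)
    qed
    then show ?thesis by (simp add: cyl_def)
  qed
  have "tau -` cyl ?J b = cyl ?J (tau b)"
    using tt[of _ b] tt[of "tau _" "tau b"] by (auto simp: tau_tau)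
  then show "emeasure (distr Om Om tau) (cyl ?J b) = ennreal ((1/2) ^ card ?J)"
    using emeasure_distr[OF tau_measurable cyl_sets[of ?J b]] emeasure_cyl[of ?J "tau b"] by simp
qed simp_all

abbreviation Omc where "Omc \<equiv> completion Om"

lemma shift_mp: "shift m \<in> mp_auts Omc"
proof (rule mp_autsI(1)[where g = "shift (- m)"])
  show "shift m \<in> measurable Omc Omc" "distr Omc Omc (shift m) = Omc"
    using measure_preserving_completion[OF shift_measurable distr_shift] by blast+
  show "shift (- m) \<in> measurable Omc Omc"
    using measure_preserving_completion(1)[OF shift_measurable distr_shift] .
qed (simp_all add: shift_shift)

lemma tau_mp: "tau \<in> mp_auts Omc"
proof (rule mp_autsI(1)[where g = tau])
  show "tau \<in> measurable Omc Omc" "distr Omc Omc tau = Omc" "tau \<in> measurable Omc Omc"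
    using measure_preserving_completion[OF tau_measurable distr_tau] by blast+
qed (simp_all add: tau_tau)

section \<open>Binary digits\<close>

definition dig :: "nat \<Rightarrow> real \<Rightarrow> bool" where "dig m x = odd \<lfloor>2 ^ Suc m * x\<rfloor>"

lemma floor_double: "\<lfloor>2 ^ Suc n * x\<rfloor> = 2 * \<lfloor>2 ^ n * x\<rfloor> + of_bool (dig n (x :: real))"
proof -
  define y where "y = 2 ^ n * x"
  have y: "2 ^ Suc n * x = 2 * y" by (simp add: y_def)
  have "2 * \<lfloor>y\<rfloor> \<le> \<lfloor>2 * y\<rfloor>" "\<lfloor>2 * y\<rfloor> \<le> 2 * \<lfloor>y\<rfloor> + 1"
    by (simp add: le_floor_iff, linarith)
  then have "\<lfloor>2 * y\<rfloor> = 2 * \<lfloor>y\<rfloor> \<or> \<lfloor>2 * y\<rfloor> = 2 * \<lfloor>y\<rfloor> + 1" by linarith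
  then show ?thesis unfolding dig_def y y_def[symmetric] by auto
qed

text \<open>Fixing the first \<open>n\<close> digits amounts to fixing the integer part of
  \<open>2 ^ n * x\<close>; the next digit decides between its two refinements.\<close>

lemma dig_interval:
  "\<exists>k::int. {x. 0 \<le> x \<and> x < 1 \<and> (\<forall>m<n. dig m x = c m)} = {real_of_int k / 2 ^ n ..< (real_of_int k + 1) / 2 ^ n}"
proof -
  have "\<exists>k::int. \<forall>x. 0 \<le> x \<and> x < 1 \<and> (\<forall>m<n. dig m x = c m) \<longleftrightarrow> \<lfloor>2 ^ n * x\<rfloor> = k"
  proof (induction n)
    case 0
    show ?case by (intro exI[of _ 0]) (auto simp: floor_eq_iff)
  next
    case (Suc n)
    then obtain k where k: "\<And>x. 0 \<le> x \<and> x < 1 \<and> (\<forall>m<n. dig m x = c m) \<longleftrightarrow> \<lfloor>2 ^ n * x\<rfloor> = k" by blast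
    have "0 \<le> x \<and> x < 1 \<and> (\<forall>m<Suc n. dig m x = c m) \<longleftrightarrow> \<lfloor>2 ^ Suc n * x\<rfloor> = 2 * k + of_bool (c n)" for x
    proof -
      have "0 \<le> x \<and> x < 1 \<and> (\<forall>m<Suc n. dig m x = c m) \<longleftrightarrow> \<lfloor>2 ^ n * x\<rfloor> = k \<and> dig n x = c n"
        using k[of x] by (auto simp: less_Suc_eq)
      also have "\<dots> \<longleftrightarrow> 2 * \<lfloor>2 ^ n * x\<rfloor> + of_bool (dig n x) = 2 * k + of_bool (c n)"
        by (cases "dig n x"; cases "c n") (simp_all, presburger+)
      finally show ?thesis unfolding floor_double .
    qed
    then show ?case by blast
  qed
  then obtain k where k: "\<And>x. 0 \<le> x \<and> x < 1 \<and> (\<forall>m<n. dig m x = c m) \<longleftrightarrow> \<lfloor>2 ^ n * x\<rfloor> = (k::int)" by blast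
  have "\<lfloor>2 ^ n * x\<rfloor> = k \<longleftrightarrow> x \<in> {real_of_int k / 2 ^ n ..< (real_of_int k + 1) / 2 ^ n}" for x :: real
    by (simp add: floor_eq_iff field_simps)
  then show ?thesis using k by blast
qed

definition digits :: "real \<Rightarrow> int \<Rightarrow> bool" where "digits x = (\<lambda>i. dig (int_encode i) x)"

definition undigits :: "(int \<Rightarrow> bool) \<Rightarrow> real" where
  "undigits w = (\<Sum>m. of_bool (w (int_decode m)) / 2 ^ Suc m)"

lemma digits_measurable: "digits \<in> measurable N1 Om"
  unfolding digits_def dig_def by (rule measurable_into_Om) measurable

lemma undigits_measurable: "undigits \<in> measurable Om N1"
proof -
  have [measurable]: "(\<lambda>w. of_bool (w i) :: real) \<in> borel_measurable Om" for i
    by (rule measurable_compose[OF coord_measurable]) simp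
  have "undigits \<in> borel_measurable Om" unfolding undigits_def by measurable
  then show ?thesis by (simp cong: measurable_cong_sets)
qed

lemma undigits_digits:
  assumes x: "0 \<le> x" "x < 1"
  shows "undigits (digits x) = x"
proof -
  have part: "(\<Sum>m<n. of_bool (dig m x) / 2 ^ Suc m) = real_of_int \<lfloor>2 ^ n * x\<rfloor> / 2 ^ n" for n
  proof (induction n)
    case 0
    then show ?case using x by (simp add: floor_eq_iff)
  next
    case (Suc n)
    then show ?case unfolding floor_double by (simp add: field_simps)
  qed
  have "(\<lambda>n. real_of_int \<lfloor>2 ^ n * x\<rfloor> / 2 ^ n) \<longlonglongrightarrow> x"
  proof (rule tendsto_sandwich)
    show "\<forall>\<^sub>F n in sequentially. x - (1/2) ^ n \<le> real_of_int \<lfloor>2 ^ n * x\<rfloor> / 2 ^ n"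
    proof (rule always_eventually, rule allI)
      fix n
      have "2 ^ n * x - 1 \<le> real_of_int \<lfloor>2 ^ n * x\<rfloor>" by linarith
      then have "(2 ^ n * x - 1) / 2 ^ n \<le> real_of_int \<lfloor>2 ^ n * x\<rfloor> / 2 ^ n" by (rule divide_right_mono) simp
      moreover have "(2 ^ n * x - 1) / 2 ^ n = x - (1/2) ^ n" by (simp add: diff_divide_distrib power_divide)
      ultimately show "x - (1/2) ^ n \<le> real_of_int \<lfloor>2 ^ n * x\<rfloor> / 2 ^ n" by simp
    qed
    show "\<forall>\<^sub>F n in sequentially. real_of_int \<lfloor>2 ^ n * x\<rfloor> / 2 ^ n \<le> x"
    proof (rule always_eventually, rule allI)
      fix n
      have "real_of_int \<lfloor>2 ^ n * x\<rfloor> \<le> 2 ^ n * x" by linarith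
      then show "real_of_int \<lfloor>2 ^ n * x\<rfloor> / 2 ^ n \<le> x" by (simp add: field_simps)
    qed
    show "(\<lambda>n. x - (1/2) ^ n) \<longlonglongrightarrow> x"
      using tendsto_diff[OF tendsto_const LIMSEQ_power_zero[of "1/2::real"], of x] by simp
  qed simp
  then have "(\<lambda>m. of_bool (dig m x) / 2 ^ Suc m) sums x" unfolding sums_def part .
  then show ?thesis by (simp add: undigits_def digits_def sums_iff)
qed

lemma distr_digits: "distr N1 Om digits = Om"
proof (rule Om_eqI[where J = "\<lambda>n. int_decode ` {..<n}"])
  show "incseq (\<lambda>n. int_decode ` {..<n})" by (auto simp: incseq_def)
  show "(\<Union>n. int_decode ` {..<n}) = UNIV"
  proof (intro equalityI subsetI UNIV_I)
    fix x :: int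
    have "x = int_decode (int_encode x)" by simp
    then show "x \<in> (\<Union>n. int_decode ` {..<n})" by blast
  qed
  fix n :: nat and b
  obtain k :: int where k: "{x. 0 \<le> x \<and> x < 1 \<and> (\<forall>m<n. dig m x = b (int_decode m))}
      = {real_of_int k / 2 ^ n ..< (real_of_int k + 1) / 2 ^ n}"
    using dig_interval[of n "\<lambda>m. b (int_decode m)"] by blast
  have c: "digits -` cyl (int_decode ` {..<n}) b \<in> sets borel"
    using measurable_sets[OF digits_measurable cyl_sets[of "int_decode ` {..<n}" b]] by simp
  have "emeasure (distr N1 Om digits) (cyl (int_decode ` {..<n}) b) = emeasure N1 (digits -` cyl (int_decode ` {..<n}) b)"
    using emeasure_distr[OF digits_measurable cyl_sets[of "int_decode ` {..<n}" b]] by simp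
  also have "\<dots> = emeasure lborel ({0..<1} \<inter> digits -` cyl (int_decode ` {..<n}) b)"
    by (rule emeasure_N1[OF c])
  also have "{0..<1} \<inter> digits -` cyl (int_decode ` {..<n}) b = {real_of_int k / 2 ^ n ..< (real_of_int k + 1) / 2 ^ n}"
    unfolding k[symmetric] by (auto simp: cyl_def digits_def)
  also have "emeasure lborel \<dots> = ennreal ((1/2) ^ n)"
    by (simp add: field_simps power_divide)
  also have "(1/2::real) ^ n = (1/2) ^ card (int_decode ` {..<n})" by (simp add: card_image inj_int_decode)
  finally show "emeasure (distr N1 Om digits) (cyl (int_decode ` {..<n}) b) = ennreal ((1/2) ^ card (int_decode ` {..<n}))" .
qed simp_all

lemma iso_Omc_U: "\<exists>f. iso_mod_null Omc U f"
proof -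
  have ud: "AE x in N1. undigits (digits x) = x"
    using AE_U01 unfolding AE_completion_iff by eventually_elim (simp add: undigits_digits)
  have "iso_mod_null N1 Om digits"
  proof (rule iso_mod_nullI[where g = undigits])
    show "digits \<in> measurable N1 Om" "undigits \<in> measurable Om N1" "distr N1 Om digits = Om"
      by (rule digits_measurable undigits_measurable distr_digits)+
    show "AE x in N1. undigits (digits x) = x" by (rule ud)
    have m: "{w \<in> space Om. digits (undigits w) = w} \<in> sets Om"
    proof -
      have [measurable]: "(\<lambda>w. digits (undigits w) i) \<in> measurable Om (count_space UNIV)" for i
        by (rule measurable_compose[OF undigits_measurable measurable_compose[OF digits_measurable coord_measurable]])
      have "{w \<in> space Om. \<forall>i. digits (undigits w) i = w i} \<in> sets Om" by measurable
      then show ?thesis by (simp add: fun_eq_iff)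
    qed
    \<comment> \<open>Sequences ending in ones, where \<open>digits\<close> fails to invert
      \<open>undigits\<close>, never have to be discussed: the identity holds almost surely on the
      image of \<open>digits\<close>, whose distribution is \<open>Om\<close>.\<close>
    have "AE x in N1. digits (undigits (digits x)) = digits x" using ud by eventually_elim simp
    then have "AE w in distr N1 Om digits. digits (undigits w) = w"
      using AE_distr_iff[OF digits_measurable m] by simp
    then show "AE w in Om. digits (undigits w) = w" by (simp only: distr_digits)
  qed
  then show ?thesis using iso_mod_null_sym[OF iso_completion] by metis
qed


section \<open>Approximation by cylinder sets\<close>

definition window :: "nat \<Rightarrow> int set" where "window n = {- int n..int n}"

lemma finite_window: "finite (window n)" by (simp add: window_def)

lemma dep_mono: "dep J S \<Longrightarrow> J \<subseteq> K \<Longrightarrow> dep K S"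
  unfolding dep_def by blast

lemma dep_window_mono: "dep (window n) S \<Longrightarrow> n \<le> m \<Longrightarrow> dep (window m) S"
  by (erule dep_mono) (auto simp: window_def)

lemma dep_Un:
  assumes "dep J S" "dep J S'"
  shows "dep J (S \<union> S')"
  unfolding dep_def
proof (intro allI impI)
  fix x y assume eq: "\<forall>i\<in>J. x i = y i" and "x \<in> S \<union> S'"
  moreover have "x \<in> S \<longrightarrow> y \<in> S" "x \<in> S' \<longrightarrow> y \<in> S'" using assms eq unfolding dep_def by simp_all
  ultimately show "y \<in> S \<union> S'" by blast
qed

lemma dep_Compl:
  assumes "dep J S"
  shows "dep J (- S)"
  unfolding dep_def
proof (intro allI impI)
  fix x y assume eq: "\<forall>i\<in>J. x i = y i" and x: "x \<in> - S"
  have "\<forall>i\<in>J. y i = x i" using eq by simp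
  then have "y \<in> S \<longrightarrow> x \<in> S" using assms unfolding dep_def by simp
  then show "y \<in> - S" using x by blast
qed

definition cylinders :: "(int \<Rightarrow> bool) set set" where
  "cylinders = {C. \<exists>n. dep (window n) C}"

lemma cylinders_sets: "C \<in> cylinders \<Longrightarrow> C \<in> sets Om"
  using dep_sets[OF finite_window] by (auto simp: cylinders_def)

lemma countable_cylinders: "countable cylinders"
proof -
  have "countable {C. dep (window n) C}" for n
  proof (rule countable_subset)
    show "{C. dep (window n) C} \<subseteq> (\<lambda>P. \<Union>b\<in>P. cyl (window n) b) ` Pow (window n \<rightarrow>\<^sub>E UNIV)"
    proof
      fix C assume "C \<in> {C. dep (window n) C}"
      then have "C = (\<Union>b\<in>patterns (window n) C. cyl (window n) b)" using dep_UN by blast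
      moreover have "patterns (window n) C \<in> Pow (window n \<rightarrow>\<^sub>E UNIV)" by (auto simp: patterns_def)
      ultimately show "C \<in> (\<lambda>P. \<Union>b\<in>P. cyl (window n) b) ` Pow (window n \<rightarrow>\<^sub>E UNIV)" by blast
    qed
    have "finite (window n \<rightarrow>\<^sub>E (UNIV :: bool set))" by (rule finite_PiE) (simp_all add: finite_window)
    then show "countable ((\<lambda>P. \<Union>b\<in>P. cyl (window n) b) ` Pow (window n \<rightarrow>\<^sub>E UNIV))"
      by (intro countable_finite finite_imageI) simp
  qed
  then have "countable (\<Union>n. {C. dep (window n) C})" by (intro countable_UN) simp_all
  moreover have "cylinders = (\<Union>n. {C. dep (window n) C})" by (auto simp: cylinders_def)
  ultimately show ?thesis by (simp only:)
qed

lemma cylinders_UN_less: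
  assumes "\<And>i. i < (n::nat) \<Longrightarrow> C i \<in> cylinders"
  shows "(\<Union>i<n. C i) \<in> cylinders"
  using assms
proof (induction n)
  case 0
  then show ?case by (auto simp: cylinders_def dep_def)
next
  case (Suc n)
  then have "(\<Union>i<n. C i) \<in> cylinders" "C n \<in> cylinders" by simp_all
  then obtain k l where "dep (window k) (\<Union>i<n. C i)" "dep (window l) (C n)"
    unfolding cylinders_def by blast
  then have "dep (window (max k l)) (\<Union>i<n. C i)" "dep (window (max k l)) (C n)"
    using dep_window_mono max.cobounded1 max.cobounded2 by blast+
  then have "dep (window (max k l)) ((\<Union>i<n. C i) \<union> C n)" by (rule dep_Un)
  moreover have "(\<Union>i<n. C i) \<union> C n = (\<Union>i<Suc n. C i)" by (auto simp: less_Suc_eq)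
  ultimately have "dep (window (max k l)) (\<Union>i<Suc n. C i)" by simp
  then show ?case by (auto simp: cylinders_def)
qed

abbreviation symdiff :: "'a set \<Rightarrow> 'a set \<Rightarrow> 'a set" where
  "symdiff A B \<equiv> (A - B) \<union> (B - A)"

text \<open>The sets that can be approximated by cylinders form a sigma-algebra: a countable union
  is first cut to finitely many members, which are then approximated one by one.\<close>

lemma approx_cylinder:
  assumes A: "A \<in> sets Om" and e: "e > 0"
  shows "\<exists>C\<in>cylinders. measure Om (symdiff A C) < e"
proof -
  have gen: "sets Om = sigma_sets UNIV {{x. x i \<in> B} | i B. True}"
    unfolding Om_def sets_PiM_single by (simp add: PiE_UNIV_domain)
  have "A \<in> sigma_sets UNIV {{x. x i \<in> B} | i B. True}" using A gen by simp
  then have "A \<in> sets Om \<and> (\<forall>e>0. \<exists>C\<in>cylinders. measure Om (symdiff A C) < e)"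
  proof (induction rule: sigma_sets.induct)
    case (Basic A)
    then obtain i B where AB: "A = {x. x i \<in> B}" by blast
    have "i \<in> window (nat \<bar>i\<bar>)" by (auto simp: window_def)
    then have "dep (window (nat \<bar>i\<bar>)) A" unfolding AB dep_def by auto
    then have C: "A \<in> cylinders" by (auto simp: cylinders_def)
    show ?case
    proof (intro conjI allI impI)
      show "A \<in> sets Om" by (rule cylinders_sets[OF C])
      fix e :: real assume "e > 0"
      then show "\<exists>C\<in>cylinders. measure Om (symdiff A C) < e" using C by (intro bexI[of _ A]) simp_all
    qed
  next
    case Empty
    have C: "{} \<in> cylinders" by (auto simp: cylinders_def dep_def)
    show ?case
    proof (intro conjI allI impI)
      fix e :: real assume "e > 0"
      then show "\<exists>C\<in>cylinders. measure Om (symdiff {} C) < e" using C by (intro bexI[of _ "{}"]) simp_all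
    qed simp
  next
    case (Compl A)
    show ?case
    proof (intro conjI allI impI)
      show "UNIV - A \<in> sets Om" using Compl sets.compl_sets[of A Om] by simp
      fix e :: real assume "e > 0"
      then obtain C where C: "C \<in> cylinders" "measure Om (symdiff A C) < e" using Compl by blast
      have "- C \<in> cylinders" using C(1) dep_Compl unfolding cylinders_def by blast
      moreover have "symdiff (UNIV - A) (- C) = symdiff A C" by blast
      ultimately show "\<exists>C\<in>cylinders. measure Om (symdiff (UNIV - A) C) < e" using C(2) by metis
    qed
  next
    case (Union A)
    then have A: "\<And>i. A i \<in> sets Om" by blast
    show ?case
    proof (intro conjI allI impI)
      show "\<Union> (range A) \<in> sets Om" using A by blast
      fix e :: real assume e: "e > 0"
      have "(\<lambda>n. measure Om (\<Union>i<n. A i)) \<longlonglongrightarrow> measure Om (\<Union>n. \<Union>i<n. A i)"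
        using A by (intro Om.finite_Lim_measure_incseq) (auto simp: incseq_def, metis lessThan_iff order_less_le_trans)
      moreover have "(\<Union>n. \<Union>i<n. A i) = (\<Union>i. A i)" by auto
      ultimately have "(\<lambda>n. measure Om (\<Union>i<n. A i)) \<longlonglongrightarrow> measure Om (\<Union>i. A i)" by simp
      then obtain N where N: "\<bar>measure Om (\<Union>i<N. A i) - measure Om (\<Union>i. A i)\<bar> < e / 2"
        using e LIMSEQ_iff[of "\<lambda>n. measure Om (\<Union>i<n. A i)"] by (metis half_gt_zero order_refl real_norm_def)
      \<comment> \<open>Half of \<open>e\<close> is spent on the cut and at most half on the
        \<open>N\<close> approximations; \<open>N + 1\<close> avoids a division by zero.\<close>
      have "\<exists>C. \<forall>i. C i \<in> cylinders \<and> measure Om (symdiff (A i) (C i)) < e / (2 * real (N + 1))"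
      proof (rule choice, rule allI)
        fix i
        have "e / (2 * real (N + 1)) > 0" using e by simp
        then show "\<exists>C. C \<in> cylinders \<and> measure Om (symdiff (A i) C) < e / (2 * real (N + 1))"
          using Union by blast
      qed
      then obtain C where C: "\<And>i. C i \<in> cylinders"
        "\<And>i. measure Om (symdiff (A i) (C i)) < e / (2 * real (N + 1))" by blast
      note Cs = cylinders_sets[OF C(1)]
      have "measure Om (symdiff (\<Union>i. A i) (\<Union>i<N. C i))
          \<le> measure Om (((\<Union>i. A i) - (\<Union>i<N. A i)) \<union> (\<Union>i<N. symdiff (A i) (C i)))"
      proof (rule Om.finite_measure_mono)
        show "symdiff (\<Union>i. A i) (\<Union>i<N. C i) \<subseteq> ((\<Union>i. A i) - (\<Union>i<N. A i)) \<union> (\<Union>i<N. symdiff (A i) (C i))"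
          by auto
        show "((\<Union>i. A i) - (\<Union>i<N. A i)) \<union> (\<Union>i<N. symdiff (A i) (C i)) \<in> sets Om"
          using A Cs by (intro sets.Un sets.Diff sets.finite_UN sets.countable_UN) auto
      qed
      also have "\<dots> \<le> measure Om ((\<Union>i. A i) - (\<Union>i<N. A i)) + measure Om (\<Union>i<N. symdiff (A i) (C i))"
        using A Cs by (intro measure_Un_le sets.Un sets.Diff sets.finite_UN sets.countable_UN) auto
      also have "measure Om ((\<Union>i. A i) - (\<Union>i<N. A i)) = measure Om (\<Union>i. A i) - measure Om (\<Union>i<N. A i)"
        using A by (intro Om.finite_measure_Diff sets.finite_UN sets.countable_UN) auto
      also have "measure Om (\<Union>i<N. symdiff (A i) (C i)) \<le> (\<Sum>i<N. measure Om (symdiff (A i) (C i)))"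
        using A Cs by (intro Om.finite_measure_subadditive_finite) auto
      also have "\<dots> \<le> (\<Sum>i<N. e / (2 * real (N + 1)))"
        using C(2) by (intro sum_mono less_imp_le)
      also have "\<dots> = real N * (e / (2 * real (N + 1)))" by simp
      also have "\<dots> \<le> e / 2" using e by (simp add: field_simps)
      finally have "measure Om (symdiff (\<Union>i. A i) (\<Union>i<N. C i)) < e" using N by linarith
      moreover have "(\<Union>i<N. C i) \<in> cylinders" using C by (intro cylinders_UN_less)
      ultimately show "\<exists>C\<in>cylinders. measure Om (symdiff (\<Union> (range A)) C) < e" by blast
    qed
  qed
  then show ?thesis using e by blast
qed

lemma approx_cylinder_completion:
  assumes A: "A \<in> sets Omc" and e: "e > 0"
  obtains C where "C \<in> cylinders" "measure Omc (symdiff A C) < e"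
proof -
  have m: "main_part Om A \<in> sets Om" by (rule main_part_sets[OF A])
  obtain C where C: "C \<in> cylinders" "measure Om (symdiff (main_part Om A) C) < e"
    using approx_cylinder[OF m e] by blast
  note Cs = cylinders_sets[OF C(1)]
  have "measure Omc (symdiff A C) = measure Omc (symdiff (main_part Om A) C)"
  proof (rule measure_eq_AE)
    show "AE x in Omc. x \<in> symdiff A C \<longleftrightarrow> x \<in> symdiff (main_part Om A) C"
      using AE_completion[OF AE_notin_null_part[OF A]]
    proof eventually_elim
      case (elim x)
      then have "x \<in> A \<longleftrightarrow> x \<in> main_part Om A" using main_part_null_part_Un[OF A] by blast
      then show ?case by blast
    qed
  qed (use A m Cs in auto)
  also have "\<dots> = measure Om (symdiff (main_part Om A) C)" using m Cs by (intro measure_completion) auto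
  finally show thesis using that C by simp
qed

section \<open>Independence of distant coordinates and ergodicity\<close>

interpretation Omc: prob_space Omc
  by (rule Om.prob_space_completion)

lemma measure_dep:
  assumes "finite J" "dep J S" "W \<in> sets Om"
  shows "measure Om (S \<inter> W) = (\<Sum>b\<in>patterns J S. measure Om (cyl J b \<inter> W))"
proof -
  have "ennreal (measure Om (S \<inter> W)) = (\<Sum>b\<in>patterns J S. ennreal (measure Om (cyl J b \<inter> W)))"
    using emeasure_dep[OF assms(1,2) refl assms(3)] by (simp add: Om.emeasure_eq_measure)
  also have "\<dots> = ennreal (\<Sum>b\<in>patterns J S. measure Om (cyl J b \<inter> W))" by (rule sum_ennreal) simp
  finally show ?thesis by (simp add: sum_nonneg)
qed

lemma dep_indep:
  assumes J: "finite J" "dep J S" and K: "finite K" "dep K S'" and JK: "J \<inter> K = {}"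
  shows "measure Om (S \<inter> S') = measure Om S * measure Om S'"
proof -
  have S': "S' \<in> sets Om" by (rule dep_sets[OF K])
  have cc: "measure Om (cyl J b \<inter> cyl K c) = (1/2) ^ card J * (1/2) ^ card K" for b c
  proof -
    have "cyl J b \<inter> cyl K c = cyl (J \<union> K) (\<lambda>i. if i \<in> J then b i else c i)"
      using JK by (auto simp: cyl_def)
    then show ?thesis using J(1) K(1) JK by (simp add: measure_cyl card_Un_disjoint power_add)
  qed
  have *: "measure Om T = real (card (patterns L T)) * (1/2) ^ card L" if "finite L" "dep L T" for L T
    using measure_dep[OF that sets.top[of Om, simplified]] measure_cyl[OF that(1)] by simp
  have "measure Om (S \<inter> S') = (\<Sum>b\<in>patterns J S. measure Om (cyl J b \<inter> S'))"
    by (rule measure_dep[OF J S'])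
  also have "\<dots> = (\<Sum>b\<in>patterns J S. \<Sum>c\<in>patterns K S'. (1/2) ^ card J * (1/2) ^ card K)"
  proof (rule sum.cong[OF refl])
    fix b
    have "measure Om (S' \<inter> cyl J b) = (\<Sum>c\<in>patterns K S'. measure Om (cyl K c \<inter> cyl J b))"
      by (rule measure_dep[OF K cyl_sets[OF J(1)]])
    then show "measure Om (cyl J b \<inter> S') = (\<Sum>c\<in>patterns K S'. (1/2) ^ card J * (1/2) ^ card K)"
      using cc by (simp add: Int_commute)
  qed
  also have "\<dots> = measure Om S * measure Om S'" by (simp add: *[OF J] *[OF K])
  finally show ?thesis .
qed

lemma measure_vimage:
  assumes "g \<in> mp_auts Omc" "A \<in> sets Omc"
  shows "measure Omc (g -` A) = measure Omc A" "g -` A \<in> sets Omc"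
  using mp_auts_emeasure_vimage[OF assms] measurable_sets[OF mp_autsD(1)[OF assms(1)] assms(2)]
  by (simp_all add: measure_def)

lemma symdiff_le:
  assumes "A \<in> sets Omc" "B \<in> sets Omc"
  shows "\<bar>measure Omc A - measure Omc B\<bar> \<le> measure Omc (symdiff A B)"
proof -
  have "measure Omc A \<le> measure Omc (B \<union> symdiff A B)" "measure Omc B \<le> measure Omc (A \<union> symdiff A B)"
    using assms by (intro Omc.finite_measure_mono; auto)+
  moreover have "measure Omc (B \<union> symdiff A B) \<le> measure Omc B + measure Omc (symdiff A B)"
    "measure Omc (A \<union> symdiff A B) \<le> measure Omc A + measure Omc (symdiff A B)"
    using assms by (intro measure_Un_le; auto)+
  ultimately show ?thesis by linarith
qed

text \<open>A mixing argument: \<open>A\<close> is close to a cylinder \<open>C\<close>, and a far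
  translate of \<open>C\<close> is independent of \<open>C\<close>. Since \<open>A\<close> is almost
  its own translate, P(A) is close to P(C)^2 and therefore to P(A)^2.\<close>

lemma ergodic_shift: "ae_ergodic Omc (shift 1)"
  unfolding ae_ergodic_def
proof (intro ballI impI)
  fix A assume A: "A \<in> sets Omc" and inv: "AE x in Omc. shift 1 x \<in> A \<longleftrightarrow> x \<in> A"
  let ?P = "measure Omc"
  have inv': "AE x in Omc. shift (int k) x \<in> A \<longleftrightarrow> x \<in> A" for k
  proof (induction k)
    case 0
    then show ?case by (simp add: shift_shift)
  next
    case (Suc k)
    have s: "shift 1 (shift (int k) x) = shift (int (Suc k)) x" for x by (simp add: shift_shift add.commute)
    from Suc AE_mp_auts[OF shift_mp inv, of "int k"] show ?case unfolding s[symmetric] by eventually_elim simp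
  qed
  have "\<bar>?P A - ?P A * ?P A\<bar> \<le> 0 + d" if "d > 0" for d
  proof -
    \<comment> \<open>Two comparisons follow, each with an error of at most
      \<open>2 * e\<close>.\<close>
    define e where "e = d / 4"
    have e: "e > 0" using that by (simp add: e_def)
    obtain C where C: "C \<in> cylinders" "?P (symdiff A C) < e" using approx_cylinder_completion[OF A e] .
    then obtain n where n: "dep (window n) C" by (auto simp: cylinders_def)
    have Cs: "C \<in> sets Om" by (rule cylinders_sets[OF C(1)])
    have Cc: "C \<in> sets Omc" using Cs by simp
    \<comment> \<open>The least positive shift that makes the window disjoint from its
      translate.\<close>
    define m where "m = 2 * int n + 1"
    define K where "K = {- int n + m..int n + m}"
    have dK: "dep K (shift m -` C)"
      unfolding dep_def
    proof (intro allI impI)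
      fix x y assume xy: "\<forall>i\<in>K. x i = y i" and x: "x \<in> shift m -` C"
      have "\<forall>i\<in>window n. shift m x i = shift m y i" using xy by (auto simp: window_def K_def shift_def)
      then show "y \<in> shift m -` C" using n x unfolding dep_def by simp
    qed
    have "window n \<inter> K = {}" by (auto simp: window_def K_def m_def)
    then have ind: "measure Om (C \<inter> shift m -` C) = measure Om C * measure Om (shift m -` C)"
      by (intro dep_indep[OF finite_window n _ dK]) (simp_all add: K_def)
    have sC: "?P (shift m -` C) = ?P C" "shift m -` C \<in> sets Omc" using measure_vimage[OF shift_mp Cc] by blast+
    have sCs: "shift m -` C \<in> sets Om" using dep_sets[OF _ dK] by (simp add: K_def)
    have ind': "?P (C \<inter> shift m -` C) = ?P C * ?P C"
      using ind sC(1) Cs sCs by (simp add: measure_completion)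
    have sA: "shift m -` A \<in> sets Omc" using measure_vimage[OF shift_mp A] by blast
    have "AE x in Omc. x \<in> A \<inter> shift m -` A \<longleftrightarrow> x \<in> A"
      using inv'[of "nat m"] by (simp add: m_def) (auto elim: eventually_mono)
    then have PA: "?P (A \<inter> shift m -` A) = ?P A"
      using A sA by (intro measure_eq_AE) auto
    have "\<bar>?P (A \<inter> shift m -` A) - ?P (C \<inter> shift m -` C)\<bar> \<le> ?P (symdiff (A \<inter> shift m -` A) (C \<inter> shift m -` C))"
      using A Cc sA sC(2) by (intro symdiff_le) auto
    also have "\<dots> \<le> ?P (symdiff A C \<union> shift m -` symdiff A C)"
      using A Cc measure_vimage(2)[OF shift_mp, of "symdiff A C" m] by (intro Omc.finite_measure_mono) auto
    also have "\<dots> \<le> ?P (symdiff A C) + ?P (shift m -` symdiff A C)"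
      using A Cc measure_vimage(2)[OF shift_mp, of "symdiff A C" m] by (intro measure_Un_le) auto
    also have "?P (shift m -` symdiff A C) = ?P (symdiff A C)"
      using A Cc by (intro measure_vimage(1)[OF shift_mp]) auto
    finally have 1: "\<bar>?P A - ?P C * ?P C\<bar> \<le> 2 * e" using C(2) PA ind' by linarith
    have 2: "\<bar>?P A - ?P C\<bar> \<le> e" using symdiff_le[OF A Cc] C(2) by linarith
    have "?P A * ?P A - ?P C * ?P C = (?P A - ?P C) * (?P A + ?P C)" by (simp add: algebra_simps)
    then have "\<bar>?P A * ?P A - ?P C * ?P C\<bar> = \<bar>?P A - ?P C\<bar> * \<bar>?P A + ?P C\<bar>" by (simp only: abs_mult)
    also have "\<dots> \<le> e * 2"
    proof (rule mult_mono[OF 2])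
      show "\<bar>?P A + ?P C\<bar> \<le> 2"
        using Omc.prob_le_1[of A] Omc.prob_le_1[of C] measure_nonneg[of Omc A] measure_nonneg[of Omc C] by linarith
    qed (use e in simp_all)
    finally show ?thesis using 1 unfolding e_def by linarith
  qed
  then have "\<bar>?P A - ?P A * ?P A\<bar> \<le> 0" by (rule field_le_epsilon)
  then have "?P A * (1 - ?P A) = 0" by (simp add: algebra_simps)
  then show "?P A = 0 \<or> ?P A = 1" by simp
qed


section \<open>Rigidity of the commutant of the shift and a transvection\<close>

lemma commutes_with_comp:
  assumes g: "commutes_with M g \<phi>" and h: "h \<in> mp_auts M" "commutes_with M h \<phi>"
  shows "commutes_with M (g \<circ> h) \<phi>"
  using AE_mp_auts[OF h(1) g[unfolded commutes_with_def]] h(2)[unfolded commutes_with_def]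
  unfolding commutes_with_def by eventually_elim simp

definition commuting_auts :: "((int \<Rightarrow> bool) \<Rightarrow> int \<Rightarrow> bool) \<Rightarrow> ((int \<Rightarrow> bool) \<Rightarrow> int \<Rightarrow> bool) set" where
  "commuting_auts \<phi> = {g \<in> mp_auts Omc. commutes_with Omc g \<phi>}"

lemma commuting_comp:
  "g \<in> commuting_auts \<phi> \<Longrightarrow> h \<in> commuting_auts \<phi> \<Longrightarrow> g \<circ> h \<in> commuting_auts \<phi>"
  unfolding commuting_auts_def using commutes_with_comp mp_auts_comp by blast

lemma commuting_id: "id \<in> commuting_auts \<phi>"
proof -
  have "commutes_with Omc id \<phi>" by (simp add: commutes_with_def)
  then show ?thesis using mp_auts_id unfolding commuting_auts_def by blast
qed

lemma commuting_shift:
  assumes "commutes_with Omc (shift 1) \<phi>"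
  shows "shift m \<in> commuting_auts \<phi>"
proof -
  have pos: "shift 1 \<in> commuting_auts \<phi>" using assms shift_mp by (simp add: commuting_auts_def)
  have neg: "shift (-1) \<in> commuting_auts \<phi>"
  proof -
    have "AE x in Omc. \<phi> (shift (-1) x) = shift (-1) (\<phi> x)"
      using AE_mp_auts[OF shift_mp[of "-1"] assms[unfolded commutes_with_def]]
    proof eventually_elim
      case (elim x)
      then have "shift (-1) (\<phi> x) = shift (-1) (shift 1 (\<phi> (shift (-1) x)))" by (simp add: shift_shift)
      then show ?case by (simp add: shift_shift)
    qed
    then show ?thesis using shift_mp by (simp add: commuting_auts_def commutes_with_def)
  qed
  have nat: "shift (c * int n) \<in> commuting_auts \<phi>" if c: "shift c \<in> commuting_auts \<phi>" for c n
  proof (induction n)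
    case 0
    have "shift (c * int 0) = id" by (auto simp: shift_shift)
    then show ?case by (simp only: commuting_id)
  next
    case (Suc n)
    have "shift (c * int (Suc n)) = shift c \<circ> shift (c * int n)"
      by (auto simp: shift_shift algebra_simps)
    then show ?case using commuting_comp[OF c Suc] by (simp only:)
  qed
  show ?thesis
  proof (cases "m \<ge> 0")
    case True
    then show ?thesis using nat[OF pos, of "nat m"] by simp
  next
    case False
    then show ?thesis using nat[OF neg, of "nat (- m)"] by simp
  qed
qed

text \<open>Regarding \<open>{0,1}\<^sup>\<int>\<close> as a module of rank 3 over \<open>\<F>\<^sub>2[t, t\<^sup>-\<^sup>1]\<close>, with \<open>t\<close> acting as \<open>shift 3\<close>,
  \<open>trv i j k\<close> is the elementary matrix with entry \<open>t ^ k\<close> in position \<open>(i, j)\<close>.\<close>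

definition trv :: "int \<Rightarrow> int \<Rightarrow> int \<Rightarrow> (int \<Rightarrow> bool) \<Rightarrow> int \<Rightarrow> bool" where
  "trv i j k y = (\<lambda>n. if n mod 3 = i then y n \<noteq> y (n - i + j + 3 * k) else y n)"

text \<open>In characteristic 2 each factor is its own inverse, so the product is the commutator of
  two elementary matrices. Three distinct indices are involved, which is why the coordinates are
  grouped modulo 3.\<close>

lemma trv_commutator:
  assumes ijl: "i \<in> {0, 1, 2}" "j \<in> {0, 1, 2}" "l \<in> {0, 1, 2}" "i \<noteq> j" "j \<noteq> l" "i \<noteq> l"
  shows "trv i j k \<circ> trv j l m \<circ> trv i j k \<circ> trv j l m = trv i l (k + m)"
proof (intro ext)
  fix y n
  define n' where "n' = n - i + j + 3 * k"
  define n'' where "n'' = n' - j + l + 3 * m"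
  define q where "q = n - j + l + 3 * m"
  have r: "n mod 3 = i \<Longrightarrow> n' mod 3 = j" "n mod 3 = i \<Longrightarrow> n'' mod 3 = l" "n mod 3 = j \<Longrightarrow> q mod 3 = l"
    unfolding n''_def n'_def q_def using ijl(1-3) by (auto, presburger+)
  have n'': "n'' = n - i + l + 3 * (k + m)" by (simp add: n''_def n'_def algebra_simps)
  have i: "trv i j k z n = (if n mod 3 = i then z n \<noteq> z n' else z n)" for z by (simp add: trv_def n'_def)
  have j: "trv j l m z n' = (if n' mod 3 = j then z n' \<noteq> z n'' else z n')" for z by (simp add: trv_def n''_def)
  have jn: "trv j l m z n = (if n mod 3 = j then z n \<noteq> z q else z n)" for z by (simp add: trv_def q_def)
  have o: "trv i j k z n' = z n'" "trv i j k z n'' = z n''" "trv j l m z n'' = z n''"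
    if "n mod 3 = i" for z
    using r(1,2)[OF that] ijl by (auto simp: trv_def)
  have oq: "trv i j k z q = z q" "trv j l m z q = z q" if "n mod 3 = j" for z
    using r(3)[OF that] ijl by (auto simp: trv_def)
  have t: "trv i l (k + m) y n = (if n mod 3 = i then y n \<noteq> y n'' else y n)" by (simp add: trv_def n'')
  consider "n mod 3 = i" | "n mod 3 = j" | "n mod 3 \<noteq> i" "n mod 3 \<noteq> j" by blast
  then show "(trv i j k \<circ> trv j l m \<circ> trv i j k \<circ> trv j l m) y n = trv i l (k + m) y n"
  proof cases
    case 1
    then show ?thesis using r(1)[OF 1] ijl(4) by (auto simp: i j jn o t)
  next
    case 2
    then show ?thesis using ijl(4) by (auto simp: i jn oq t)
  next
    case 3
    then show ?thesis by (auto simp: i jn t)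
  qed
qed

lemma trv_tau: "trv 0 1 0 = tau"
  by (intro ext) (simp add: trv_def tau_def)

text \<open>The shift by 1 rotates the three positions. Stepping from position 2 to position 0
  enters the next block, hence the exponent 1.\<close>

lemma trv_conj: "trv 1 2 0 = shift (-1) \<circ> tau \<circ> shift 1" "trv 2 0 1 = shift (-2) \<circ> tau \<circ> shift 2"
proof -
  have "(n - 1) mod 3 = 0 \<longleftrightarrow> n mod 3 = 1" "(n - 2) mod 3 = 0 \<longleftrightarrow> n mod 3 = 2" for n :: int
    by presburger+
  then show "trv 1 2 0 = shift (-1) \<circ> tau \<circ> shift 1" "trv 2 0 1 = shift (-2) \<circ> tau \<circ> shift 2"
    by (intro ext, simp add: trv_def tau_def shift_def add.commute)+
qed

text \<open>The exponent grows by one on the detour 0, 1, 2, 1: the commutator with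
  \<open>trv 1 2 0\<close> leads to \<open>trv 0 2 k\<close>, and the one with
  \<open>trv 2 1 1\<close> leads back to position 1, one block further.\<close>

lemma commuting_trv:
  assumes S: "commutes_with Omc (shift 1) \<phi>" and tau: "commutes_with Omc tau \<phi>"
  shows "trv 0 1 (int k) \<in> commuting_auts \<phi>"
proof -
  have comm: "trv i l (k + m) \<in> commuting_auts \<phi>"
    if "trv i j k \<in> commuting_auts \<phi>" "trv j l m \<in> commuting_auts \<phi>"
      "i \<in> {0, 1, 2}" "j \<in> {0, 1, 2}" "l \<in> {0, 1, 2}" "i \<noteq> j" "j \<noteq> l" "i \<noteq> l" for i j l k m
    unfolding trv_commutator[OF that(3-8), symmetric] by (intro commuting_comp that(1,2))
  have t: "tau \<in> commuting_auts \<phi>" using tau tau_mp by (simp add: commuting_auts_def)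
  have 12: "trv 1 2 0 \<in> commuting_auts \<phi>" and 20: "trv 2 0 1 \<in> commuting_auts \<phi>"
    unfolding trv_conj by (intro commuting_comp commuting_shift[OF S] t)+
  have 01: "trv 0 1 0 \<in> commuting_auts \<phi>" using t by (simp add: trv_tau)
  have 21: "trv 2 1 1 \<in> commuting_auts \<phi>" using comm[OF 20 01] by simp
  show ?thesis
  proof (induction k)
    case 0
    then show ?case using 01 by simp
  next
    case (Suc k)
    have "trv 0 2 (int k + 0) \<in> commuting_auts \<phi>" by (rule comm[OF Suc 12]) simp_all
    then have "trv 0 1 (int k + 0 + 1) \<in> commuting_auts \<phi>" by (rule comm[OF _ 21]) simp_all
    then show ?case by (simp add: add.commute)
  qed
qed

section \<open>Parities over finite sets of coordinates\<close>

definition par :: "nat set \<Rightarrow> (nat \<Rightarrow> bool) \<Rightarrow> bool" where "par K v \<longleftrightarrow> odd (card {k \<in> K. v k})"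

lemma par_empty: "\<not> par {} v" by (simp add: par_def)

lemma par_insert:
  assumes "finite K" "k \<notin> K"
  shows "par (insert k K) v \<longleftrightarrow> (par K v \<noteq> v k)"
proof (cases "v k")
  case True
  then have "{k' \<in> insert k K. v k'} = insert k {k' \<in> K. v k'}" by auto
  then show ?thesis using assms True by (simp add: par_def)
next
  case False
  then have "{k' \<in> insert k K. v k'} = {k' \<in> K. v k'}" by auto
  then show ?thesis using False by (simp add: par_def)
qed

lemma par_xor:
  assumes "finite K"
  shows "par K (\<lambda>k. u k \<noteq> v k) \<longleftrightarrow> (par K u \<noteq> par K v)"
  using assms by (induction K rule: finite_induct) (auto simp: par_empty par_insert)

text \<open>The product of the maps \<open>trv 0 1 k\<close> over \<open>k\<close> in
  \<open>K\<close> in closed form: they read coordinates 1 modulo 3 and alter only coordinates 0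
  modulo 3, so they do not interact.\<close>

definition trvs :: "nat set \<Rightarrow> (int \<Rightarrow> bool) \<Rightarrow> int \<Rightarrow> bool" where
  "trvs K y = (\<lambda>n. if n mod 3 = 0 then y n \<noteq> par K (\<lambda>k. y (n + 1 + 3 * int k)) else y n)"

lemma commuting_trvs:
  assumes S: "commutes_with Omc (shift 1) \<phi>" and tau: "commutes_with Omc tau \<phi>" and K: "finite K"
  shows "trvs K \<in> commuting_auts \<phi>"
  using K
proof (induction K rule: finite_induct)
  case empty
  have "trvs {} = id" by (auto simp: trvs_def par_empty)
  then show ?case by (simp only: commuting_id)
next
  case (insert k K)
  have "trvs (insert k K) y n = (trv 0 1 (int k) \<circ> trvs K) y n" for y n
  proof (cases "n mod 3 = 0")
    case True
    have "(n + 1 + 3 * int k) mod 3 \<noteq> 0" using True by presburger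
    then show ?thesis using True insert by (simp add: trv_def trvs_def par_insert) blast
  qed (simp add: trv_def trvs_def)
  then have "trvs (insert k K) = trv 0 1 (int k) \<circ> trvs K" by blast
  then show ?case using commuting_comp[OF commuting_trv[OF S tau] insert(3), of k] by (simp only:)
qed

lemma sum_Pow_insert:
  assumes "finite A" "a \<notin> A"
  shows "sum f (Pow (insert a A)) = sum f (Pow A) + (\<Sum>K\<in>Pow A. f (insert a K))"
proof -
  have "sum f (Pow (insert a A)) = sum f (Pow A) + sum f (insert a ` Pow A)"
    unfolding Pow_insert using assms by (intro sum.union_disjoint) auto
  also have "sum f (insert a ` Pow A) = (\<Sum>K\<in>Pow A. f (insert a K))"
  proof -
    have "inj_on (insert a) (Pow A)"
    proof (rule inj_onI)
      fix K L assume "K \<in> Pow A" "L \<in> Pow A" "insert a K = insert a L"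
      then show "K = L" using assms(2) insert_ident[of a K L] by blast
    qed
    then show ?thesis by (simp add: sum.reindex)
  qed
  finally show ?thesis .
qed

text \<open>Toggling in \<open>K\<close> an index \<open>k\<close> with \<open>v k\<close> flips the
  parity, so both parities are equally frequent. The induction follows both values of
  \<open>u\<close>, whose counts add up to \<open>2 ^ N\<close>.\<close>

lemma half_parity:
  assumes "\<exists>k<N. v k"
  shows "(\<Sum>K\<in>Pow {..<N}. of_bool (u \<noteq> par K v)) = (2 ^ N / 2 :: real)"
proof -
  define c where "c N u = (\<Sum>K\<in>Pow {..<N}. of_bool (u \<noteq> par K v) :: real)" for N u
  have step: "c (Suc N) u = c N u + c N (u \<noteq> v N)" for N u
  proof -
    have "c (Suc N) u = c N u + (\<Sum>K\<in>Pow {..<N}. of_bool (u \<noteq> par (insert N K) v))"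
      unfolding c_def lessThan_Suc by (rule sum_Pow_insert) simp_all
    also have "(\<Sum>K\<in>Pow {..<N}. of_bool (u \<noteq> par (insert N K) v)) = c N (u \<noteq> v N)"
      unfolding c_def
    proof (rule sum.cong[OF refl])
      fix K assume K: "K \<in> Pow {..<N}"
      then have "finite K" "N \<notin> K" using finite_subset[of K "{..<N}"] by auto
      then show "of_bool (u \<noteq> par (insert N K) v) = (of_bool ((u \<noteq> v N) \<noteq> par K v) :: real)"
        by (auto simp: par_insert)
    qed
    finally show ?thesis .
  qed
  have total: "c N u + c N (\<not> u) = 2 ^ N" for N u
  proof -
    have "c N u + c N (\<not> u) = (\<Sum>K\<in>Pow {..<N}. 1)"
      unfolding c_def sum.distrib[symmetric] by (intro sum.cong refl) auto
    then show ?thesis by (simp add: card_Pow)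
  qed
  have "(\<exists>k<N. v k) \<longrightarrow> c N u = 2 ^ N / 2" for u
  proof (induction N arbitrary: u)
    case (Suc N)
    show ?case
    proof (cases "v N")
      case True
      then show ?thesis using step[of N u] total[of N u] by (cases u) simp_all
    next
      case False
      then have "(u \<noteq> v N) = u" by simp
      then show ?thesis using step[of N u] Suc[of u] False by (auto simp: less_Suc_eq)
    qed
  qed simp
  then show ?thesis using assms unfolding c_def by blast
qed

lemma coord_Omc:
  assumes "\<phi> \<in> mp_auts Omc"
  shows "(\<lambda>x. \<phi> x i) \<in> measurable Omc (count_space UNIV)"
  by (rule measurable_compose[OF mp_autsD(1)[OF assms] measurable_completion[OF coord_measurable]])

lemma commutant_gap:
  assumes \<phi>: "\<phi> \<in> mp_auts Omc" "commutes_with Omc (shift 1) \<phi>" "commutes_with Omc tau \<phi>"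
    and \<psi>: "\<psi> \<in> mp_auts Omc" "commutes_with Omc (shift 1) \<psi>" "commutes_with Omc tau \<psi>"
    and small: "measure Omc {x. \<phi> x 0 \<noteq> \<psi> x 0} < 1/6"
  shows "AE x in Omc. \<phi> x = \<psi> x"
proof -
  let ?P = "measure Omc"
  define D where "D i = {x. \<phi> x i \<noteq> \<psi> x i}" for i
  define p where "p = ?P (D 0)"
  note [measurable] = coord_Omc[OF \<phi>(1)] coord_Omc[OF \<psi>(1)]
  have D [measurable]: "D i \<in> sets Omc" for i
  proof -
    have "{x \<in> space Omc. \<phi> x i \<noteq> \<psi> x i} \<in> sets Omc" by measurable
    then show ?thesis by (simp add: D_def)
  qed
  have both: "AE x in Omc. \<phi> (g x) = g (\<phi> x) \<and> \<psi> (g x) = g (\<psi> x)"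
    if "g \<in> commuting_auts \<phi>" "g \<in> commuting_auts \<psi>" for g
    using that unfolding commuting_auts_def commutes_with_def by auto
  have shiftD: "AE x in Omc. \<forall>i. shift m x \<in> D i \<longleftrightarrow> x \<in> D (i + m)" for m
    using both[OF commuting_shift[OF \<phi>(2)] commuting_shift[OF \<psi>(2)], of m]
    by eventually_elim (simp add: D_def shift_def)
  \<comment> \<open>Disagreement somewhere on a half-line within one residue class modulo 3. Shifts
    carry these events into one another up to null sets, so all are equally likely.\<close>
  define W where "W r = {x. \<exists>k::nat. x \<in> D (r + 3 * int k)}" for r
  have Wset [measurable]: "W r \<in> sets Omc" for r
  proof -
    have "W r = (\<Union>k. D (r + 3 * int k))" by (auto simp: W_def)
    then show ?thesis using D by auto
  qed
  have PW: "?P (W r) = ?P (W 1)" for r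
  proof -
    have "?P (W 1) = ?P (shift (r - 1) -` W 1)" using measure_vimage(1)[OF shift_mp Wset] by simp
    also have "\<dots> = ?P (W r)"
    proof (rule measure_eq_AE)
      show "AE x in Omc. x \<in> shift (r - 1) -` W 1 \<longleftrightarrow> x \<in> W r"
        using shiftD[of "r - 1"] by eventually_elim (simp add: W_def algebra_simps)
    qed (use Wset measure_vimage(2)[OF shift_mp Wset] in auto)
    finally show ?thesis by simp
  qed
  have PW1: "?P (W 1) \<le> 2 * p"
  proof -
    define WN where "WN N = {x. \<exists>k<N. x \<in> D (1 + 3 * int k)}" for N :: nat
    have WN: "WN N \<in> sets Omc" for N
    proof -
      have "WN N = (\<Union>k<N. D (1 + 3 * int k))" by (auto simp: WN_def)
      then show ?thesis using D by auto
    qed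
    have le: "?P (WN N) \<le> 2 * p" for N
    proof -
      \<comment> \<open>Disagreement at coordinate 0 after applying \<open>trvs K\<close>. Both maps
        commute with \<open>trvs K\<close>, which acts linearly on their difference, so each of
        these events has probability \<open>p\<close>.\<close>
      define S where "S K = {x. (x \<in> D 0) \<noteq> par K (\<lambda>k. x \<in> D (1 + 3 * int k))}" for K
      have S: "?P (S K) = p" "S K \<in> sets Omc" if K: "finite K" for K
      proof -
        note g = commuting_trvs[OF \<phi>(2,3) K] commuting_trvs[OF \<psi>(2,3) K]
        have gm: "trvs K \<in> mp_auts Omc" using g(1) by (simp add: commuting_auts_def)
        have v: "?P (trvs K -` D 0) = p" "trvs K -` D 0 \<in> sets Omc"
          using measure_vimage[OF gm D] by (simp_all add: p_def)
        have ae: "AE x in Omc. x \<in> trvs K -` D 0 \<longleftrightarrow> x \<in> S K"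
          using both[OF g]
        proof eventually_elim
          case (elim x)
          have "par K (\<lambda>k. x \<in> D (1 + 3 * int k)) \<longleftrightarrow> (par K (\<lambda>k. \<phi> x (1 + 3 * int k)) \<noteq> par K (\<lambda>k. \<psi> x (1 + 3 * int k)))"
            unfolding D_def mem_Collect_eq by (rule par_xor[OF K])
          then show ?case using elim by (auto simp: S_def D_def trvs_def)
        qed
        show Ss: "S K \<in> sets Omc"
        proof -
          show ?thesis by (rule completion.in_sets_AE[OF ae v(2)]) simp
        qed
        show "?P (S K) = p" using v measure_eq_AE[OF ae v(2) Ss] by simp
      qed
      have fin: "finite K" if "K \<in> Pow {..<N}" for K using that finite_subset[of K "{..<N}"] by auto
      \<comment> \<open>By \<open>half_parity\<close> each point of \<open>WN N\<close> lies in
        exactly half of the \<open>2 ^ N\<close> sets \<open>S K\<close>; integrating this count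
        bounds the measure of \<open>WN N\<close> by \<open>2 * p\<close>.\<close>
      have "2 ^ N / 2 * ?P (WN N) = (\<integral>x. 2 ^ N / 2 * indicator (WN N) x \<partial>Omc)"
        using WN by simp
      also have "\<dots> \<le> (\<integral>x. (\<Sum>K\<in>Pow {..<N}. indicator (S K) x) \<partial>Omc)"
      proof (rule integral_mono)
        show "integrable Omc (\<lambda>x. 2 ^ N / 2 * indicator (WN N) x :: real)"
          using WN by (intro integrable_mult_right integrable_real_indicator) (auto simp: Omc.emeasure_eq_measure)
        show "integrable Omc (\<lambda>x. \<Sum>K\<in>Pow {..<N}. indicator (S K) x :: real)"
          using S fin by (intro Bochner_Integration.integrable_sum integrable_real_indicator) (auto simp: Omc.emeasure_eq_measure)
        fix x
        have i: "indicator (S K) x = (of_bool ((x \<in> D 0) \<noteq> par K (\<lambda>k. x \<in> D (1 + 3 * int k))) :: real)" for K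
          by (simp add: S_def indicator_def)
        show "2 ^ N / 2 * indicator (WN N) x \<le> (\<Sum>K\<in>Pow {..<N}. indicator (S K) x :: real)"
        proof (cases "x \<in> WN N")
          case True
          then show ?thesis unfolding i by (subst half_parity) (auto simp: WN_def)
        next
          case False
          then show ?thesis by (simp add: sum_nonneg)
        qed
      qed
      also have "\<dots> = (\<Sum>K\<in>Pow {..<N}. \<integral>x. indicator (S K) x \<partial>Omc)"
        using S fin by (intro Bochner_Integration.integral_sum integrable_real_indicator) (auto simp: Omc.emeasure_eq_measure)
      also have "\<dots> = (\<Sum>K\<in>Pow {..<N}. p)"
        using S fin by (intro sum.cong refl) simp
      also have "\<dots> = 2 ^ N * p" by (simp add: card_Pow)
      finally show ?thesis by (simp add: field_simps)
    qed
    have "(\<lambda>N. ?P (WN N)) \<longlonglongrightarrow> ?P (\<Union>N. WN N)"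
    proof (rule Omc.finite_Lim_measure_incseq)
      show "range WN \<subseteq> sets Omc" using WN by blast
      show "incseq WN" unfolding incseq_def WN_def using order_less_le_trans by blast
    qed
    moreover have "(\<Union>N. WN N) = W 1" by (auto simp: WN_def W_def)
    ultimately show ?thesis using le LIMSEQ_le_const2 by metis
  qed
  define Z where "Z = {x. \<phi> x \<noteq> \<psi> x}"
  define ZN where "ZN m = {x. \<exists>i. - int m \<le> i \<and> x \<in> D i}" for m
  have ZN: "ZN m \<in> sets Omc" for m
  proof -
    have "ZN m = (\<Union>i\<in>{- int m..}. D i)" by (auto simp: ZN_def)
    then show ?thesis using D by (auto intro!: sets.countable_UN')
  qed
  \<comment> \<open>Three residue classes contribute at most \<open>2 * p\<close> each; this is the
    origin of the threshold 1/6.\<close>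
  have "?P (ZN m) \<le> 6 * p" for m
  proof -
    have "ZN m \<subseteq> W (- int m) \<union> (W (1 - int m) \<union> W (2 - int m))"
    proof
      fix x assume "x \<in> ZN m"
      then obtain i where i: "- int m \<le> i" "x \<in> D i" by (auto simp: ZN_def)
      define q where "q = nat (i + int m)"
      have iq: "i = int q - int m" using i by (simp add: q_def)
      define k where "k = q div 3"
      have "q = 3 * k \<or> q = 3 * k + 1 \<or> q = 3 * k + 2" unfolding k_def by presburger
      then have "i = - int m + 3 * int k \<or> i = 1 - int m + 3 * int k \<or> i = 2 - int m + 3 * int k"
        unfolding iq by auto
      then show "x \<in> W (- int m) \<union> (W (1 - int m) \<union> W (2 - int m))" using i(2) unfolding W_def by blast
    qed
    then have "?P (ZN m) \<le> ?P (W (- int m) \<union> (W (1 - int m) \<union> W (2 - int m)))"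
      using Wset by (intro Omc.finite_measure_mono) auto
    also have "\<dots> \<le> ?P (W (- int m)) + ?P (W (1 - int m) \<union> W (2 - int m))"
      using Wset by (intro measure_Un_le) auto
    also have "?P (W (1 - int m) \<union> W (2 - int m)) \<le> ?P (W (1 - int m)) + ?P (W (2 - int m))"
      using Wset by (intro measure_Un_le) auto
    finally show ?thesis using PW[of "- int m"] PW[of "1 - int m"] PW[of "2 - int m"] PW1 by linarith
  qed
  moreover have "(\<lambda>m. ?P (ZN m)) \<longlonglongrightarrow> ?P (\<Union>m. ZN m)"
  proof (rule Omc.finite_Lim_measure_incseq)
    show "range ZN \<subseteq> sets Omc" using ZN by blast
    show "incseq ZN"
      unfolding incseq_def
    proof (intro allI impI subsetI)
      fix m n :: nat and x assume mn: "m \<le> n" and "x \<in> ZN m"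
      then obtain i where "- int m \<le> i" "x \<in> D i" by (auto simp: ZN_def)
      moreover have "- int n \<le> - int m" using mn by simp
      ultimately show "x \<in> ZN n" unfolding ZN_def using order_trans by blast
    qed
  qed
  moreover have U: "(\<Union>m. ZN m) = Z"
  proof (intro equalityI subsetI)
    fix x assume "x \<in> (\<Union>m. ZN m)"
    then show "x \<in> Z" by (auto simp: ZN_def Z_def D_def)
  next
    fix x assume "x \<in> Z"
    then obtain i where "x \<in> D i" by (auto simp: Z_def D_def fun_eq_iff)
    then have "x \<in> ZN (nat \<bar>i\<bar>)" unfolding ZN_def by (intro CollectI exI[of _ i]) auto
    then show "x \<in> (\<Union>m. ZN m)" by blast
  qed
  ultimately have PZ: "?P Z \<le> 6 * p" using LIMSEQ_le_const2 by metis
  have Zs: "Z \<in> sets Omc" using U ZN by auto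
  \<comment> \<open>Both maps commute with the shift, so the set where they disagree is invariant
    and hence null or full; measure below 1 leaves only null.\<close>
  have "AE x in Omc. shift 1 x \<in> Z \<longleftrightarrow> x \<in> Z"
    using both[OF commuting_shift[OF \<phi>(2)] commuting_shift[OF \<psi>(2)], of 1]
  proof eventually_elim
    case (elim x)
    have "shift 1 a = shift 1 b \<longleftrightarrow> a = b" for a b
    proof
      assume "shift 1 a = shift 1 b"
      then have "shift (-1) (shift 1 a) = shift (-1) (shift 1 b)" by simp
      then show "a = b" by (simp add: shift_shift)
    qed simp
    then show ?case using elim by (simp add: Z_def)
  qed
  then have "?P Z = 0 \<or> ?P Z = 1" using ergodic_shift Zs unfolding ae_ergodic_def by blast
  moreover have "p < 1/6" using small by (simp add: p_def D_def)
  ultimately have "?P Z = 0" using PZ by linarith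
  then have "AE x in Omc. x \<notin> Z"
    using Zs by (intro AE_not_in) (auto simp: null_sets_def Omc.emeasure_eq_measure)
  then show ?thesis by (simp add: Z_def)
qed

section \<open>The commutant is countably infinite\<close>

abbreviation commutant where "commutant \<equiv> sub_aut Omc (cent Omc False (shift 1) tau)"

text \<open>A class is coded by a cylinder within 1/12 of the event that coordinate 0 of the image
  is true. Two classes with the same code disagree at coordinate 0 with probability below 1/12 +
  1/12, which is the gap of \<open>commutant_gap\<close>, so they coincide.\<close>

lemma countable_commutant: "countable (carrier commutant)"
proof -
  define ok where "ok s \<phi> \<longleftrightarrow> \<phi> \<in> mp_auts Omc \<and> commutes_with Omc (shift 1) \<phi> \<and> commutes_with Omc tau \<phi>
    \<and> s = aut_class Omc \<phi>" for s \<phi>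
  have "\<forall>s\<in>carrier commutant. \<exists>\<phi>. ok s \<phi>" by (auto simp: carrier_sub_aut cent_def ok_def)
  then obtain rep where rep: "\<And>s. s \<in> carrier commutant \<Longrightarrow> ok s (rep s)" by metis
  define A where "A s = {x. rep s x 0}" for s
  have A: "A s \<in> sets Omc" if "s \<in> carrier commutant" for s
  proof -
    have [measurable]: "(\<lambda>x. rep s x 0) \<in> measurable Omc (count_space UNIV)"
      using coord_Omc rep[OF that] by (simp add: ok_def)
    have "{x \<in> space Omc. rep s x 0} \<in> sets Omc" by measurable
    then show ?thesis by (simp add: A_def)
  qed
  have "\<forall>s\<in>carrier commutant. \<exists>C. C \<in> cylinders \<and> measure Omc (symdiff (A s) C) < 1/12"
  proof
    fix s assume s: "s \<in> carrier commutant"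
    show "\<exists>C. C \<in> cylinders \<and> measure Omc (symdiff (A s) C) < 1/12"
      by (rule approx_cylinder_completion[OF A[OF s], of "1/12"]) auto
  qed
  then obtain C where C: "\<And>s. s \<in> carrier commutant \<Longrightarrow> C s \<in> cylinders \<and> measure Omc (symdiff (A s) (C s)) < 1/12"
    by metis
  have "inj_on C (carrier commutant)"
  proof (rule inj_onI)
    fix s t assume s: "s \<in> carrier commutant" and t: "t \<in> carrier commutant" and eq: "C s = C t"
    have Cs: "C s \<in> sets Omc" using cylinders_sets C[OF s] by auto
    have "{x. rep s x 0 \<noteq> rep t x 0} \<subseteq> symdiff (A s) (C s) \<union> symdiff (A t) (C s)"
      by (auto simp: A_def)
    then have "measure Omc {x. rep s x 0 \<noteq> rep t x 0} \<le> measure Omc (symdiff (A s) (C s) \<union> symdiff (A t) (C s))"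
      using A[OF s] A[OF t] Cs by (intro Omc.finite_measure_mono) auto
    also have "\<dots> \<le> measure Omc (symdiff (A s) (C s)) + measure Omc (symdiff (A t) (C s))"
      using A[OF s] A[OF t] Cs by (intro measure_Un_le) auto
    also have "\<dots> < 1/6" using C[OF s] C[OF t] eq by simp
    finally have small: "measure Omc {x. rep s x 0 \<noteq> rep t x 0} < 1/6" .
    have rs: "rep s \<in> mp_auts Omc" "commutes_with Omc (shift 1) (rep s)" "commutes_with Omc tau (rep s)" "s = aut_class Omc (rep s)"
      and rt: "rep t \<in> mp_auts Omc" "commutes_with Omc (shift 1) (rep t)" "commutes_with Omc tau (rep t)" "t = aut_class Omc (rep t)"
      using rep[OF s] rep[OF t] unfolding ok_def by blast+
    have "AE x in Omc. rep s x = rep t x"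
      by (rule commutant_gap[OF rs(1-3) rt(1-3) small])
    then have "aut_class Omc (rep s) = aut_class Omc (rep t)" using aut_class_eq_iff[OF rs(1) rt(1)] by blast
    then show "s = t" using rs(4) rt(4) by metis
  qed
  moreover have "countable (C ` carrier commutant)"
    by (rule countable_subset[OF _ countable_cylinders]) (use C in blast)
  ultimately show ?thesis using countable_image_inj_on by blast
qed

lemma shift3_tau: "shift (3 * m) (tau x) = tau (shift (3 * m) x)"
proof
  fix i
  have "(i + 3 * m) mod 3 = i mod 3" by presburger
  then show "shift (3 * m) (tau x) i = tau (shift (3 * m) x) i"
    by (simp add: shift_def tau_def ac_simps)
qed

lemma infinite_commutant: "infinite (carrier commutant)"
proof -
  define s where "s n = aut_class Omc (shift (3 * int n))" for n :: nat
  have ne: "s m \<noteq> s n" if mn: "m < n" for m n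
  proof
    assume "s m = s n"
    then have "AE x in Omc. shift (3 * int m) x = shift (3 * int n) x"
      by (simp add: s_def aut_class_eq_iff shift_mp)
    then have ae: "AE x in Omc. x (3 * int m) = x (3 * int n)"
    proof eventually_elim
      case (elim x)
      then have "shift (3 * int m) x 0 = shift (3 * int n) x 0" by simp
      then show ?case by (simp add: shift_def)
    qed
    \<comment> \<open>On this event of probability 1/4 the coordinates \<open>3 * m\<close> and
      \<open>3 * n\<close> differ.\<close>
    let ?C = "cyl {3 * int m, 3 * int n} (\<lambda>i. i = 3 * int m)"
    have C: "?C \<in> sets Om" by (rule cyl_sets) simp
    have "AE x in Omc. x \<notin> ?C" using ae by eventually_elim (use mn in \<open>auto simp: cyl_def\<close>)
    then have "measure Omc ?C = measure Omc {}" using C by (intro measure_eq_AE) auto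
    moreover have "measure Omc ?C = (1/2) ^ card {3 * int m, 3 * int n}"
      using measure_cyl[of "{3 * int m, 3 * int n}"] measure_completion[OF C] by simp
    ultimately show False by simp
  qed
  have "inj s"
  proof (rule injI)
    fix m n assume "s m = s n"
    then show "m = n" using ne[of m n] ne[of n m] by (cases m n rule: linorder_cases) auto
  qed
  moreover have "range s \<subseteq> carrier commutant"
  proof
    fix t assume "t \<in> range s"
    then obtain n where "t = aut_class Omc (shift (3 * int n))" by (auto simp: s_def)
    moreover have "cent Omc False (shift 1) tau (shift (3 * int n))"
      by (simp add: cent_def commutes_with_def shift_shift shift3_tau add.commute)
    ultimately show "t \<in> carrier commutant" using shift_mp by (auto simp: carrier_sub_aut)
  qed
  ultimately show ?thesis using range_inj_infinite infinite_super by blast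
qed


section \<open>Countable compact groups\<close>

text \<open>By Baire's theorem some point is isolated; by homogeneity the topology is discrete.\<close>

lemma countable_compact_group_finite:
  assumes "group G" and top: "group_topology G X" "Hausdorff_space X" "compact_space X"
    and count: "countable (carrier G)"
  shows "finite (carrier G)"
proof -
  interpret group G by fact
  have X: "topspace X = carrier G"
    and mult: "continuous_map (prod_topology X X) X (\<lambda>(a, b). a \<otimes>\<^bsub>G\<^esub> b)"
    using top(1) by (auto simp: group_topology_def)
  have "\<exists>c\<in>carrier G. openin X {c}"
  proof (rule ccontr)
    assume none: "\<not> (\<exists>c\<in>carrier G. openin X {c})"
    have "X interior_of \<Union>((\<lambda>c. {c}) ` carrier G) = {}"
    proof (rule Baire_category_alt)
      show "completely_metrizable_space X \<or> locally_compact_space X \<and> regular_space X"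
        using top compact_imp_locally_compact_space compact_Hausdorff_imp_regular_space by blast
      show "countable ((\<lambda>c. {c}) ` carrier G)" using count by simp
      fix T assume "T \<in> (\<lambda>c. {c}) ` carrier G"
      then obtain c where c: "c \<in> carrier G" "T = {c}" by blast
      have "closedin X {c}"
        using compactin_imp_closedin[OF top(2)] finite_imp_compactin[of "{c}" X] c X by simp
      moreover have "X interior_of {c} = {}"
      proof (rule ccontr)
        assume "X interior_of {c} \<noteq> {}"
        then have "X interior_of {c} = {c}" using interior_of_subset[of X "{c}"] by blast
        then have "openin X {c}" using openin_interior_of[of X "{c}"] by metis
        then show False using none c by blast
      qed
      ultimately show "closedin X T \<and> X interior_of T = {}" using c by simp
    qed
    moreover have "\<Union>((\<lambda>c. {c}) ` carrier G) = topspace X" using X by blast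
    ultimately have "carrier G = {}" using X interior_of_topspace[of X] by simp
    then show False using one_closed by blast
  qed
  then obtain c where c: "c \<in> carrier G" "openin X {c}" by blast
  have "openin X {b}" if b: "b \<in> carrier G" for b
  proof -
    define a where "a = c \<otimes>\<^bsub>G\<^esub> inv\<^bsub>G\<^esub> b"
    have a: "a \<in> carrier G" using b c by (simp add: a_def)
    have "continuous_map X (prod_topology X X) (\<lambda>x. (a, x))"
      using a X by (intro continuous_map_pairedI) simp_all
    from continuous_map_compose[OF this mult] have "continuous_map X X (\<lambda>x. a \<otimes>\<^bsub>G\<^esub> x)"
      by (simp add: comp_def)
    then have "openin X {x \<in> topspace X. a \<otimes>\<^bsub>G\<^esub> x \<in> {c}}"
      using c(2) openin_continuous_map_preimage by blast
    moreover have "{x \<in> topspace X. a \<otimes>\<^bsub>G\<^esub> x \<in> {c}} = {b}"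
    proof -
      have "a \<otimes>\<^bsub>G\<^esub> b = c" using b c by (simp add: a_def m_assoc)
      moreover have "x = b" if "x \<in> carrier G" "a \<otimes>\<^bsub>G\<^esub> x = c" for x
      proof -
        have "z = inv\<^bsub>G\<^esub> a \<otimes>\<^bsub>G\<^esub> c" if "z \<in> carrier G" "a \<otimes>\<^bsub>G\<^esub> z = c" for z
          using inv_solve_left[OF that(1) a c(1)] that(2) by blast
        then show ?thesis using that b \<open>a \<otimes>\<^bsub>G\<^esub> b = c\<close> by metis
      qed
      ultimately show ?thesis unfolding X using b by blast
    qed
    ultimately show ?thesis by simp
  qed
  then have "discrete_topology (carrier G) = X" using X by (simp add: discrete_topology_unique)
  then show ?thesis using top(3) compact_space_discrete_topology by metis
qed

theorem theoremA:
  shows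
    "(\<forall>(M :: 'a measure) T.
        standard_prob_space M \<and> infinite_prob_space M \<and> ergodic_aut M T \<longrightarrow>
          (\<exists>(M1 :: real measure) E1.
             ergodic_graphing M1 E1 \<and> graphing_aut_group M1 E1 \<cong> aut_T M T) \<and>
          (\<exists>(M2 :: real measure) E2.
             ergodic_graphing M2 E2 \<and> graphing_aut_group M2 E2 \<cong> aut_pm_T M T)) \<and>
     (\<exists>(M :: real measure) E.
        ergodic_graphing M E \<and>
        countable (carrier (graphing_aut_group M E)) \<and>
        infinite (carrier (graphing_aut_group M E)) \<and>
        \<not> (\<exists>X. group_topology (graphing_aut_group M E) X \<and> Hausdorff_space X \<and> compact_space X))"
proof (intro conjI allI impI)
  fix M :: "'a measure" and T
  assume "standard_prob_space M \<and> infinite_prob_space M \<and> ergodic_aut M T"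
  then have M: "standard_prob_space M" "infinite_prob_space M" "ergodic_aut M T" by blast+
  show "\<exists>(M1 :: real measure) E1. ergodic_graphing M1 E1 \<and> graphing_aut_group M1 E1 \<cong> aut_T M T"
    using ergodic_automorphism_graphings(1)[OF M] by blast
  show "\<exists>(M2 :: real measure) E2. ergodic_graphing M2 E2 \<and> graphing_aut_group M2 E2 \<cong> aut_pm_T M T"
    using ergodic_automorphism_graphings(2)[OF M] by blast
next
  obtain f where f: "iso_mod_null Omc U f" using iso_Omc_U by blast
  obtain E where E: "ergodic_graphing V E" "group (graphing_aut_group V E)" "graphing_aut_group V E \<cong> commutant"
    using graphing_of_cent[OF f shift_mp ergodic_shift tau_mp, of False] by (auto simp: tau_tau)
  then obtain h where "bij_betw h (carrier (graphing_aut_group V E)) (carrier commutant)"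
    unfolding is_iso_def iso_def by blast
  then have "countable (carrier (graphing_aut_group V E))" "infinite (carrier (graphing_aut_group V E))"
    using countable_commutant infinite_commutant bij_betw_finite
    by (metis bij_betw_def countable_image_inj_on, metis bij_betw_finite)
  then show "\<exists>(M :: real measure) E. ergodic_graphing M E \<and>
      countable (carrier (graphing_aut_group M E)) \<and> infinite (carrier (graphing_aut_group M E)) \<and>
      \<not> (\<exists>X. group_topology (graphing_aut_group M E) X \<and> Hausdorff_space X \<and> compact_space X)"
    using E(1) countable_compact_group_finite[OF E(2)] by blast
qed

end
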